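(* Let $\alpha\in(0,\frac{\pi}{2})$, let $E$ be a discrete eigenvalue of $T_\alpha$ and let $\mathcal V$ be an associated eigenfunction. Then for any $\epsilon\in(0,1)$ one has $$\int_{U_\alpha}\big(|\nabla\mathcal V|^2+|\mathcal V|^2\big)\,e^{2(1-\epsilon)\sqrt{-1-E}\,|x|}\,dx<+\infty.$$
   Context: $U_\alpha=\{(x_1,x_2)\in\mathbb R^2: |\arg(x_1+ix_2)|<\alpha\}$. $T_\alpha$ denotes the self-adjoint operator in $L^2(U_\alpha)$ associated with the closed, lower semibounded sesquilinear form $$t_\alpha(u,u)=\int_{U_\alpha}|\nabla u|^2\,dx-\int_{\partial U_\alpha}|u|^2\,ds,\qquad u\in H^1(U_\alpha),$$ where $ds$ is the one-dimensional Hausdorff measure (the Laplacian with the Robin condition $\partial_\nu u=u$). Its essential spectrum is $[-1,+\infty)$, so each discrete eigenvalue $E$ (isolated eigenvalue of finite multiplicity) satisfies $E<-1$. *)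

theory Defs
  imports "HOL-Analysis.Analysis"
begin

section \<open>Hausdorff measure\<close>

definition hausdorff1_pre :: "real \<Rightarrow> 'a::metric_space set \<Rightarrow> ennreal" where
  "hausdorff1_pre \<delta> A =
     (INF C\<in>{C :: nat \<Rightarrow> 'a set. A \<subseteq> (\<Union>n. C n) \<and> (\<forall>n. bounded (C n) \<and> diameter (C n) \<le> \<delta>)}.
        \<Sum>n. ennreal (diameter (C n)))"

definition hausdorff1_outer :: "'a::metric_space set \<Rightarrow> ennreal" where
  "hausdorff1_outer A = (SUP \<delta>\<in>{0<..}. hausdorff1_pre \<delta> A)"

text \<open>The outer measure is a metric outer measure, hence countably additive on the Borel sets, so
  \<^const>\<open>measure_of\<close> does not collapse to the null measure here.\<close>

definition hausdorff1 :: "'a::metric_space measure" where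
  "hausdorff1 = measure_of UNIV (sets borel) hausdorff1_outer"


section \<open>Square-integrable functions\<close>

text \<open>Elements of $L^2$ are represented by functions; two functions that agree almost everywhere
  represent the same element.\<close>

definition L2 :: "'a measure \<Rightarrow> ('a \<Rightarrow> 'b::euclidean_space) set" where
  "L2 M = {f \<in> borel_measurable M. integrable M (\<lambda>x. (norm (f x))\<^sup>2)}"

definition L2_inner :: "'a measure \<Rightarrow> ('a \<Rightarrow> complex) \<Rightarrow> ('a \<Rightarrow> complex) \<Rightarrow> complex" where
  "L2_inner M f g = (\<integral>x. f x * cnj (g x) \<partial>M)"

definition L2_norm :: "'a measure \<Rightarrow> ('a \<Rightarrow> complex) \<Rightarrow> real" where
  "L2_norm M f = sqrt (\<integral>x. (norm (f x))\<^sup>2 \<partial>M)"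


section \<open>Operators in $L^2$ and their spectrum\<close>

text \<open>An operator in $L^2$ is given by its graph, again in terms of representatives.\<close>

type_synonym 'a graph = "(('a \<Rightarrow> complex) \<times> ('a \<Rightarrow> complex)) set"

text \<open>The operator associated with a sesquilinear form \<open>t\<close> with form domain \<open>D\<close>
  (Kato's first representation theorem).\<close>

definition form_operator ::
  "'a measure \<Rightarrow> ('a \<Rightarrow> complex) set \<Rightarrow> (('a \<Rightarrow> complex) \<Rightarrow> ('a \<Rightarrow> complex) \<Rightarrow> complex) \<Rightarrow> 'a graph" where
  "form_operator M D t = {(u, f). u \<in> D \<and> f \<in> L2 M \<and> (\<forall>v\<in>D. t u v = L2_inner M f v)}"

text \<open>\<open>z\<close> is in the resolvent set iff \<open>T - z\<close> is a bijection from the domain of \<open>T\<close> onto $L^2$ with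
  bounded inverse; the estimate contains injectivity.\<close>

definition resolvent_set :: "'a measure \<Rightarrow> 'a graph \<Rightarrow> complex set" where
  "resolvent_set M T =
     {z. (\<forall>f\<in>L2 M. \<exists>u. (u, \<lambda>x. z * u x + f x) \<in> T) \<and>
         (\<exists>C. \<forall>(u, g)\<in>T. L2_norm M u \<le> C * L2_norm M (\<lambda>x. g x - z * u x))}"

definition spectrum :: "'a measure \<Rightarrow> 'a graph \<Rightarrow> complex set" where
  "spectrum M T = - resolvent_set M T"

definition eigenspace :: "'a graph \<Rightarrow> complex \<Rightarrow> ('a \<Rightarrow> complex) set" where
  "eigenspace T z = {u. (u, \<lambda>x. z * u x) \<in> T}"

definition is_eigenfunction :: "'a measure \<Rightarrow> 'a graph \<Rightarrow> complex \<Rightarrow> ('a \<Rightarrow> complex) \<Rightarrow> bool" where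
  "is_eigenfunction M T z u \<longleftrightarrow> u \<in> eigenspace T z \<and> \<not> (AE x in M. u x = 0)"

definition finite_multiplicity :: "'a measure \<Rightarrow> 'a graph \<Rightarrow> complex \<Rightarrow> bool" where
  "finite_multiplicity M T z \<longleftrightarrow>
     (\<exists>B. finite B \<and> B \<subseteq> eigenspace T z \<and>
        (\<forall>u\<in>eigenspace T z. \<exists>c. AE x in M. u x = (\<Sum>b\<in>B. c b * b x)))"

definition discrete_eigenvalue :: "'a measure \<Rightarrow> 'a graph \<Rightarrow> complex \<Rightarrow> bool" where
  "discrete_eigenvalue M T z \<longleftrightarrow>
     (\<exists>u. is_eigenfunction M T z u) \<and> z isolated_in spectrum M T \<and> finite_multiplicity M T z"


section \<open>The Sobolev space $H^1$ in the plane\<close>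

type_synonym plane = "real \<times> real"

definition dx1 :: "(plane \<Rightarrow> complex) \<Rightarrow> plane \<Rightarrow> complex" where
  "dx1 f x = frechet_derivative f (at x) (1, 0)"

definition dx2 :: "(plane \<Rightarrow> complex) \<Rightarrow> plane \<Rightarrow> complex" where
  "dx2 f x = frechet_derivative f (at x) (0, 1)"

primrec C_k :: "nat \<Rightarrow> (plane \<Rightarrow> complex) \<Rightarrow> bool" where
  "C_k 0 f = continuous_on UNIV f"
| "C_k (Suc k) f = ((\<forall>x. f differentiable at x) \<and> C_k k (dx1 f) \<and> C_k k (dx2 f))"

definition test_functions :: "plane set \<Rightarrow> (plane \<Rightarrow> complex) set" where
  "test_functions U =
     {\<phi>. (\<forall>k. C_k k \<phi>) \<and> compact (closure {x. \<phi> x \<noteq> 0}) \<and> closure {x. \<phi> x \<noteq> 0} \<subseteq> U}"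

text \<open>A gradient is a pair of complex numbers; the norm on \<^typ>\<open>complex \<times> complex\<close> is Euclidean.\<close>

definition is_weak_gradient ::
  "plane set \<Rightarrow> (plane \<Rightarrow> complex) \<Rightarrow> (plane \<Rightarrow> complex \<times> complex) \<Rightarrow> bool" where
  "is_weak_gradient U u g \<longleftrightarrow>
     g \<in> L2 (lebesgue_on U) \<and>
     (\<forall>\<phi>\<in>test_functions U.
        (\<integral>x. u x * dx1 \<phi> x \<partial>lebesgue_on U) = - (\<integral>x. fst (g x) * \<phi> x \<partial>lebesgue_on U) \<and>
        (\<integral>x. u x * dx2 \<phi> x \<partial>lebesgue_on U) = - (\<integral>x. snd (g x) * \<phi> x \<partial>lebesgue_on U))"

definition H1 :: "plane set \<Rightarrow> (plane \<Rightarrow> complex) set" where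
  "H1 U = {u \<in> L2 (lebesgue_on U). \<exists>g. is_weak_gradient U u g}"

definition weak_grad :: "plane set \<Rightarrow> (plane \<Rightarrow> complex) \<Rightarrow> plane \<Rightarrow> complex \<times> complex" where
  "weak_grad U u = (SOME g. is_weak_gradient U u g)"

definition H1_norm :: "plane set \<Rightarrow> (plane \<Rightarrow> complex) \<Rightarrow> real" where
  "H1_norm U u =
     sqrt (\<integral>x. (norm (weak_grad U u x))\<^sup>2 + (norm (u x))\<^sup>2 \<partial>lebesgue_on U)"

definition boundary_measure :: "plane set \<Rightarrow> plane measure" where
  "boundary_measure U = restrict_space hausdorff1 (frontier U)"

text \<open>The trace is the continuous extension of \<open>\<phi> \<mapsto> \<phi>\<close> restricted to the boundary, from the
  restrictions to \<open>U\<close> of smooth compactly supported functions on the plane (dense in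
  $H^1(U)$ for Lipschitz \<open>U\<close>) to all of $H^1(U)$.\<close>

definition is_trace :: "plane set \<Rightarrow> (plane \<Rightarrow> complex) \<Rightarrow> (plane \<Rightarrow> complex) \<Rightarrow> bool" where
  "is_trace U u h \<longleftrightarrow>
     h \<in> L2 (boundary_measure U) \<and>
     (\<exists>\<phi>. (\<forall>n::nat. \<phi> n \<in> test_functions UNIV) \<and>
        (\<lambda>n. H1_norm U (\<lambda>x. \<phi> n x - u x)) \<longlonglongrightarrow> 0 \<and>
        (\<lambda>n. L2_norm (boundary_measure U) (\<lambda>x. \<phi> n x - h x)) \<longlonglongrightarrow> 0)"

definition trace_on_boundary :: "plane set \<Rightarrow> (plane \<Rightarrow> complex) \<Rightarrow> plane \<Rightarrow> complex" where
  "trace_on_boundary U u = (SOME h. is_trace U u h)"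


section \<open>The Robin Laplacian in a sector\<close>

text \<open>The origin has to be excluded explicitly, since \<^prop>\<open>Arg 0 = 0\<close>.\<close>

definition sector :: "real \<Rightarrow> plane set" where
  "sector \<alpha> = {(x1, x2). (x1, x2) \<noteq> (0, 0) \<and> \<bar>Arg (Complex x1 x2)\<bar> < \<alpha>}"

definition robin_form :: "real \<Rightarrow> (plane \<Rightarrow> complex) \<Rightarrow> (plane \<Rightarrow> complex) \<Rightarrow> complex" where
  "robin_form \<alpha> u v =
     (let U = sector \<alpha> in
       (\<integral>x. fst (weak_grad U u x) * cnj (fst (weak_grad U v x))
            + snd (weak_grad U u x) * cnj (snd (weak_grad U v x)) \<partial>lebesgue_on U)
       - L2_inner (boundary_measure U) (trace_on_boundary U u) (trace_on_boundary U v))"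

definition robin_laplacian :: "real \<Rightarrow> plane graph" where
  "robin_laplacian \<alpha> =
     form_operator (lebesgue_on (sector \<alpha>)) (H1 (sector \<alpha>)) (robin_form \<alpha>)"

end

theory Submission
  imports Defs "HOL-Complex_Analysis.Complex_Analysis" "HOL-Real_Asymp.Real_Asymp"
begin

text \<open>The starting point is the weak form of the eigenvalue equation: \<open>V\<close> lies in $H^1(U)$ and \<open>t(V, v) = E \<langle>V, v\<rangle>\<close> for
every $v \in H^1(U)$, where \<open>U\<close> is the sector. If \<open>E \<ge> - 1\<close> the exponent in the statement is at most \<open>0\<close>,
because \<^const>\<open>sqrt\<close> is odd on negative numbers, and the claim is just \<open>V \<in> H\<^sup>1(U)\<close>. So let \<open>E < - 1\<close> and
\<open>c = (1 - \<epsilon>) sqrt (- 1 - E)\<close>; the argument is Agmon's.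

Testing with \<open>v = \<psi>\<^sup>2 V\<close>, for a bounded smooth real \<open>\<psi>\<close> with bounded gradient, gives
(\<open>eigen_identity\<close>)
  \<open>\<integral>|\<nabla>(\<psi> V)|\<^sup>2 = \<integral>|\<nabla>\<psi>|\<^sup>2 |V|\<^sup>2 + \<integral>\<^sub>\<partial>\<^sub>U |\<psi> V|\<^sup>2 + E \<integral>|\<psi> V|\<^sup>2\<close>.
The boundary term is controlled by two inequalities. Far from the corner a function that vanishes for \<open>x\<^sub>1 \<le> R\<close>
satisfies \<open>\<integral>\<^sub>\<partial>\<^sub>U |w|\<^sup>2 \<le> \<integral>|\<nabla>w|\<^sup>2 + (1 + O(1 / R)) \<integral>|w|\<^sup>2\<close> (\<open>trace_inequality_far\<close>): along a normal segment of
length \<open>\<ell>\<close> at the edge, a one-dimensional estimate loses only \<open>1 / \<ell>\<close>, and segments of length \<open>R tan \<alpha>\<close> based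
beyond distance \<open>R\<close> do not reach the axis of the sector. Without a condition on the support one still has
\<open>\<integral>\<^sub>\<partial>\<^sub>U |w|\<^sup>2 \<le> 1/2 \<integral>|\<nabla>w|\<^sup>2 + C \<integral>|w|\<^sup>2\<close> (\<open>trace_inequality_test\<close>).

With the first inequality the gradient terms cancel and
\<open>(- 1 - E - O(1 / R)) \<integral>|\<psi> V|\<^sup>2 \<le> \<integral>|\<nabla>\<psi>|\<^sup>2 |V|\<^sup>2\<close> (\<open>agmon_far\<close>). Take for \<open>\<psi>\<close> a cutoff in \<open>x\<^sub>1\<close> times a bounded weight that
increases to \<open>exp (c sqrt (1 + |x|\<^sup>2))\<close>. Outside a bounded part of the sector \<open>|\<nabla>\<psi>| \<le> (c + 1 / R) \<psi>\<close>, and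
\<open>(c + 1 / R)\<^sup>2 < - 1 - E - O(1 / R)\<close> for large \<open>R\<close>, so \<open>\<integral>|\<psi> V|\<^sup>2\<close> is bounded uniformly in the
truncation (\<open>weighted_bound\<close>). The second inequality then bounds the weighted gradient, and Fatou's lemma removes the
truncation (\<open>agmon_estimate\<close>).

To apply these inequalities to \<open>V\<close>, its trace has to exist, to be unique, and to be compatible with multiplication by
\<open>\<psi>\<close>. This rests on the density of restrictions of test functions in $H^1(U)$ (\<open>density\<close>). Since \<open>U\<close> is a convex cone,
a function on \<open>U\<close> may be averaged over \<open>x + y\<close> with \<open>y\<close> in a small compact subset of \<open>U\<close>: for \<open>x\<close> in \<open>U\<close>
the average sees values inside \<open>U\<close> alone, and it is smooth on the whole plane. The one-dimensional Hausdorff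
measure enters through the upper bound by length on each edge, which follows from coverings by short segments
(\<open>nn_integral_ray_le\<close>).\<close>

section \<open>Continuity of translations in the $L^2$ norm\<close>

text \<open>Continuity at the identity of $y \mapsto f(\cdot + y)$ in $L^1$. The $L^2$ version is deduced from this one
because Scheffe's lemma and the induction principle for integrable functions both live in $L^1$.\<close>

definition translation_continuous :: "('a::euclidean_space \<Rightarrow> 'b::euclidean_space) \<Rightarrow> bool" where
  "translation_continuous f \<longleftrightarrow>
     (\<forall>e>0. \<exists>d>0. \<forall>y. norm y < d \<longrightarrow> (\<integral>\<^sup>+x. norm (f (x + y) - f x) \<partial>lborel) < ennreal e)"

lemma nn_integral_translate:
  fixes f :: "'a::euclidean_space \<Rightarrow> ennreal"
  assumes [measurable]: "f \<in> borel_measurable borel"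
  shows "(\<integral>\<^sup>+x. f (x + y) \<partial>lborel) = (\<integral>\<^sup>+x. f x \<partial>lborel)"
proof -
  have "(\<integral>\<^sup>+x. f x \<partial>lborel) = (\<integral>\<^sup>+x. f x \<partial>distr lborel borel ((+) y))"
    by (simp add: lborel_distr_plus)
  also have "\<dots> = (\<integral>\<^sup>+x. f (y + x) \<partial>lborel)"
    by (subst nn_integral_distr) auto
  finally show ?thesis by (simp add: add.commute)
qed

text \<open>Scheffe's lemma: the translates converge pointwise and all have the same $L^1$ norm.\<close>

lemma translation_continuous_continuous:
  fixes g :: "'a::euclidean_space \<Rightarrow> 'b::euclidean_space"
  assumes cont: "continuous_on UNIV g" and int: "integrable lborel g"
  shows "translation_continuous g"
  unfolding translation_continuous_def
proof (rule ccontr)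
  have [measurable]: "g \<in> borel_measurable borel" using cont by (rule borel_measurable_continuous_onI)
  assume "\<not> (\<forall>e>0. \<exists>d>0. \<forall>y. norm y < d \<longrightarrow> (\<integral>\<^sup>+x. norm (g (x + y) - g x) \<partial>lborel) < ennreal e)"
  then obtain e where e: "e > 0"
    and *: "\<forall>d>0. \<exists>y. norm y < d \<and> \<not> (\<integral>\<^sup>+x. norm (g (x + y) - g x) \<partial>lborel) < ennreal e"
    by blast
  have "\<forall>n. \<exists>y. norm y < 1 / Suc n \<and> \<not> (\<integral>\<^sup>+x. norm (g (x + y) - g x) \<partial>lborel) < ennreal e"
    using * by simp
  then obtain y where y: "\<And>n. norm (y n) < 1 / Suc n"
    and ye: "\<And>n. \<not> (\<integral>\<^sup>+x. norm (g (x + y n) - g x) \<partial>lborel) < ennreal e"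
    by metis
  have y0: "y \<longlonglongrightarrow> 0"
    using y by (intro Lim_null_comparison[OF _ LIMSEQ_Suc[OF lim_1_over_n]]) (auto intro: always_eventually less_imp_le)
  have "(\<lambda>n. \<integral>\<^sup>+x. norm (g (x + y n) - g x) \<partial>lborel) \<longlonglongrightarrow> 0"
  proof (rule Scheffe_lemma2[OF _ int])
    show "AE x in lborel. (\<lambda>n. g (x + y n)) \<longlonglongrightarrow> g x"
    proof (rule AE_I2)
      fix x
      have "(\<lambda>n. x + y n) \<longlonglongrightarrow> x" using tendsto_add[OF tendsto_const y0, of x] by simp
      moreover have "isCont g x" using cont by (simp add: continuous_on_eq_continuous_at)
      ultimately show "(\<lambda>n. g (x + y n)) \<longlonglongrightarrow> g x" by (rule isCont_tendsto_compose[rotated])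
    qed
    show "(\<integral>\<^sup>+x. norm (g (x + y n)) \<partial>lborel) \<le> (\<integral>\<^sup>+x. norm (g x) \<partial>lborel)" for n
      by (subst nn_integral_translate[of "\<lambda>x. ennreal (norm (g x))"]) auto
  qed measurable
  then have "eventually (\<lambda>n. (\<integral>\<^sup>+x. norm (g (x + y n) - g x) \<partial>lborel) < ennreal e) sequentially"
    using e by (intro order_tendstoD) auto
  then show False using ye by (simp add: eventually_sequentially)
qed

text \<open>Translations are isometries, so the property passes to $L^1$ limits by an \<open>e / 3\<close> argument.\<close>

lemma translation_continuous_approx:
  fixes f :: "'a::euclidean_space \<Rightarrow> 'b::euclidean_space"
  assumes [measurable]: "f \<in> borel_measurable borel"
    and approx: "\<And>e. e > 0 \<Longrightarrow> \<exists>g\<in>borel_measurable borel. translation_continuous g \<and>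
           (\<integral>\<^sup>+x. norm (f x - g x) \<partial>lborel) < ennreal e"
  shows "translation_continuous f"
  unfolding translation_continuous_def
proof (intro allI impI)
  fix e :: real assume "e > 0"
  then have e3: "e / 3 > 0" by simp
  obtain g where [measurable]: "g \<in> borel_measurable borel" and g: "translation_continuous g"
    and fg: "(\<integral>\<^sup>+x. norm (f x - g x) \<partial>lborel) < ennreal (e / 3)" using approx[OF e3] by blast
  obtain d where d: "d > 0" "\<And>y. norm y < d \<Longrightarrow> (\<integral>\<^sup>+x. norm (g (x + y) - g x) \<partial>lborel) < ennreal (e / 3)"
    using g e3 unfolding translation_continuous_def by blast
  have "(\<integral>\<^sup>+x. norm (f (x + y) - f x) \<partial>lborel) < ennreal e" if "norm y < d" for y
  proof -
    have "(\<integral>\<^sup>+x. norm (f (x + y) - f x) \<partial>lborel) \<le>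
        (\<integral>\<^sup>+x. (ennreal (norm (f (x + y) - g (x + y))) + ennreal (norm (g (x + y) - g x))) + ennreal (norm (f x - g x)) \<partial>lborel)"
    proof (intro nn_integral_mono)
      fix x
      have "norm (f (x + y) - f x) \<le> norm (f (x + y) - g (x + y)) + norm (g (x + y) - g x) + norm (f x - g x)"
        by norm
      then show "ennreal (norm (f (x + y) - f x)) \<le> ennreal (norm (f (x + y) - g (x + y))) + ennreal (norm (g (x + y) - g x)) + ennreal (norm (f x - g x))"
        by (simp flip: ennreal_plus)
    qed
    also have "\<dots> = (\<integral>\<^sup>+x. norm (f (x + y) - g (x + y)) \<partial>lborel) + (\<integral>\<^sup>+x. norm (g (x + y) - g x) \<partial>lborel) + (\<integral>\<^sup>+x. norm (f x - g x) \<partial>lborel)"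
      by (subst nn_integral_add; measurable)+ 
    also have "(\<integral>\<^sup>+x. norm (f (x + y) - g (x + y)) \<partial>lborel) = (\<integral>\<^sup>+x. norm (f x - g x) \<partial>lborel)"
      by (rule nn_integral_translate[of "\<lambda>x. ennreal (norm (f x - g x))"]) measurable
    also have "(\<integral>\<^sup>+x. norm (f x - g x) \<partial>lborel) + (\<integral>\<^sup>+x. norm (g (x + y) - g x) \<partial>lborel) + (\<integral>\<^sup>+x. norm (f x - g x) \<partial>lborel)
        < ennreal (e / 3) + ennreal (e / 3) + ennreal (e / 3)"
      using fg d(2)[OF that] by (intro add_strict_mono)
    also have "\<dots> = ennreal e" using e3 by (simp flip: ennreal_plus)
    finally show ?thesis .
  qed
  then show "\<exists>d>0. \<forall>y. norm y < d \<longrightarrow> (\<integral>\<^sup>+x. norm (f (x + y) - f x) \<partial>lborel) < ennreal e"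
    using d(1) by blast
qed

lemma translation_continuous_limit:
  fixes f :: "'a::euclidean_space \<Rightarrow> 'b::euclidean_space"
  assumes [measurable]: "f \<in> borel_measurable borel" "\<And>n. s n \<in> borel_measurable borel"
    and "integrable lborel w" and tc: "\<And>n. translation_continuous (s n)"
    and lim: "\<And>x. (\<lambda>n. s n x) \<longlonglongrightarrow> f x" and dom: "\<And>n x. norm (s n x) \<le> w x"
  shows "translation_continuous f"
proof (rule translation_continuous_approx)
  fix e :: real assume e: "e > 0"
  have "(\<lambda>n. \<integral>\<^sup>+x. norm (f x - s n x) \<partial>lborel) \<longlonglongrightarrow> 0"
  proof (rule nn_integral_dominated_convergence_norm[where w=w])
    have "(\<integral>\<^sup>+x. ennreal (norm (w x)) \<partial>lborel) < \<infinity>"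
      using assms(3) by (simp add: integrable_iff_bounded)
    moreover have "norm (w x) = w x" for x using order_trans[OF norm_ge_zero dom[of 0 x]] by simp
    ultimately show "(\<integral>\<^sup>+x. ennreal (w x) \<partial>lborel) < \<infinity>" by simp
  qed (use assms(3) dom lim in auto)
  then have "eventually (\<lambda>n. (\<integral>\<^sup>+x. norm (f x - s n x) \<partial>lborel) < ennreal e) sequentially"
    using e by (intro order_tendstoD) auto
  then obtain n where "(\<integral>\<^sup>+x. norm (f x - s n x) \<partial>lborel) < ennreal e"
    by (auto simp: eventually_sequentially)
  then show "\<exists>g\<in>borel_measurable borel. translation_continuous g \<and> (\<integral>\<^sup>+x. norm (f x - g x) \<partial>lborel) < ennreal e"
    using tc by (intro bexI[of _ "s n"]) auto
qed fact

text \<open>The indicator of a compact set is the limit of the integrable continuous functions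
\<open>max 0 (1 - n dist(x, K))\<close>.\<close>

lemma translation_continuous_compact:
  fixes K :: "'a::euclidean_space set" and c :: "'b::euclidean_space"
  assumes K: "compact K"
  shows "translation_continuous (\<lambda>x. indicat_real K x *\<^sub>R c)"
proof (cases "K = {}")
  case True
  then show ?thesis by (auto simp: translation_continuous_def intro!: exI[of _ 1])
next
  case False
  have [measurable]: "K \<in> sets borel" using K by (simp add: borel_compact)
  define g where "g n x = (max 0 (1 - real n * infdist x K)) *\<^sub>R c" for n x
  have gc: "continuous_on UNIV (g n)" for n unfolding g_def by (intro continuous_intros)
  obtain r where r: "K \<subseteq> cball 0 r" using compact_imp_bounded[OF K] unfolding bounded_iff by (metis mem_cball_0 subsetI)
  \<comment> \<open>From \<open>n = 1\<close> on, the functions vanish at distance \<open>1\<close> from \<open>K\<close>, so one ball carries all of them.\<close>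
  define w where "w x = indicat_real (cball 0 (r + 1)) x * norm c" for x :: 'a
  have wi: "integrable lborel w" unfolding w_def
    by (intro integrable_mult_left integrable_real_indicator) (use emeasure_bounded_finite[OF bounded_cball, of 0 "r + 1"] in auto)
  have dom: "norm (g (Suc n) x) \<le> w x" for n x
  proof (cases "x \<in> cball 0 (r + 1)")
    case True
    have "max 0 (1 - real (Suc n) * infdist x K) \<le> 1" using infdist_nonneg[of x K] by auto
    then have "max 0 (1 - real (Suc n) * infdist x K) * norm c \<le> 1 * norm c"
      by (intro mult_right_mono) auto
    then show ?thesis using True by (simp add: g_def w_def)
  next
    case False
    obtain k where "k \<in> K" "infdist x K = dist x k"
      using infdist_attains_inf[of K x] K \<open>K \<noteq> {}\<close> compact_imp_closed by metis
    moreover have "dist x k \<ge> 1" using False r \<open>k \<in> K\<close>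
      by (smt (verit) dist_norm dist_triangle mem_cball subsetD dist_commute)
    ultimately have "real (Suc n) * infdist x K \<ge> 1"
      by (metis mult_mono' One_nat_def Suc_leI mult_1 of_nat_1 of_nat_le_iff zero_le_one zero_less_Suc)
    then show ?thesis using False by (simp add: g_def w_def)
  qed
  have gi: "integrable lborel (g (Suc n))" for n
    using wi by (rule Bochner_Integration.integrable_bound)
      (use gc dom in \<open>auto intro!: AE_I2 order_trans[OF dom] borel_measurable_continuous_onI\<close>)
  show ?thesis
  proof (rule translation_continuous_limit[where s="\<lambda>n. g (Suc n)" and w=w])
    show "(\<lambda>n. g (Suc n) x) \<longlonglongrightarrow> indicat_real K x *\<^sub>R c" for x
    proof (cases "x \<in> K")
      case True
      then show ?thesis by (simp add: g_def)
    next
      case False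
      then have p: "infdist x K > 0"
        using K \<open>K \<noteq> {}\<close> compact_imp_closed by (metis in_closed_iff_infdist_zero infdist_pos_not_in_closed)
      have "eventually (\<lambda>n. real n * infdist x K \<ge> 1) sequentially"
        using p by real_asymp
      then have "eventually (\<lambda>n. real (Suc n) * infdist x K \<ge> 1) sequentially"
        by (rule eventually_sequentially_Suc[THEN iffD2])
      then have "eventually (\<lambda>n. g (Suc n) x = indicat_real K x *\<^sub>R c) sequentially"
        by eventually_elim (use False in \<open>simp add: g_def\<close>)
      then show ?thesis by (rule tendsto_eventually)
    qed
  qed (use wi dom gc gi in \<open>auto intro!: borel_measurable_continuous_onI translation_continuous_continuous\<close>)
qed

text \<open>Inner regularity by closed sets, which are exhausted by compact ones.\<close>

lemma translation_continuous_indicator: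
  fixes S :: "'a::euclidean_space set" and c :: "'b::euclidean_space"
  assumes S[measurable]: "S \<in> sets borel" and fin: "emeasure lborel S < \<infinity>"
  shows "translation_continuous (\<lambda>x. indicat_real S x *\<^sub>R c)"
proof (rule translation_continuous_approx)
  fix e :: real assume e: "e > 0"
  define e' where "e' = e / (norm c + 1)"
  have "norm c + 1 > 0" by (smt (verit) norm_ge_zero)
  then have e': "e' > 0" using e by (simp add: e'_def)
  have "S \<in> sets lebesgue" using S by (metis sets_completionI_sets sets_lborel)
  then obtain T where T: "closed T" "T \<subseteq> S" "emeasure lebesgue (S - T) < ennreal e'"
    using sets_lebesgue_inner_closed[OF _ e'] by metis
  have [measurable]: "T \<in> sets borel" using T by auto
  have "translation_continuous (\<lambda>x. indicat_real T x *\<^sub>R c)"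
  proof (rule translation_continuous_limit[where s="\<lambda>n x. indicat_real (T \<inter> cball 0 (real n)) x *\<^sub>R c" and w="\<lambda>x. indicat_real S x * norm c"])
    show "translation_continuous (\<lambda>x. indicat_real (T \<inter> cball 0 (real n)) x *\<^sub>R c)" for n
      using T by (intro translation_continuous_compact closed_Int_compact) auto
    show "(\<lambda>n. indicat_real (T \<inter> cball 0 (real n)) x *\<^sub>R c) \<longlonglongrightarrow> indicat_real T x *\<^sub>R c" for x
    proof (rule tendsto_eventually)
      have "eventually (\<lambda>n. norm x \<le> real n) sequentially" by real_asymp
      then show "eventually (\<lambda>n. indicat_real (T \<inter> cball 0 (real n)) x *\<^sub>R c = indicat_real T x *\<^sub>R c) sequentially"
        by eventually_elim (auto simp: indicator_def)
    qed
    show "integrable lborel (\<lambda>x. indicat_real S x * norm c)"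
      using fin by (intro integrable_mult_left integrable_real_indicator) auto
  qed (use T in \<open>auto simp: indicator_def\<close>)
  moreover have "(\<integral>\<^sup>+x. norm (indicat_real S x *\<^sub>R c - indicat_real T x *\<^sub>R c) \<partial>lborel) < ennreal e"
  proof -
    have "(\<integral>\<^sup>+x. norm (indicat_real S x *\<^sub>R c - indicat_real T x *\<^sub>R c) \<partial>lborel) = (\<integral>\<^sup>+x. ennreal (norm c) * indicator (S - T) x \<partial>lborel)"
      using T(2) by (intro nn_integral_cong) (auto simp: indicator_def)
    also have "\<dots> = ennreal (norm c) * emeasure lborel (S - T)"
      by (subst nn_integral_cmult_indicator) auto
    also have "emeasure lborel (S - T) = emeasure lebesgue (S - T)" by simp
    also have "ennreal (norm c) * emeasure lebesgue (S - T) \<le> ennreal (norm c) * ennreal e'"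
      using T(3) by (intro mult_left_mono) auto
    also have "\<dots> = ennreal (norm c * e')" using e' by (simp add: ennreal_mult')
    also have "\<dots> < ennreal e" using e using \<open>norm c + 1 > 0\<close> by (intro ennreal_lessI) (auto simp: e'_def field_simps)
    finally show ?thesis .
  qed
  ultimately show "\<exists>g\<in>borel_measurable borel. translation_continuous g \<and> (\<integral>\<^sup>+x. norm (indicat_real S x *\<^sub>R c - g x) \<partial>lborel) < ennreal e"
    by (intro bexI[of _ "\<lambda>x. indicat_real T x *\<^sub>R c"]) auto
qed measurable

lemma translation_continuous_add:
  fixes f g :: "'a::euclidean_space \<Rightarrow> 'b::euclidean_space"
  assumes [measurable]: "f \<in> borel_measurable borel" "g \<in> borel_measurable borel"
    and f: "translation_continuous f" and g: "translation_continuous g"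
  shows "translation_continuous (\<lambda>x. f x + g x)"
  unfolding translation_continuous_def
proof (intro allI impI)
  fix e :: real assume e: "e > 0"
  obtain d1 where d1: "d1 > 0" "\<And>y. norm y < d1 \<Longrightarrow> (\<integral>\<^sup>+x. norm (f (x + y) - f x) \<partial>lborel) < ennreal (e / 2)"
    using f e half_gt_zero[OF e] unfolding translation_continuous_def by blast
  obtain d2 where d2: "d2 > 0" "\<And>y. norm y < d2 \<Longrightarrow> (\<integral>\<^sup>+x. norm (g (x + y) - g x) \<partial>lborel) < ennreal (e / 2)"
    using g e half_gt_zero[OF e] unfolding translation_continuous_def by blast
  have "(\<integral>\<^sup>+x. norm (f (x + y) + g (x + y) - (f x + g x)) \<partial>lborel) < ennreal e" if "norm y < min d1 d2" for y
  proof -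
    have "(\<integral>\<^sup>+x. norm (f (x + y) + g (x + y) - (f x + g x)) \<partial>lborel) \<le>
       (\<integral>\<^sup>+x. ennreal (norm (f (x + y) - f x)) + ennreal (norm (g (x + y) - g x)) \<partial>lborel)"
    proof (intro nn_integral_mono)
      fix x
      have "norm (f (x + y) + g (x + y) - (f x + g x)) \<le> norm (f (x + y) - f x) + norm (g (x + y) - g x)" by norm
      then show "ennreal (norm (f (x + y) + g (x + y) - (f x + g x))) \<le> ennreal (norm (f (x + y) - f x)) + ennreal (norm (g (x + y) - g x))"
        by (simp flip: ennreal_plus)
    qed
    also have "\<dots> = (\<integral>\<^sup>+x. norm (f (x + y) - f x) \<partial>lborel) + (\<integral>\<^sup>+x. norm (g (x + y) - g x) \<partial>lborel)"
      by (rule nn_integral_add) measurable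
    also have "\<dots> < ennreal (e / 2) + ennreal (e / 2)"
      using d1 d2 that by (intro add_strict_mono) auto
    also have "\<dots> = ennreal e" using e by (simp flip: ennreal_plus)
    finally show ?thesis .
  qed
  then show "\<exists>d>0. \<forall>y. norm y < d \<longrightarrow> (\<integral>\<^sup>+x. norm (f (x + y) + g (x + y) - (f x + g x)) \<partial>lborel) < ennreal e"
    using d1 d2 by (intro exI[of _ "min d1 d2"]) auto
qed

lemma translation_continuous_integrable:
  fixes f :: "'a::euclidean_space \<Rightarrow> 'b::euclidean_space"
  assumes "integrable lborel f"
  shows "translation_continuous f"
  using assms
proof (induction rule: integrable_induct)
  case (base S c)
  then show ?case by (intro translation_continuous_indicator) auto
next
  case (add f g)
  then show ?case by (intro translation_continuous_add) auto
next
  case (lim f s)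
  show ?case
    by (rule translation_continuous_limit[where s=s and w="\<lambda>x. 2 * norm (f x)"])
      (use lim in auto)
qed

text \<open>The map \<open>a \<mapsto> |a| a\<close> is strongly monotone. It carries $L^2$ to $L^1$, and this inequality transports convergence
back, so that translation continuity in $L^2$ needs no separate approximation argument.\<close>

lemma norm_diff_sq_le:
  fixes a b :: "'a::real_inner"
  shows "(norm (a - b))\<^sup>2 \<le> 2 * norm (norm a *\<^sub>R a - norm b *\<^sub>R b)"
proof (cases "a = b")
  case False
  then have p: "norm (a - b) > 0" by simp
  have ab: "(norm (a - b))\<^sup>2 = (norm a)\<^sup>2 + (norm b)\<^sup>2 - 2 * inner a b"
    by (simp add: power2_norm_eq_inner inner_diff inner_commute[of b a])
  have "inner (norm a *\<^sub>R a - norm b *\<^sub>R b) (a - b) =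
     (norm a + norm b) * ((norm (a - b))\<^sup>2 / 2) + (norm a + norm b) * (norm a - norm b)\<^sup>2 / 2"
    unfolding ab by (simp add: inner_diff inner_commute[of b a] dot_square_norm power2_eq_square field_simps)
  then have "(norm a + norm b) * ((norm (a - b))\<^sup>2 / 2) \<le> inner (norm a *\<^sub>R a - norm b *\<^sub>R b) (a - b)"
    by simp
  also have "\<dots> \<le> norm (norm a *\<^sub>R a - norm b *\<^sub>R b) * norm (a - b)" by (rule norm_cauchy_schwarz)
  finally have 1: "(norm a + norm b) * ((norm (a - b))\<^sup>2 / 2) \<le> norm (norm a *\<^sub>R a - norm b *\<^sub>R b) * norm (a - b)" .
  have "norm (a - b) * ((norm (a - b))\<^sup>2 / 2) \<le> (norm a + norm b) * ((norm (a - b))\<^sup>2 / 2)"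
    by (intro mult_right_mono norm_triangle_ineq4) auto
  then have "norm (a - b) * ((norm (a - b))\<^sup>2 / 2) \<le> norm (a - b) * norm (norm a *\<^sub>R a - norm b *\<^sub>R b)"
    using 1 by (simp add: mult.commute)
  then show ?thesis using p by simp
qed simp

lemma L2_translation_continuous:
  fixes f :: "'a::euclidean_space \<Rightarrow> 'b::euclidean_space"
  assumes [measurable]: "f \<in> borel_measurable borel" and int: "integrable lborel (\<lambda>x. (norm (f x))\<^sup>2)"
    and e: "e > 0"
  obtains d where "d > 0" "\<And>y. norm y < d \<Longrightarrow> (\<integral>\<^sup>+x. (norm (f (x + y) - f x))\<^sup>2 \<partial>lborel) \<le> ennreal e"
proof -
  define F where "F x = norm (f x) *\<^sub>R f x" for x
  have [measurable]: "F \<in> borel_measurable borel" unfolding F_def by measurable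
  have "integrable lborel F"
    by (rule Bochner_Integration.integrable_bound[OF int]) (auto simp: F_def power2_eq_square)
  then have "translation_continuous F" by (rule translation_continuous_integrable)
  then obtain d where d: "d > 0" "\<And>y. norm y < d \<Longrightarrow> (\<integral>\<^sup>+x. norm (F (x + y) - F x) \<partial>lborel) < ennreal (e / 2)"
    using half_gt_zero[OF e] unfolding translation_continuous_def by blast
  show ?thesis
  proof (rule that[OF d(1)])
    fix y :: 'a assume y: "norm y < d"
    have "(\<integral>\<^sup>+x. (norm (f (x + y) - f x))\<^sup>2 \<partial>lborel) \<le> (\<integral>\<^sup>+x. ennreal 2 * ennreal (norm (F (x + y) - F x)) \<partial>lborel)"
      by (intro nn_integral_mono, subst ennreal_mult'[symmetric])
        (auto intro!: ennreal_leI simp: F_def norm_diff_sq_le)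
    also have "\<dots> = ennreal 2 * (\<integral>\<^sup>+x. norm (F (x + y) - F x) \<partial>lborel)"
      by (rule nn_integral_cmult) measurable
    also have "\<dots> \<le> ennreal 2 * ennreal (e / 2)"
      using d(2)[OF y] by (intro mult_left_mono) auto
    also have "\<dots> = ennreal e" using e by (subst ennreal_mult'[symmetric]) auto
    finally show "(\<integral>\<^sup>+x. (norm (f (x + y) - f x))\<^sup>2 \<partial>lborel) \<le> ennreal e" .
  qed
qed

section \<open>Smooth functions and test functions\<close>

text \<open>All partial derivatives of all orders exist and are continuous.\<close>

definition smooth :: "(plane \<Rightarrow> complex) \<Rightarrow> bool" where
  "smooth f \<longleftrightarrow> (\<forall>k. C_k k f)"

lemma dx_has_derivative:
  assumes "(f has_derivative D) (at x)"
  shows "dx1 f x = D (1, 0)" "dx2 f x = D (0, 1)"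
  unfolding dx1_def dx2_def frechet_derivative_at[OF assms, symmetric] by simp_all

text \<open>Turns the two partial derivatives of a differentiable function into its total derivative; every rule for \<^const>\<open>dx1\<close>
and \<^const>\<open>dx2\<close> below is read off from the corresponding rule for total derivatives.\<close>

lemma has_derivative_dx:
  assumes "f differentiable at x"
  shows "(f has_derivative (\<lambda>h. fst h *\<^sub>R dx1 f x + snd h *\<^sub>R dx2 f x)) (at x)"
proof -
  let ?D = "frechet_derivative f (at x)"
  have D: "(f has_derivative ?D) (at x)" using assms by (simp add: frechet_derivative_works)
  then have lin: "linear ?D" by (rule has_derivative_linear)
  have "?D = (\<lambda>h. fst h *\<^sub>R dx1 f x + snd h *\<^sub>R dx2 f x)"
  proof
    fix h :: plane
    have "h = fst h *\<^sub>R (1, 0) + snd h *\<^sub>R (0, 1)" by (simp add: prod_eq_iff)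
    then have "?D h = ?D (fst h *\<^sub>R (1, 0) + snd h *\<^sub>R (0, 1))" by simp
    also have "\<dots> = fst h *\<^sub>R dx1 f x + snd h *\<^sub>R dx2 f x"
      by (simp only: linear_add[OF lin] linear_scale[OF lin] dx1_def dx2_def)
    finally show "?D h = fst h *\<^sub>R dx1 f x + snd h *\<^sub>R dx2 f x" .
  qed
  with D show ?thesis by simp
qed

lemma C_k_SucD: "C_k (Suc k) f \<Longrightarrow> C_k k f"
proof (induction k arbitrary: f)
  case 0
  then show ?case
    by (auto simp: continuous_on_eq_continuous_at intro: differentiable_imp_continuous_within)
next
  case (Suc k)
  from Suc.prems have "\<forall>x. f differentiable at x" "C_k (Suc k) (dx1 f)" "C_k (Suc k) (dx2 f)"
    unfolding C_k.simps(2)[of "Suc k" f] by blast+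
  then show ?case using Suc.IH unfolding C_k.simps(2)[of k f] by blast
qed

lemma C_k_const: "C_k k (\<lambda>x. c)"
proof (induction k arbitrary: c)
  case (Suc k)
  have "dx1 (\<lambda>x. c) = (\<lambda>x. 0)" "dx2 (\<lambda>x. c) = (\<lambda>x. 0)" by (auto simp: dx1_def dx2_def)
  then show ?case using Suc by simp
qed simp

lemma dx_add:
  assumes "f differentiable at x" "g differentiable at x"
  shows "dx1 (\<lambda>x. f x + g x) x = dx1 f x + dx1 g x" "dx2 (\<lambda>x. f x + g x) x = dx2 f x + dx2 g x"
  using dx_has_derivative[OF has_derivative_add[OF has_derivative_dx[OF assms(1)] has_derivative_dx[OF assms(2)]]]
  by simp_all

lemma dx_mult:
  assumes "f differentiable at x" "g differentiable at x"
  shows "dx1 (\<lambda>x. f x * g x) x = f x * dx1 g x + dx1 f x * g x"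
    "dx2 (\<lambda>x. f x * g x) x = f x * dx2 g x + dx2 f x * g x"
  using dx_has_derivative[OF has_derivative_mult[OF has_derivative_dx[OF assms(1)] has_derivative_dx[OF assms(2)]]]
  by simp_all

lemma C_k_add: "C_k k f \<Longrightarrow> C_k k g \<Longrightarrow> C_k k (\<lambda>x. f x + g x)"
proof (induction k arbitrary: f g)
  case (Suc k)
  then have d: "\<And>x. f differentiable at x" "\<And>x. g differentiable at x" by auto
  have "dx1 (\<lambda>x. f x + g x) = (\<lambda>x. dx1 f x + dx1 g x)" "dx2 (\<lambda>x. f x + g x) = (\<lambda>x. dx2 f x + dx2 g x)"
    using dx_add[OF d] by auto
  then show ?case using Suc d by (auto intro!: differentiable_add)
qed (auto intro: continuous_intros)

lemma C_k_mult: "C_k k f \<Longrightarrow> C_k k g \<Longrightarrow> C_k k (\<lambda>x. f x * g x)"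
proof (induction k arbitrary: f g)
  case (Suc k)
  then have d: "\<And>x. f differentiable at x" "\<And>x. g differentiable at x" by auto
  have "dx1 (\<lambda>x. f x * g x) = (\<lambda>x. f x * dx1 g x + dx1 f x * g x)"
    "dx2 (\<lambda>x. f x * g x) = (\<lambda>x. f x * dx2 g x + dx2 f x * g x)"
    using dx_mult[OF d] by auto
  then show ?case using Suc.prems Suc.IH C_k_SucD[OF Suc.prems(1)] C_k_SucD[OF Suc.prems(2)] d
    by (auto intro!: differentiable_mult C_k_add)
qed (auto intro: continuous_intros)

text \<open>One induction that covers exponentials, square roots and reciprocals at once: the derivative of a holomorphic
function is holomorphic on the same open set.\<close>

lemma C_k_holomorphic_compose:
  assumes "open S" "F holomorphic_on S" "range f \<subseteq> S" "C_k k f"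
  shows "C_k k (\<lambda>x. F (f x))"
  using assms(2,4)
proof (induction k arbitrary: F)
  case 0
  then have "continuous_on UNIV f" by simp
  from continuous_on_compose2[OF holomorphic_on_imp_continuous_on[OF 0(1)] this assms(3)] show ?case by simp
next
  case (Suc k)
  have fS: "f x \<in> S" for x using assms(3) by auto
  have d: "f differentiable at x" for x using Suc.prems(2) unfolding C_k.simps by blast
  have Fd: "((\<lambda>x. F (f x)) has_derivative (\<lambda>h. deriv F (f x) * (fst h *\<^sub>R dx1 f x + snd h *\<^sub>R dx2 f x))) (at x)" for x
  proof -
    have "(F has_field_derivative deriv F (f x)) (at (f x))"
      using Suc.prems(1) assms(1) fS by (rule holomorphic_derivI)
    then have "(F has_derivative (*) (deriv F (f x))) (at (f x))"
      by (simp add: has_field_derivative_def)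
    from has_derivative_compose[OF has_derivative_dx[OF d] this] show ?thesis by simp
  qed
  have "dx1 (\<lambda>x. F (f x)) = (\<lambda>x. deriv F (f x) * dx1 f x)" "dx2 (\<lambda>x. F (f x)) = (\<lambda>x. deriv F (f x) * dx2 f x)"
    using dx_has_derivative[OF Fd] by auto
  moreover have "C_k k (\<lambda>x. deriv F (f x))"
    by (rule Suc.IH[OF holomorphic_deriv[OF Suc.prems(1) assms(1)] C_k_SucD[OF Suc.prems(2)]])
  moreover have "(\<lambda>x. F (f x)) differentiable at x" for x using Fd[of x] by (rule differentiableI)
  ultimately show ?case using Suc.prems by (auto intro!: C_k_mult)
qed

lemma C_k_shift: "C_k k f \<Longrightarrow> C_k k (\<lambda>z. f (z + a))"
proof (induction k arbitrary: f)
  case 0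
  then have "continuous_on UNIV f" by simp
  from continuous_on_compose2[OF this, of UNIV "\<lambda>z. z + a"] show ?case by (simp add: continuous_intros)
next
  case (Suc k)
  have D: "((\<lambda>z. f (z + a)) has_derivative (\<lambda>h. fst h *\<^sub>R dx1 f (z + a) + snd h *\<^sub>R dx2 f (z + a))) (at z)" for z
  proof -
    have d: "f differentiable at (z + a)" using Suc.prems unfolding C_k.simps by blast
    have "((\<lambda>z. z + a) has_derivative (\<lambda>h. h)) (at z)" by (auto intro!: derivative_eq_intros)
    from has_derivative_compose[OF this has_derivative_dx[OF d]] show ?thesis .
  qed
  have "dx1 (\<lambda>z. f (z + a)) = (\<lambda>z. dx1 f (z + a))" "dx2 (\<lambda>z. f (z + a)) = (\<lambda>z. dx2 f (z + a))"
    using dx_has_derivative[OF D] by auto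
  moreover have "(\<lambda>z. f (z + a)) differentiable at z" for z using D[of z] by (rule differentiableI)
  ultimately show ?case using Suc by auto
qed

lemma smooth_const: "smooth (\<lambda>x. c)"
  and smooth_add: "smooth f \<Longrightarrow> smooth g \<Longrightarrow> smooth (\<lambda>x. f x + g x)"
  and smooth_mult: "smooth f \<Longrightarrow> smooth g \<Longrightarrow> smooth (\<lambda>x. f x * g x)"
  and smooth_shift: "smooth f \<Longrightarrow> smooth (\<lambda>z. f (z + a))"
  by (auto simp: smooth_def C_k_const C_k_add C_k_mult C_k_shift)

lemma smooth_diff: "smooth f \<Longrightarrow> smooth g \<Longrightarrow> smooth (\<lambda>x. f x - g x)"
  using smooth_add[OF _ smooth_mult[OF smooth_const[of "-1"]], of f g] by simp

lemma smooth_holomorphic_compose: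
  assumes "open S" "F holomorphic_on S" "range f \<subseteq> S" "smooth f"
  shows "smooth (\<lambda>x. F (f x))"
  using assms by (auto simp: smooth_def intro: C_k_holomorphic_compose)

lemma smooth_differentiable: "smooth f \<Longrightarrow> f differentiable at x"
  unfolding smooth_def using C_k.simps(2) by blast

lemma smooth_continuous: "smooth f \<Longrightarrow> continuous_on UNIV f"
  unfolding smooth_def using C_k.simps(1) by blast

lemma smooth_dx: "smooth f \<Longrightarrow> smooth (dx1 f)" "smooth f \<Longrightarrow> smooth (dx2 f)"
  unfolding smooth_def using C_k.simps(2) by blast+

lemma smooth_measurable [measurable_dest]: "smooth f \<Longrightarrow> f \<in> borel_measurable borel"
  using smooth_continuous borel_measurable_continuous_onI by blast

lemma dx_diff:
  assumes "f differentiable at x" "g differentiable at x"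
  shows "dx1 (\<lambda>x. f x - g x) x = dx1 f x - dx1 g x" "dx2 (\<lambda>x. f x - g x) x = dx2 f x - dx2 g x"
  using dx_has_derivative[OF has_derivative_diff[OF has_derivative_dx[OF assms(1)] has_derivative_dx[OF assms(2)]]]
  by simp_all

text \<open>A real function all of whose derivatives are supplied as a sequence \<open>F 0, F 1, ...\<close> stays smooth after an affine
function is inserted. Products of such functions are all the bumps and cutoffs that are needed.\<close>

lemma smooth_affine_compose:
  fixes F :: "nat \<Rightarrow> real \<Rightarrow> real"
  assumes F: "\<And>n t. (F n has_real_derivative F (Suc n) t) (at t)"
  shows "smooth (\<lambda>x. complex_of_real (F 0 (a * fst x + b * snd x + c)))"
proof -
  have "C_k k (\<lambda>x. complex_of_real (F n (a * fst x + b * snd x + c)))" for k n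
  proof (induction k arbitrary: n)
    case 0
    have "continuous_on UNIV (F n)"
      using F by (auto simp: continuous_on_eq_continuous_at intro: DERIV_isCont)
    from continuous_on_compose2[OF this, of UNIV "\<lambda>x. a * fst x + b * snd x + c"]
    show ?case by (simp add: continuous_intros)
  next
    case (Suc k)
    let ?f = "\<lambda>x. complex_of_real (F n (a * fst x + b * snd x + c))"
    let ?g = "\<lambda>x. complex_of_real (F (Suc n) (a * fst x + b * snd x + c))"
    have D: "(?f has_derivative (\<lambda>h. complex_of_real (F (Suc n) (a * fst x + b * snd x + c) * (a * fst h + b * snd h)))) (at x)" for x
    proof -
      have l: "((\<lambda>x. a * fst x + b * snd x + c) has_derivative (\<lambda>h. a * fst h + b * snd h)) (at x)"
        by (auto intro!: derivative_eq_intros)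
      have "((\<lambda>x. F n (a * fst x + b * snd x + c)) has_derivative (\<lambda>h. F (Suc n) (a * fst x + b * snd x + c) * (a * fst h + b * snd h))) (at x)"
        using has_derivative_compose[OF l F[of n, unfolded has_field_derivative_def]] .
      then show ?thesis by (rule has_derivative_of_real)
    qed
    have "dx1 ?f = (\<lambda>x. of_real a * ?g x)" "dx2 ?f = (\<lambda>x. of_real b * ?g x)"
      using dx_has_derivative[OF D] by (auto simp: mult.commute)
    moreover have "?f differentiable at x" for x using D[of x] by (rule differentiableI)
    ultimately show ?case using Suc by (auto intro!: C_k_mult C_k_const)
  qed
  then show ?thesis by (simp add: smooth_def)
qed

text \<open>The standard smooth function that is \<open>0\<close> on the non-positive half-line and positive beyond it.\<close>

definition flat :: "real \<Rightarrow> real" where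
  "flat t = (if t > 0 then exp (- (1 / t)) else 0)"

text \<open>The \<open>n\<close>-th derivative of \<^const>\<open>flat\<close> at \<open>t > 0\<close> is a polynomial in \<open>1 / t\<close> times \<open>exp (- (1 / t))\<close>;
this is the recursion for the polynomials.\<close>

primrec flat_poly :: "nat \<Rightarrow> real poly" where
  "flat_poly 0 = 1"
| "flat_poly (Suc n) = [:0, 0, 1:] * (flat_poly n - pderiv (flat_poly n))"

definition flat_deriv :: "nat \<Rightarrow> real \<Rightarrow> real" where
  "flat_deriv n t = (if t > 0 then poly (flat_poly n) (1 / t) * exp (- (1 / t)) else 0)"

lemma poly_times_exp_minus_tendsto_0:
  fixes p :: "real poly"
  shows "((\<lambda>y. poly p y * exp (- y)) \<longlongrightarrow> 0) at_top"
proof -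
  have "((\<lambda>y. \<Sum>i\<le>degree p. coeff p i * (y ^ i / exp y)) \<longlongrightarrow> (\<Sum>i\<le>degree p. coeff p i * 0)) at_top"
    by (intro tendsto_intros tendsto_power_div_exp_0)
  moreover have "(\<lambda>y. \<Sum>i\<le>degree p. coeff p i * (y ^ i / exp y)) = (\<lambda>y. poly p y * exp (- y))"
    by (auto simp: poly_altdef exp_minus sum_distrib_right divide_inverse mult.assoc)
  ultimately show ?thesis by simp
qed

lemma flat_deriv_has_derivative:
  "(flat_deriv n has_real_derivative flat_deriv (Suc n) t) (at t)"
proof -
  consider "t > 0" | "t < 0" | "t = 0" by linarith
  then show ?thesis
  proof cases
    case 1
    let ?p = "flat_poly n"
    have "((\<lambda>t. poly ?p (1 / t) * exp (- (1 / t))) has_real_derivative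
        (poly (pderiv ?p) (1 / t) * (- 1 / t\<^sup>2)) * exp (- (1 / t)) + (exp (- (1 / t)) * (1 / t\<^sup>2)) * poly ?p (1 / t)) (at t)"
      using 1 by (auto intro!: derivative_eq_intros DERIV_chain2[OF poly_DERIV] simp: power2_eq_square)
    also have "(poly (pderiv ?p) (1 / t) * (- 1 / t\<^sup>2)) * exp (- (1 / t)) + (exp (- (1 / t)) * (1 / t\<^sup>2)) * poly ?p (1 / t)
        = flat_deriv (Suc n) t"
      using 1 by (simp add: flat_deriv_def field_simps power2_eq_square)
    finally show ?thesis
      by (rule has_field_derivative_transform_within_open[where S="{0<..}"]) (use 1 in \<open>auto simp: flat_deriv_def\<close>)
  next
    case 2
    have "((\<lambda>t. 0) has_real_derivative 0) (at t)" by simp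
    then have "(flat_deriv n has_real_derivative 0) (at t)"
      by (rule has_field_derivative_transform_within_open[where S="{..<0}"]) (use 2 in \<open>auto simp: flat_deriv_def\<close>)
    then show ?thesis using 2 by (simp add: flat_deriv_def)
  next
    case 3
    \<comment> \<open>With \<open>y = 1 / h\<close> the difference quotient at \<open>0\<close> from the right is \<open>y p(y) exp (- y)\<close>.\<close>
    let ?q = "[:0, 1:] * flat_poly n"
    have "((\<lambda>h. poly ?q (inverse h) * exp (- inverse h)) \<longlongrightarrow> 0) (at_right 0)"
      by (rule filterlim_compose[OF poly_times_exp_minus_tendsto_0 filterlim_inverse_at_top_right])
    moreover have "eventually (\<lambda>h. poly ?q (inverse h) * exp (- inverse h) = flat_deriv n h / h) (at_right 0)"
      by (rule eventually_at_rightI[of 0 1]) (simp_all add: flat_deriv_def inverse_eq_divide)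
    ultimately have r: "((\<lambda>h. flat_deriv n h / h) \<longlongrightarrow> 0) (at_right 0)"
      by (rule Lim_transform_eventually)
    have "eventually (\<lambda>h. 0 = flat_deriv n h / h) (at_left 0)"
      by (rule eventually_at_leftI[of "-1" 0]) (simp_all add: flat_deriv_def)
    then have l: "((\<lambda>h. flat_deriv n h / h) \<longlongrightarrow> 0) (at_left 0)"
      by (rule Lim_transform_eventually[OF tendsto_const])
    have "((\<lambda>h. (flat_deriv n (0 + h) - flat_deriv n 0) / h) \<longlongrightarrow> 0) (at 0)"
      using filterlim_split_at[OF l r] by (simp add: flat_deriv_def)
    then show ?thesis using 3 by (simp add: DERIV_def flat_deriv_def)
  qed
qed

lemma smooth_flat: "smooth (\<lambda>x. complex_of_real (flat (a * fst x + b * snd x + c)))"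
proof -
  have "flat_deriv 0 = flat" by (auto simp: flat_def flat_deriv_def)
  then show ?thesis using smooth_affine_compose[of flat_deriv a b c] flat_deriv_has_derivative by simp
qed

lemma flat_nonneg [simp]: "flat t \<ge> 0" and flat_pos: "t > 0 \<Longrightarrow> flat t > 0" and flat_0: "t \<le> 0 \<Longrightarrow> flat t = 0"
  and flat_le_1: "flat t \<le> 1"
  by (auto simp: flat_def)

text \<open>Positive exactly on the open square in which \<open>a x\<^sub>1 + b\<close> and \<open>a x\<^sub>2 + c\<close> both lie strictly between \<open>0\<close> and \<open>1\<close>.\<close>

definition bump :: "real \<Rightarrow> real \<Rightarrow> real \<Rightarrow> plane \<Rightarrow> real" where
  "bump a b c x = flat (a * fst x + b) * flat (1 - (a * fst x + b)) *
     (flat (a * snd x + c) * flat (1 - (a * snd x + c)))"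

lemma smooth_bump: "smooth (\<lambda>x. complex_of_real (bump a b c x))"
proof -
  have "smooth (\<lambda>x. complex_of_real (flat (a * fst x + 0 * snd x + b)) * complex_of_real (flat (- a * fst x + 0 * snd x + (1 - b))) *
     (complex_of_real (flat (0 * fst x + a * snd x + c)) * complex_of_real (flat (0 * fst x + - a * snd x + (1 - c)))))"
    by (intro smooth_mult smooth_flat)
  then show ?thesis by (simp add: bump_def algebra_simps)
qed

lemma bump_nonneg [simp]: "bump a b c x \<ge> 0"
  by (simp add: bump_def)

lemma bump_pos: "0 < a * fst x + b \<Longrightarrow> a * fst x + b < 1 \<Longrightarrow> 0 < a * snd x + c \<Longrightarrow> a * snd x + c < 1 \<Longrightarrow> bump a b c x > 0"
  by (auto simp: bump_def intro!: mult_pos_pos flat_pos)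

lemma bump_support:
  assumes "a > 0"
  shows "closure {x. complex_of_real (bump a b c x) \<noteq> 0} \<subseteq> cbox (- b / a, - c / a) ((1 - b) / a, (1 - c) / a)"
proof (rule closure_minimal)
  have "0 < a * fst x + b \<and> a * fst x + b < 1 \<and> 0 < a * snd x + c \<and> a * snd x + c < 1" if "bump a b c x \<noteq> 0" for x
    using that by (auto simp: bump_def) (meson flat_0 not_le linorder_not_less diff_gt_0_iff_gt)+
  then show "{x. complex_of_real (bump a b c x) \<noteq> 0} \<subseteq> cbox (- b / a, - c / a) ((1 - b) / a, (1 - c) / a)"
    using assms by (fastforce simp: cbox_Pair_eq field_simps)
qed (rule closed_cbox)

lemma bump_test_function:
  assumes "a > 0" "cbox (- b / a, - c / a) ((1 - b) / a, (1 - c) / a) \<subseteq> U"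
  shows "(\<lambda>x. complex_of_real (bump a b c x)) \<in> test_functions U"
proof -
  have "compact (closure {x. complex_of_real (bump a b c x) \<noteq> 0})"
    using bump_support[OF assms(1), of b c] by (meson bounded_cbox bounded_subset compact_eq_bounded_closed closed_closure)
  then show ?thesis
    using smooth_bump[of a b c] bump_support[OF assms(1), of b c] assms(2)
    unfolding test_functions_def smooth_def by blast
qed

text \<open>The support condition with an arbitrary compact set in place of the closure of the non-zero set.\<close>

lemma test_functionsI:
  assumes "smooth \<phi>" "compact C" "C \<subseteq> U" "\<And>x. x \<notin> C \<Longrightarrow> \<phi> x = 0"
  shows "\<phi> \<in> test_functions U"
proof -
  have "closure {x. \<phi> x \<noteq> 0} \<subseteq> C"
    using assms by (intro closure_minimal) (auto intro: compact_imp_closed)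
  then show ?thesis
    using assms compact_Int_closed[OF assms(2) closed_closure, of "{x. \<phi> x \<noteq> 0}"]
    unfolding test_functions_def smooth_def by (auto simp: Int_absorb1)
qed

lemma test_functionsE:
  assumes "\<phi> \<in> test_functions U"
  obtains C where "smooth \<phi>" "compact C" "C \<subseteq> U" "\<And>x. x \<notin> C \<Longrightarrow> \<phi> x = 0"
proof (rule that[of "closure {x. \<phi> x \<noteq> 0}"])
  show "\<phi> x = 0" if "x \<notin> closure {x. \<phi> x \<noteq> 0}" for x using that subsetD[OF closure_subset, of x "{x. \<phi> x \<noteq> 0}"] by auto
qed (use assms in \<open>auto simp: test_functions_def smooth_def\<close>)

lemma test_functions_smooth: "\<phi> \<in> test_functions U \<Longrightarrow> smooth \<phi>"
  by (auto elim: test_functionsE)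

lemma test_functions_mult: "smooth \<psi> \<Longrightarrow> \<phi> \<in> test_functions U \<Longrightarrow> (\<lambda>x. \<psi> x * \<phi> x) \<in> test_functions U"
  by (elim test_functionsE) (auto intro!: test_functionsI smooth_mult)

lemma test_functions_diff:
  assumes "\<phi> \<in> test_functions U" "\<psi> \<in> test_functions U"
  shows "(\<lambda>x. \<phi> x - \<psi> x) \<in> test_functions U"
proof -
  obtain C where C: "smooth \<phi>" "compact C" "C \<subseteq> U" "\<And>x. x \<notin> C \<Longrightarrow> \<phi> x = 0" using test_functionsE[OF assms(1)] by blast
  obtain D where D: "smooth \<psi>" "compact D" "D \<subseteq> U" "\<And>x. x \<notin> D \<Longrightarrow> \<psi> x = 0" using test_functionsE[OF assms(2)] by blast
  show ?thesis
    by (rule test_functionsI[where C="C \<union> D"]) (use C D in \<open>auto intro!: smooth_diff\<close>)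
qed

lemma test_functions_dx:
  assumes "\<phi> \<in> test_functions U"
  shows "dx1 \<phi> \<in> test_functions U" "dx2 \<phi> \<in> test_functions U"
proof -
  obtain C where C: "smooth \<phi>" "compact C" "C \<subseteq> U" "\<And>x. x \<notin> C \<Longrightarrow> \<phi> x = 0" using test_functionsE[OF assms] by blast
  have "(\<phi> has_derivative (\<lambda>h. 0)) (at x)" if "x \<notin> C" for x
    by (rule has_derivative_transform_within_open[of "\<lambda>x. 0" _ _ _ "- C"])
      (use C that in \<open>auto intro: compact_imp_closed\<close>)
  from dx_has_derivative[OF this] show "dx1 \<phi> \<in> test_functions U" "dx2 \<phi> \<in> test_functions U"
    using C by (auto intro!: test_functionsI smooth_dx)
qed

lemma test_functions_bounded:
  assumes "\<phi> \<in> test_functions U"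
  obtains M where "M > 0" "\<And>x. norm (\<phi> x) \<le> M"
proof -
  obtain C where C: "smooth \<phi>" "compact C" "C \<subseteq> U" "\<And>x. x \<notin> C \<Longrightarrow> \<phi> x = 0" using test_functionsE[OF assms] by blast
  have "compact (\<phi> ` C)"
    using C(2) by (rule compact_continuous_image[OF continuous_on_subset[OF smooth_continuous[OF C(1)] subset_UNIV]])
  then obtain M where M: "\<And>x. x \<in> C \<Longrightarrow> norm (\<phi> x) \<le> M"
    by (meson bounded_iff compact_imp_bounded imageI)
  show ?thesis
  proof (rule that[of "\<bar>M\<bar> + 1"])
    show "norm (\<phi> x) \<le> \<bar>M\<bar> + 1" for x using M[of x] C(4)[of x] by (cases "x \<in> C") auto
  qed simp
qed

lemma test_functions_lipschitz:
  assumes "\<phi> \<in> test_functions U"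
  obtains L where "L > 0" "\<And>x y. norm (\<phi> x - \<phi> y) \<le> L * norm (x - y)"
proof -
  obtain M1 where M1: "M1 > 0" "\<And>x. norm (dx1 \<phi> x) \<le> M1" using test_functions_bounded[OF test_functions_dx(1)[OF assms]] by blast
  obtain M2 where M2: "M2 > 0" "\<And>x. norm (dx2 \<phi> x) \<le> M2" using test_functions_bounded[OF test_functions_dx(2)[OF assms]] by blast
  have sm: "smooth \<phi>" using assms by (rule test_functions_smooth)
  have "norm (\<phi> x - \<phi> y) \<le> (M1 + M2) * norm (x - y)" for x y
  proof (rule differentiable_bound[of UNIV \<phi>])
    show "(\<phi> has_derivative (\<lambda>h. fst h *\<^sub>R dx1 \<phi> x + snd h *\<^sub>R dx2 \<phi> x)) (at x within UNIV)" for x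
      using has_derivative_dx[OF smooth_differentiable[OF sm]] by simp
    show "onorm (\<lambda>h. fst h *\<^sub>R dx1 \<phi> x + snd h *\<^sub>R dx2 \<phi> x) \<le> M1 + M2" for x
    proof (rule onorm_le)
      fix h :: plane
      have "norm (fst h *\<^sub>R dx1 \<phi> x + snd h *\<^sub>R dx2 \<phi> x) \<le> norm (fst h) * norm (dx1 \<phi> x) + norm (snd h) * norm (dx2 \<phi> x)"
        by (rule order_trans[OF norm_triangle_ineq]) simp
      also have "\<dots> \<le> norm h * M1 + norm h * M2"
        using M1 M2 norm_fst_le[of "fst h" "snd h"] norm_snd_le[of "snd h" "fst h"] by (intro add_mono mult_mono) auto
      finally show "norm (fst h *\<^sub>R dx1 \<phi> x + snd h *\<^sub>R dx2 \<phi> x) \<le> (M1 + M2) * norm h" by (simp add: algebra_simps)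
    qed
  qed auto
  then show ?thesis using M1 M2 by (intro that[of "M1 + M2"]) auto
qed

lemma test_functions_support_ball:
  assumes "\<phi> \<in> test_functions U"
  obtains r where "r > 0" "\<And>x. norm x > r \<Longrightarrow> \<phi> x = 0"
proof -
  obtain C where C: "smooth \<phi>" "compact C" "C \<subseteq> U" "\<And>x. x \<notin> C \<Longrightarrow> \<phi> x = 0" using test_functionsE[OF assms] by blast
  obtain r where r: "\<And>x. x \<in> C \<Longrightarrow> norm x \<le> r" using compact_imp_bounded[OF C(2)] unfolding bounded_iff by blast
  show ?thesis
  proof (rule that[of "\<bar>r\<bar> + 1"])
    show "\<phi> x = 0" if "norm x > \<bar>r\<bar> + 1" for x using that r[of x] C(4)[of x] by force
  qed simp
qed

section \<open>Smoothing by averages\<close>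

definition locally_integrable :: "(plane \<Rightarrow> complex) \<Rightarrow> bool" where
  "locally_integrable f \<longleftrightarrow> f \<in> borel_measurable borel \<and>
     (\<forall>r. integrable lborel (\<lambda>z. indicat_real (cball 0 r) z * norm (f z)))"

text \<open>The average of \<open>f\<close> over \<open>x + y\<close> with density \<open>K y\<close>. The argument is \<open>z - x\<close>, not \<open>x - z\<close> as in a
convolution, so that a kernel supported in a convex cone samples \<open>f\<close> at points of the cone whenever \<open>x\<close> is one.\<close>

definition smoothing :: "(plane \<Rightarrow> complex) \<Rightarrow> (plane \<Rightarrow> complex) \<Rightarrow> plane \<Rightarrow> complex" where
  "smoothing K f x = (\<integral>z. K (z - x) * f z \<partial>lborel)"

lemma locally_integrable_mult_bounded:
  assumes f: "locally_integrable f" and [measurable]: "q \<in> borel_measurable borel"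
    and M: "\<And>z. norm (q z) \<le> M" and r: "\<And>z. norm z > r \<Longrightarrow> q z = 0"
  shows "integrable lborel (\<lambda>z. q z * f z)"
proof (rule Bochner_Integration.integrable_bound[where f="\<lambda>z. M * (indicat_real (cball 0 r) z * norm (f z))"])
  show "integrable lborel (\<lambda>z. M * (indicat_real (cball 0 r) z * norm (f z)))"
    using f by (simp add: locally_integrable_def)
  have [measurable]: "f \<in> borel_measurable borel" using f by (simp add: locally_integrable_def)
  show "(\<lambda>z. q z * f z) \<in> borel_measurable lborel" by measurable
  have "norm (q z * f z) \<le> norm (M * (indicat_real (cball 0 r) z * norm (f z)))" for z
  proof (cases "norm z > r")
    case False
    then have "z \<in> cball 0 r" by simp
    moreover have "norm (q z) * norm (f z) \<le> M * norm (f z)" using M by (intro mult_right_mono) auto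
    moreover have "M \<ge> 0" using order_trans[OF norm_ge_zero M] .
    ultimately show ?thesis by (simp add: norm_mult abs_mult)
  qed (simp add: r)
  then show "AE z in lborel. norm (q z * f z) \<le> norm (M * (indicat_real (cball 0 r) z * norm (f z)))" by simp
qed

lemma smoothing_integrable:
  assumes K: "K \<in> test_functions U" and f: "locally_integrable f"
  shows "integrable lborel (\<lambda>z. K (z - x) * f z)"
proof -
  obtain M where M: "M > 0" "\<And>x. norm (K x) \<le> M" using test_functions_bounded[OF K] by blast
  obtain r where r: "r > 0" "\<And>x. norm x > r \<Longrightarrow> K x = 0" using test_functions_support_ball[OF K] by blast
  have [measurable]: "K \<in> borel_measurable borel" using smooth_measurable[OF test_functions_smooth[OF K]] .
  show ?thesis
  proof (rule locally_integrable_mult_bounded[OF f, where M=M and r="r + norm x"])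
    show "K (z - x) = 0" if "norm z > r + norm x" for z
      using that norm_triangle_sub[of z x] by (intro r) linarith
  qed (use M in auto)
qed

text \<open>Differentiation under the integral. Along a sequence tending to \<open>x\<close>, the difference quotients of
the kernel minus its derivative are uniformly bounded, by the Lipschitz property, have a common compact support and tend to \<open>0\<close>
pointwise, so dominated convergence applies.\<close>

lemma smoothing_has_derivative:
  assumes K: "K \<in> test_functions U" and f: "locally_integrable f"
  shows "(smoothing K f has_derivative
     (\<lambda>h. - (fst h *\<^sub>R smoothing (dx1 K) f x + snd h *\<^sub>R smoothing (dx2 K) f x))) (at x)"
    (is "(_ has_derivative ?D) _")
proof -
  note K' = test_functions_dx[OF K]
  note sm = test_functions_smooth[OF K] test_functions_smooth[OF K'(1)] test_functions_smooth[OF K'(2)]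
  note [measurable] = smooth_measurable[OF sm(1)] smooth_measurable[OF sm(2)] smooth_measurable[OF sm(3)]
  have [measurable]: "f \<in> borel_measurable borel" using f by (simp add: locally_integrable_def)
  obtain M1 where M1: "M1 > 0" "\<And>x. norm (dx1 K x) \<le> M1" using test_functions_bounded[OF K'(1)] by blast
  obtain M2 where M2: "M2 > 0" "\<And>x. norm (dx2 K x) \<le> M2" using test_functions_bounded[OF K'(2)] by blast
  obtain L where L: "L > 0" "\<And>x y. norm (K x - K y) \<le> L * norm (x - y)" using test_functions_lipschitz[OF K] by blast
  obtain r0 where r0: "r0 > 0" "\<And>x. norm x > r0 \<Longrightarrow> K x = 0" using test_functions_support_ball[OF K] by blast
  obtain r1 where r1: "r1 > 0" "\<And>x. norm x > r1 \<Longrightarrow> dx1 K x = 0" using test_functions_support_ball[OF K'(1)] by blast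
  obtain r2 where r2: "r2 > 0" "\<And>x. norm x > r2 \<Longrightarrow> dx2 K x = 0" using test_functions_support_ball[OF K'(2)] by blast
  have blin: "bounded_linear ?D" 
    by (intro bounded_linear_minus bounded_linear_add bounded_linear_scaleR_const bounded_linear_fst bounded_linear_snd)
  have "((\<lambda>y. norm (smoothing K f y - smoothing K f x - ?D (y - x)) / norm (y - x)) \<longlongrightarrow> 0) (at x)"
    unfolding tendsto_at_iff_sequentially
  proof (intro allI impI)
    fix X :: "nat \<Rightarrow> plane"
    assume "\<forall>i. X i \<in> UNIV - {x}" and X: "X \<longlonglongrightarrow> x"
    then have Xx: "\<And>i. X i \<noteq> x" by auto
    obtain B where B: "\<And>n. norm (X n) \<le> B" using convergent_imp_Bseq[of X] X unfolding convergent_def Bseq_def by blast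
    define h where "h n = X n - x" for n
    have hpos: "norm (h n) > 0" for n using Xx[of n] by (simp add: h_def)
    \<comment> \<open>The derivative enters with a plus sign because the kernel is evaluated at \<open>z - x\<close>.\<close>
    define q where "q n z = (K (z - X n) - K (z - x) + (fst (h n) *\<^sub>R dx1 K (z - x) + snd (h n) *\<^sub>R dx2 K (z - x))) /\<^sub>R norm (h n)" for n z
    have [measurable]: "q n \<in> borel_measurable borel" for n unfolding q_def by measurable
    define R where "R = max r0 (max r1 r2) + B + norm x"
    have B0: "B \<ge> 0" using order_trans[OF norm_ge_zero B] .
    have qb: "norm (q n z) \<le> L + M1 + M2" for n z
    proof -
      have "norm (K (z - X n) - K (z - x)) \<le> L * norm (h n)"
        using L(2)[of "z - X n" "z - x"] by (simp add: h_def norm_minus_commute)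
      moreover have "norm (fst (h n) *\<^sub>R dx1 K (z - x)) \<le> norm (h n) * M1"
        unfolding norm_scaleR using M1 norm_fst_le[of "fst (h n)" "snd (h n)"] by (intro mult_mono) auto
      moreover have "norm (snd (h n) *\<^sub>R dx2 K (z - x)) \<le> norm (h n) * M2"
        unfolding norm_scaleR using M2 norm_snd_le[of "snd (h n)" "fst (h n)"] by (intro mult_mono) auto
      ultimately have "norm (K (z - X n) - K (z - x) + (fst (h n) *\<^sub>R dx1 K (z - x) + snd (h n) *\<^sub>R dx2 K (z - x)))
           \<le> norm (h n) * (L + M1 + M2)"
        by (intro order_trans[OF norm_triangle_ineq] order_trans[OF add_left_mono[OF norm_triangle_ineq]])
          (simp add: algebra_simps)
      then have "norm (K (z - X n) - K (z - x) + (fst (h n) *\<^sub>R dx1 K (z - x) + snd (h n) *\<^sub>R dx2 K (z - x))) / norm (h n) \<le> L + M1 + M2"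
        using hpos[of n] by (simp add: divide_le_eq mult.commute)
      then show ?thesis by (simp add: q_def divide_inverse mult.commute)
    qed
    have q0: "q n z = 0" if "norm z > R" for n z
    proof -
      have "norm (z - x) > max r0 (max r1 r2)" "norm (z - X n) > r0"
        using that norm_triangle_sub[of z x] norm_triangle_sub[of z "X n"] B[of n] B0 unfolding R_def
        by (smt (verit) norm_ge_zero)+
      then show ?thesis by (simp add: q_def r0 r1 r2)
    qed
    have qlim: "(\<lambda>n. q n z) \<longlonglongrightarrow> 0" for z
    proof -
      have "(K has_derivative (\<lambda>h. fst h *\<^sub>R dx1 K (z - x) + snd h *\<^sub>R dx2 K (z - x))) (at (z - x))"
        by (rule has_derivative_dx[OF smooth_differentiable[OF sm(1)]])
      then have "((\<lambda>y. norm (K y - K (z - x) - (fst (y - (z - x)) *\<^sub>R dx1 K (z - x) + snd (y - (z - x)) *\<^sub>R dx2 K (z - x))) / norm (y - (z - x))) \<longlongrightarrow> 0) (at (z - x))"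
        unfolding has_derivative_iff_norm by blast
      moreover have "filterlim (\<lambda>n. z - X n) (at (z - x)) sequentially"
        unfolding filterlim_at using X Xx by (auto intro!: tendsto_intros)
      ultimately have "(\<lambda>n. norm (K (z - X n) - K (z - x) - (fst (z - X n - (z - x)) *\<^sub>R dx1 K (z - x) + snd (z - X n - (z - x)) *\<^sub>R dx2 K (z - x))) / norm (z - X n - (z - x))) \<longlonglongrightarrow> 0"
        by (rule filterlim_compose)
      moreover have "norm (K (z - X n) - K (z - x) - (fst (z - X n - (z - x)) *\<^sub>R dx1 K (z - x) + snd (z - X n - (z - x)) *\<^sub>R dx2 K (z - x))) / norm (z - X n - (z - x)) = norm (q n z)" for n
      proof -
        have e: "z - X n - (z - x) = - h n" by (simp add: h_def)
        have "fst (- h n) *\<^sub>R dx1 K (z - x) + snd (- h n) *\<^sub>R dx2 K (z - x) = - (fst (h n) *\<^sub>R dx1 K (z - x) + snd (h n) *\<^sub>R dx2 K (z - x))"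
          by simp
        then show ?thesis unfolding e q_def norm_scaleR
          by (simp only: diff_minus_eq_add norm_minus_cancel) (simp add: divide_inverse mult.commute)
      qed
      ultimately show ?thesis by (simp add: tendsto_norm_zero_iff)
    qed
    have qi: "integrable lborel (\<lambda>z. q n z * f z)" for n
      by (rule locally_integrable_mult_bounded[OF f _ qb q0]) measurable
    have "(\<lambda>n. \<integral>z. q n z * f z \<partial>lborel) \<longlonglongrightarrow> integral\<^sup>L lborel (\<lambda>z::plane. 0)"
    proof (rule integral_dominated_convergence[where w="\<lambda>z. (L + M1 + M2) * (indicat_real (cball 0 R) z * norm (f z))"])
      show "integrable lborel (\<lambda>z. (L + M1 + M2) * (indicat_real (cball 0 R) z * norm (f z)))"
        using f by (simp add: locally_integrable_def)
      show "AE z in lborel. (\<lambda>n. q n z * f z) \<longlonglongrightarrow> 0" using qlim by (intro AE_I2 tendsto_mult_left_zero)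
      have "norm (q n z * f z) \<le> (L + M1 + M2) * (indicat_real (cball 0 R) z * norm (f z))" for n z
      proof (cases "norm z > R")
        case False
        then have "z \<in> cball 0 R" by simp
        then show ?thesis using mult_right_mono[OF qb norm_ge_zero, of n z "f z"] by (simp add: norm_mult)
      qed (use q0 in simp)
      then show "AE z in lborel. norm (q n z * f z) \<le> (L + M1 + M2) * (indicat_real (cball 0 R) z * norm (f z))" for n
        by simp
    qed measurable
    then have lim: "(\<lambda>n. \<integral>z. q n z * f z \<partial>lborel) \<longlonglongrightarrow> 0" by simp
    have eq: "norm (smoothing K f (X n) - smoothing K f x - ?D (X n - x)) / norm (X n - x) = norm (\<integral>z. q n z * f z \<partial>lborel)" for n
    proof -
      note i0 = smoothing_integrable[OF K f] and i1 = smoothing_integrable[OF K'(1) f] and i2 = smoothing_integrable[OF K'(2) f]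
      have "q n z * f z = (K (z - X n) * f z - K (z - x) * f z + (fst (h n) *\<^sub>R (dx1 K (z - x) * f z) + snd (h n) *\<^sub>R (dx2 K (z - x) * f z))) /\<^sub>R norm (h n)" for z
        by (simp add: q_def algebra_simps)
      then have "(\<integral>z. q n z * f z \<partial>lborel) = (smoothing K f (X n) - smoothing K f x + (fst (h n) *\<^sub>R smoothing (dx1 K) f x + snd (h n) *\<^sub>R smoothing (dx2 K) f x)) /\<^sub>R norm (h n)"
        unfolding smoothing_def using i0[of "X n"] i0[of x] i1[of x] i2[of x] by simp
      then show ?thesis
        by (simp only: diff_minus_eq_add norm_scaleR h_def) (simp add: divide_inverse mult.commute)
    qed
    show "((\<lambda>y. norm (smoothing K f y - smoothing K f x - ?D (y - x)) / norm (y - x)) \<circ> X) \<longlonglongrightarrow> 0"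
      using tendsto_norm_zero[OF lim] unfolding comp_def eq .
  qed
  then show ?thesis unfolding has_derivative_iff_norm using blin by blast
qed

lemma dx_smoothing:
  assumes "K \<in> test_functions U" "locally_integrable f"
  shows "dx1 (smoothing K f) x = - smoothing (dx1 K) f x" "dx2 (smoothing K f) x = - smoothing (dx2 K) f x"
  using dx_has_derivative[OF smoothing_has_derivative[OF assms]] by simp_all

lemma smooth_smoothing:
  assumes "K \<in> test_functions U" "locally_integrable f"
  shows "smooth (smoothing K f)"
proof -
  have "C_k k (smoothing K f)" if "K \<in> test_functions U" for k K
    using that
  proof (induction k arbitrary: K)
    case 0
    have "isCont (smoothing K f) x" for x
      using smoothing_has_derivative[OF 0 assms(2)] by (rule has_derivative_continuous)
    then show ?case by (simp add: continuous_on_eq_continuous_at)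
  next
    case (Suc k)
    have "dx1 (smoothing K f) = (\<lambda>x. -1 * smoothing (dx1 K) f x)" "dx2 (smoothing K f) = (\<lambda>x. -1 * smoothing (dx2 K) f x)"
      using dx_smoothing[OF Suc.prems assms(2)] by auto
    moreover have "smoothing K f differentiable at x" for x
      using smoothing_has_derivative[OF Suc.prems assms(2)] by (rule differentiableI)
    ultimately show ?case
      using C_k_mult[OF C_k_const Suc.IH[OF test_functions_dx(1)[OF Suc.prems]], of "-1"]
        C_k_mult[OF C_k_const Suc.IH[OF test_functions_dx(2)[OF Suc.prems]], of "-1"] by simp
  qed
  then show ?thesis using assms(1) by (simp add: smooth_def)
qed

lemma locally_integrable_const: "locally_integrable (\<lambda>x. c)"
  unfolding locally_integrable_def
proof (intro conjI allI)
  show "integrable lborel (\<lambda>z::plane. indicat_real (cball 0 r) z * norm c)" for r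
    using emeasure_bounded_finite[OF bounded_cball, of "0::plane" r]
    by (intro integrable_mult_left integrable_real_indicator) auto
qed simp

lemma test_functions_integrable:
  assumes "\<phi> \<in> test_functions U"
  shows "integrable lborel \<phi>"
  using smoothing_integrable[OF assms locally_integrable_const, of 0 1] by simp

lemma integral_translate:
  fixes f :: "'a::euclidean_space \<Rightarrow> 'b::{banach, second_countable_topology}"
  shows "f \<in> borel_measurable borel \<Longrightarrow> (\<integral>x. f (x + y) \<partial>lborel) = (\<integral>x. f x \<partial>lborel)"
    and integrable_translate: "f \<in> borel_measurable borel \<Longrightarrow> integrable lborel (\<lambda>x. f (x + y)) \<longleftrightarrow> integrable lborel f"
proof -
  assume [measurable]: "f \<in> borel_measurable borel"
  have "(\<integral>x. f x \<partial>lborel) = (\<integral>x. f x \<partial>distr lborel borel ((+) y))"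
    by (simp add: lborel_distr_plus)
  also have "\<dots> = (\<integral>x. f (y + x) \<partial>lborel)"
    by (subst integral_distr) auto
  finally show "(\<integral>x. f (x + y) \<partial>lborel) = (\<integral>x. f x \<partial>lborel)" by (simp add: add.commute)
  have "integrable lborel f \<longleftrightarrow> integrable (distr lborel borel ((+) y)) f"
    by (simp add: lborel_distr_plus)
  also have "\<dots> \<longleftrightarrow> integrable lborel (\<lambda>x. f (y + x))"
    by (subst integrable_distr_eq) auto
  finally show "integrable lborel (\<lambda>x. f (x + y)) \<longleftrightarrow> integrable lborel f" by (simp add: add.commute)
qed

text \<open>Smoothing a constant function gives a constant, whose derivative is \<open>0\<close>; but it is also the integral of the
derivative of the kernel.\<close>

lemma integral_dx_test_function:
  assumes "\<phi> \<in> test_functions U"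
  shows "(\<integral>x. dx1 \<phi> x \<partial>lborel) = 0" "(\<integral>x. dx2 \<phi> x \<partial>lborel) = 0"
proof -
  have [measurable]: "\<phi> \<in> borel_measurable borel" using smooth_measurable[OF test_functions_smooth[OF assms]] .
  have "smoothing \<phi> (\<lambda>x. 1) x = (\<integral>z. \<phi> z \<partial>lborel)" for x
    unfolding smoothing_def using integral_translate(1)[of \<phi> "- x"] by simp
  then have "dx1 (smoothing \<phi> (\<lambda>x. 1)) = dx1 (\<lambda>x. \<integral>z. \<phi> z \<partial>lborel)" "dx2 (smoothing \<phi> (\<lambda>x. 1)) = dx2 (\<lambda>x. \<integral>z. \<phi> z \<partial>lborel)"
    by (auto intro!: arg_cong[where f=dx1] arg_cong[where f=dx2])
  then have "dx1 (smoothing \<phi> (\<lambda>x. 1)) 0 = 0" "dx2 (smoothing \<phi> (\<lambda>x. 1)) 0 = 0"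
    by (auto simp: dx1_def dx2_def)
  then show "(\<integral>x. dx1 \<phi> x \<partial>lborel) = 0" "(\<integral>x. dx2 \<phi> x \<partial>lborel) = 0"
    unfolding dx_smoothing[OF assms locally_integrable_const] by (simp_all add: smoothing_def)
qed

text \<open>The derivative of a product with a test function integrates to \<open>0\<close>.\<close>

lemma integration_by_parts:
  assumes "\<phi> \<in> test_functions U" "smooth \<psi>"
  shows "(\<integral>x. \<psi> x * dx1 \<phi> x \<partial>lborel) = - (\<integral>x. dx1 \<psi> x * \<phi> x \<partial>lborel)"
    "(\<integral>x. \<psi> x * dx2 \<phi> x \<partial>lborel) = - (\<integral>x. dx2 \<psi> x * \<phi> x \<partial>lborel)"
proof -
  note d = smooth_differentiable[OF assms(2)] smooth_differentiable[OF test_functions_smooth[OF assms(1)]]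
  note t = test_functions_mult[OF assms(2,1)]
  note i = test_functions_integrable[OF test_functions_mult[OF assms(2) test_functions_dx(1)[OF assms(1)]]]
    test_functions_integrable[OF test_functions_mult[OF assms(2) test_functions_dx(2)[OF assms(1)]]]
    test_functions_integrable[OF test_functions_mult[OF smooth_dx(1)[OF assms(2)] assms(1)]]
    test_functions_integrable[OF test_functions_mult[OF smooth_dx(2)[OF assms(2)] assms(1)]]
  show "(\<integral>x. \<psi> x * dx1 \<phi> x \<partial>lborel) = - (\<integral>x. dx1 \<psi> x * \<phi> x \<partial>lborel)"
    "(\<integral>x. \<psi> x * dx2 \<phi> x \<partial>lborel) = - (\<integral>x. dx2 \<psi> x * \<phi> x \<partial>lborel)"
    using integral_dx_test_function[OF t] i by (simp_all add: dx_mult[OF d] eq_neg_iff_add_eq_0)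
qed

text \<open>A variance is non-negative.\<close>

lemma jensen_square:
  fixes g :: "'a \<Rightarrow> complex"
  assumes r: "integrable M r" "\<And>x. r x \<ge> 0" "(\<integral>x. r x \<partial>M) = (1::real)"
    and g: "integrable M (\<lambda>x. r x *\<^sub>R g x)" and g2: "integrable M (\<lambda>x. r x * (norm (g x))\<^sup>2)"
  shows "(norm (\<integral>x. r x *\<^sub>R g x \<partial>M))\<^sup>2 \<le> (\<integral>x. r x * (norm (g x))\<^sup>2 \<partial>M)"
proof -
  define a where "a = (\<integral>x. r x *\<^sub>R g x \<partial>M)"
  have "0 \<le> (\<integral>x. r x * (norm (g x - a))\<^sup>2 \<partial>M)" using r(2) by simp
  also have "\<dots> = (\<integral>x. r x * (norm (g x))\<^sup>2 - 2 * inner (r x *\<^sub>R g x) a + r x * (norm a)\<^sup>2 \<partial>M)"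
    by (intro Bochner_Integration.integral_cong)
      (auto simp: power2_norm_eq_inner inner_diff inner_commute algebra_simps)
  also have "\<dots> = (\<integral>x. r x * (norm (g x))\<^sup>2 \<partial>M) - 2 * (\<integral>x. inner (r x *\<^sub>R g x) a \<partial>M) + (\<integral>x. r x \<partial>M) * (norm a)\<^sup>2"
    using r(1) g2 integrable_inner_left[OF g, of a] by simp
  also have "(\<integral>x. inner (r x *\<^sub>R g x) a \<partial>M) = (norm a)\<^sup>2"
    using integral_inner_left[OF g, of a] by (simp add: a_def dot_square_norm)
  finally show ?thesis using r(3) by (simp add: a_def)
qed

definition mollifier :: "(plane \<Rightarrow> real) \<Rightarrow> bool" where
  "mollifier r \<longleftrightarrow> (\<lambda>x. complex_of_real (r x)) \<in> test_functions UNIV \<and> (\<forall>x. r x \<ge> 0) \<and> (\<integral>x. r x \<partial>lborel) = 1"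

lemma L2_locally_integrable:
  assumes [measurable]: "f \<in> borel_measurable borel" and f2: "integrable lborel (\<lambda>x. (norm (f x))\<^sup>2)"
  shows "locally_integrable f"
  unfolding locally_integrable_def
proof (intro conjI allI)
  fix r
  have [measurable]: "cball (0::plane) r \<in> sets borel" by simp
  have i: "integrable lborel (\<lambda>z::plane. indicat_real (cball 0 r) z)"
    using emeasure_bounded_finite[OF bounded_cball, of "0::plane" r] by (intro integrable_real_indicator) auto
  show "integrable lborel (\<lambda>z. indicat_real (cball 0 r) z * norm (f z))"
  proof (rule Bochner_Integration.integrable_bound[OF Bochner_Integration.integrable_add[OF i f2]])
    have "t \<le> 1 + t\<^sup>2" for t :: real
      using zero_le_power2[of "t - 1/2"] by (simp add: power2_eq_square algebra_simps)
    then show "AE z in lborel. norm (indicat_real (cball 0 r) z * norm (f z)) \<le> norm (indicat_real (cball 0 r) z + (norm (f z))\<^sup>2)"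
      by (intro AE_I2) (auto simp: indicator_def)
  qed measurable
qed fact

text \<open>Jensen's inequality bounds the squared error at \<open>x\<close> by the average of \<open>|f(x + y) - f(x)|\<^sup>2\<close> over \<open>y\<close>; Tonelli's
theorem then leaves the $L^2$ distance between \<open>f\<close> and its translates by vectors in the support.\<close>

lemma mollifier_L2_estimate:
  fixes f :: "plane \<Rightarrow> complex"
  assumes r: "mollifier r" and [measurable]: "f \<in> borel_measurable borel"
    and f2: "integrable lborel (\<lambda>x. (norm (f x))\<^sup>2)"
    and e: "\<And>y. r y \<noteq> 0 \<Longrightarrow> (\<integral>\<^sup>+x. (norm (f (x + y) - f x))\<^sup>2 \<partial>lborel) \<le> e"
  shows "(\<integral>\<^sup>+x. (norm (smoothing (\<lambda>x. complex_of_real (r x)) f x - f x))\<^sup>2 \<partial>lborel) \<le> e"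
proof -
  let ?r = "\<lambda>x. complex_of_real (r x)"
  have rt: "?r \<in> test_functions UNIV" and rn: "\<And>x. r x \<ge> 0" and r1: "(\<integral>x. r x \<partial>lborel) = 1"
    using r by (auto simp: mollifier_def)
  have [measurable]: "?r \<in> borel_measurable borel" using smooth_measurable[OF test_functions_smooth[OF rt]] .
  then have "(\<lambda>x. Re (?r x)) \<in> borel_measurable borel" by measurable
  then have [measurable]: "r \<in> borel_measurable borel" by simp
  have ri: "integrable lborel r" using integrable_Re[OF test_functions_integrable[OF rt]] by simp
  obtain M where M: "M > 0" "\<And>x. norm (?r x) \<le> M" using test_functions_bounded[OF rt] by blast
  note li = L2_locally_integrable[OF _ f2]
  have pw: "ennreal ((norm (smoothing ?r f x - f x))\<^sup>2) \<le> (\<integral>\<^sup>+y. ennreal (r y * (norm (f (x + y) - f x))\<^sup>2) \<partial>lborel)" for x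
  proof -
    have sh: "(\<lambda>y. r y *\<^sub>R f (x + y)) = (\<lambda>y. ?r (y + x - x) * f (y + x))"
      by (auto simp: scaleR_conv_of_real add.commute)
    have i1: "integrable lborel (\<lambda>y. r y *\<^sub>R f (x + y))" unfolding sh
      by (subst integrable_translate[of "\<lambda>z. ?r (z - x) * f z" x]) (auto intro!: smoothing_integrable[OF rt] li)
    have i2: "integrable lborel (\<lambda>y. r y *\<^sub>R (f (x + y) - f x))"
      using i1 ri by (simp add: scaleR_diff_right)
    have f2x: "integrable lborel (\<lambda>y. (norm (f (x + y)))\<^sup>2)"
      using integrable_translate[of "\<lambda>z. (norm (f z))\<^sup>2" x] f2 by (simp add: add.commute)
    have i3: "integrable lborel (\<lambda>y. r y * (norm (f (x + y) - f x))\<^sup>2)"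
    proof (rule Bochner_Integration.integrable_bound[where f="\<lambda>y. 2 * M * (norm (f (x + y)))\<^sup>2 + 2 * (norm (f x))\<^sup>2 * r y"])
      show "integrable lborel (\<lambda>y. 2 * M * (norm (f (x + y)))\<^sup>2 + 2 * (norm (f x))\<^sup>2 * r y)"
        using f2x ri by simp
      have "r y * (norm (f (x + y) - f x))\<^sup>2 \<le> 2 * M * (norm (f (x + y)))\<^sup>2 + 2 * (norm (f x))\<^sup>2 * r y" for y
      proof -
        have "(norm (f (x + y) - f x))\<^sup>2 \<le> (norm (f (x + y)) + norm (f x))\<^sup>2"
          by (intro power_mono norm_triangle_ineq4) auto
        also have "\<dots> \<le> 2 * (norm (f (x + y)))\<^sup>2 + 2 * (norm (f x))\<^sup>2"
          using zero_le_power2[of "norm (f (x + y)) - norm (f x)"] by (simp add: power2_eq_square algebra_simps)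
        finally have "r y * (norm (f (x + y) - f x))\<^sup>2 \<le> r y * (2 * (norm (f (x + y)))\<^sup>2) + r y * (2 * (norm (f x))\<^sup>2)"
          using mult_left_mono[OF _ rn[of y]] unfolding distrib_left[symmetric] by blast
        also have "r y * (2 * (norm (f (x + y)))\<^sup>2) \<le> M * (2 * (norm (f (x + y)))\<^sup>2)"
          using M(2)[of y] rn[of y] by (intro mult_right_mono) auto
        finally show ?thesis by (simp add: algebra_simps)
      qed
      then show "AE y in lborel. norm (r y * (norm (f (x + y) - f x))\<^sup>2) \<le> norm (2 * M * (norm (f (x + y)))\<^sup>2 + 2 * (norm (f x))\<^sup>2 * r y)"
        using rn M(1) by (intro AE_I2) (simp add: abs_of_nonneg)
    qed measurable
    have "smoothing ?r f x = (\<integral>y. r y *\<^sub>R f (x + y) \<partial>lborel)"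
      unfolding smoothing_def sh using integral_translate(1)[of "\<lambda>z. ?r (z - x) * f z" x] by simp
    also have "\<dots> - f x = (\<integral>y. r y *\<^sub>R (f (x + y) - f x) \<partial>lborel)"
      using i1 ri r1 by (simp add: scaleR_diff_right)
    finally have "(norm (smoothing ?r f x - f x))\<^sup>2 \<le> (\<integral>y. r y * (norm (f (x + y) - f x))\<^sup>2 \<partial>lborel)"
      using jensen_square[OF ri rn r1 i2 i3] by simp
    then show ?thesis
      using nn_integral_eq_integral[OF i3] rn by (simp add: ennreal_leI)
  qed
  have "(\<integral>\<^sup>+x. (norm (smoothing ?r f x - f x))\<^sup>2 \<partial>lborel) \<le> (\<integral>\<^sup>+x. \<integral>\<^sup>+y. ennreal (r y * (norm (f (x + y) - f x))\<^sup>2) \<partial>lborel \<partial>lborel)"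
    by (rule nn_integral_mono) (rule pw)
  also have "\<dots> = (\<integral>\<^sup>+y. \<integral>\<^sup>+x. ennreal (r y * (norm (f (x + y) - f x))\<^sup>2) \<partial>lborel \<partial>lborel)"
    by (rule lborel_pair.Fubini') measurable
  also have "\<dots> \<le> (\<integral>\<^sup>+y. ennreal (r y) * e \<partial>lborel)"
  proof (rule nn_integral_mono)
    fix y
    have "(\<integral>\<^sup>+x. ennreal (r y * (norm (f (x + y) - f x))\<^sup>2) \<partial>lborel) = (\<integral>\<^sup>+x. ennreal (r y) * ennreal ((norm (f (x + y) - f x))\<^sup>2) \<partial>lborel)"
      using rn by (simp add: ennreal_mult)
    also have "\<dots> = ennreal (r y) * (\<integral>\<^sup>+x. (norm (f (x + y) - f x))\<^sup>2 \<partial>lborel)"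
      by (rule nn_integral_cmult) measurable
    also have "\<dots> \<le> ennreal (r y) * e" using e[of y] by (cases "r y = 0") (auto intro!: mult_left_mono)
    finally show "(\<integral>\<^sup>+x. ennreal (r y * (norm (f (x + y) - f x))\<^sup>2) \<partial>lborel) \<le> ennreal (r y) * e" .
  qed
  also have "\<dots> = (\<integral>\<^sup>+y. ennreal (r y) \<partial>lborel) * e"
    by (rule nn_integral_multc) measurable
  also have "(\<integral>\<^sup>+y. ennreal (r y) \<partial>lborel) = 1"
    using nn_integral_eq_integral[OF ri] rn r1 by simp
  finally show ?thesis by simp
qed

section \<open>Square norms\<close>

text \<open>The square of the $L^2$ norm, for functions with values in any Euclidean space; gradients are covered as functions
with values in \<^typ>\<open>complex \<times> complex\<close>.\<close>

definition sq_norm :: "'a measure \<Rightarrow> ('a \<Rightarrow> 'b::euclidean_space) \<Rightarrow> real" where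
  "sq_norm M f = (\<integral>x. (norm (f x))\<^sup>2 \<partial>M)"

lemma sq_norm_nonneg [simp]: "sq_norm M f \<ge> 0"
  by (simp add: sq_norm_def)

lemma L2_measurable [measurable_dest]: "f \<in> L2 M \<Longrightarrow> f \<in> borel_measurable M"
  by (simp add: L2_def)

lemma L2_integrable_sq: "f \<in> L2 M \<Longrightarrow> integrable M (\<lambda>x. (norm (f x))\<^sup>2)"
  by (simp add: L2_def)

lemma L2_bound:
  assumes f: "f \<in> L2 M" and g: "g \<in> borel_measurable M"
    and le: "\<And>x. x \<in> space M \<Longrightarrow> norm (g x) \<le> B * norm (f x)"
  shows "g \<in> L2 M" "sq_norm M g \<le> B\<^sup>2 * sq_norm M f"
proof -
  have le2: "(norm (g x))\<^sup>2 \<le> B\<^sup>2 * (norm (f x))\<^sup>2" if "x \<in> space M" for x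
    using power_mono[OF le[OF that] norm_ge_zero, of 2] by (simp add: power_mult_distrib)
  have i: "integrable M (\<lambda>x. B\<^sup>2 * (norm (f x))\<^sup>2)" using L2_integrable_sq[OF f] by simp
  have "integrable M (\<lambda>x. (norm (g x))\<^sup>2)"
    by (rule Bochner_Integration.integrable_bound[OF i]) (use g le2 in \<open>auto intro!: AE_I2\<close>)
  then show "g \<in> L2 M" using g by (simp add: L2_def)
  have "sq_norm M g \<le> (\<integral>x. B\<^sup>2 * (norm (f x))\<^sup>2 \<partial>M)"
    unfolding sq_norm_def using i \<open>integrable M (\<lambda>x. (norm (g x))\<^sup>2)\<close> le2 by (intro integral_mono) auto
  then show "sq_norm M g \<le> B\<^sup>2 * sq_norm M f" by (simp add: sq_norm_def)
qed

lemma norm_sum_sq_le: "(norm (a + b))\<^sup>2 \<le> 2 * (norm a)\<^sup>2 + 2 * (norm (b :: 'b::real_normed_vector))\<^sup>2"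
proof -
  have "(norm (a + b))\<^sup>2 \<le> (norm a + norm b)\<^sup>2" by (intro power_mono norm_triangle_ineq) auto
  also have "\<dots> \<le> 2 * (norm a)\<^sup>2 + 2 * (norm b)\<^sup>2"
    using zero_le_power2[of "norm a - norm b"] by (simp add: power2_eq_square algebra_simps)
  finally show ?thesis .
qed

lemma L2_add:
  fixes f g :: "'a \<Rightarrow> 'b::euclidean_space"
  assumes f: "f \<in> L2 M" and g: "g \<in> L2 M"
  shows "(\<lambda>x. f x + g x) \<in> L2 M" "sq_norm M (\<lambda>x. f x + g x) \<le> 2 * sq_norm M f + 2 * sq_norm M g"
proof -
  have [measurable]: "f \<in> borel_measurable M" "g \<in> borel_measurable M" using f g by (auto simp: L2_def)
  have i: "integrable M (\<lambda>x. 2 * (norm (f x))\<^sup>2 + 2 * (norm (g x))\<^sup>2)"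
    using f g by (simp add: L2_def)
  have i2: "integrable M (\<lambda>x. (norm (f x + g x))\<^sup>2)"
    by (rule Bochner_Integration.integrable_bound[OF i]) (auto intro!: AE_I2 norm_sum_sq_le)
  then show "(\<lambda>x. f x + g x) \<in> L2 M" by (simp add: L2_def)
  have "sq_norm M (\<lambda>x. f x + g x) \<le> (\<integral>x. 2 * (norm (f x))\<^sup>2 + 2 * (norm (g x))\<^sup>2 \<partial>M)"
    unfolding sq_norm_def by (rule integral_mono[OF i2 i]) (rule norm_sum_sq_le)
  also have "\<dots> = 2 * sq_norm M f + 2 * sq_norm M g"
    using f g by (simp add: L2_def sq_norm_def)
  finally show "sq_norm M (\<lambda>x. f x + g x) \<le> 2 * sq_norm M f + 2 * sq_norm M g" .
qed

lemma L2_uminus: "f \<in> L2 M \<Longrightarrow> (\<lambda>x. - f x) \<in> L2 M"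
  by (simp add: L2_def)

lemma L2_diff:
  fixes f g :: "'a \<Rightarrow> 'b::euclidean_space"
  assumes f: "f \<in> L2 M" and g: "g \<in> L2 M"
  shows "(\<lambda>x. f x - g x) \<in> L2 M" "sq_norm M (\<lambda>x. f x - g x) \<le> 2 * sq_norm M f + 2 * sq_norm M g"
  using L2_add[OF f L2_uminus[OF g]] by (simp_all add: sq_norm_def)

lemma sq_norm_commute: "sq_norm M (\<lambda>x. f x - g x) = sq_norm M (\<lambda>x. g x - f x)"
  by (simp add: sq_norm_def norm_minus_commute)

lemma sq_norm_triangle:
  fixes f g h :: "'a \<Rightarrow> 'b::euclidean_space"
  assumes "f \<in> L2 M" "g \<in> L2 M" "h \<in> L2 M"
  shows "sq_norm M (\<lambda>x. f x - h x) \<le> 2 * sq_norm M (\<lambda>x. f x - g x) + 2 * sq_norm M (\<lambda>x. g x - h x)"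
  using L2_add(2)[OF L2_diff(1)[OF assms(1,2)] L2_diff(1)[OF assms(2,3)]] by simp

lemma L2_mult_integrable:
  fixes f g :: "'a \<Rightarrow> complex"
  assumes f: "f \<in> L2 M" and g: "g \<in> L2 M"
  shows "integrable M (\<lambda>x. f x * g x)"
proof (rule Bochner_Integration.integrable_bound)
  show "integrable M (\<lambda>x. (norm (f x))\<^sup>2 + (norm (g x))\<^sup>2)" using f g by (simp add: L2_def)
  show "(\<lambda>x. f x * g x) \<in> borel_measurable M" using f g by (auto simp: L2_def)
  have "s * t \<le> s\<^sup>2 + t\<^sup>2" if "s \<ge> 0" "t \<ge> 0" for s t :: real
    using zero_le_power2[of "s - t"] mult_nonneg_nonneg[OF that] unfolding power2_diff by linarith
  then show "AE x in M. norm (f x * g x) \<le> norm ((norm (f x))\<^sup>2 + (norm (g x))\<^sup>2)"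
    by (intro AE_I2) (simp add: norm_mult)
qed

lemma L2_cnj:
  assumes "f \<in> L2 M"
  shows "(\<lambda>x. cnj (f x)) \<in> L2 M"
proof -
  have "(\<lambda>x. cnj (f x)) \<in> borel_measurable M"
    by (rule measurable_compose[OF L2_measurable[OF assms]]) (intro borel_measurable_continuous_onI continuous_intros)
  then show ?thesis by (rule L2_bound(1)[OF assms, where B=1]) simp
qed

lemma L2_mult_bounded:
  fixes f q :: "'a \<Rightarrow> complex"
  assumes f: "f \<in> L2 M" and q: "q \<in> borel_measurable M" "\<And>x. norm (q x) \<le> B"
  shows "(\<lambda>x. q x * f x) \<in> L2 M" "sq_norm M (\<lambda>x. q x * f x) \<le> B\<^sup>2 * sq_norm M f"
proof -
  have m: "(\<lambda>x. q x * f x) \<in> borel_measurable M" using q L2_measurable[OF f] by measurable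
  have "norm (q x * f x) \<le> B * norm (f x)" for x
    unfolding norm_mult using q(2) by (intro mult_right_mono) auto
  from L2_bound[OF f m this] show "(\<lambda>x. q x * f x) \<in> L2 M" "sq_norm M (\<lambda>x. q x * f x) \<le> B\<^sup>2 * sq_norm M f"
    by auto
qed

lemma norm_pair_sq: "(norm (a, b))\<^sup>2 = (norm a)\<^sup>2 + (norm b)\<^sup>2"
  by (simp add: norm_Pair)

lemma L2_Pair_iff:
  fixes f g :: "'a \<Rightarrow> complex"
  shows "(\<lambda>x. (f x, g x)) \<in> L2 M \<longleftrightarrow> f \<in> L2 M \<and> g \<in> L2 M"
proof safe
  assume h: "(\<lambda>x. (f x, g x)) \<in> L2 M"
  have "(\<lambda>x. fst (f x, g x)) \<in> borel_measurable M" "(\<lambda>x. snd (f x, g x)) \<in> borel_measurable M"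
    by (rule measurable_compose[OF L2_measurable[OF h]], intro borel_measurable_continuous_onI continuous_intros)+
  then show "f \<in> L2 M" "g \<in> L2 M"
    using norm_fst_le norm_snd_le by (auto intro!: L2_bound(1)[OF h, where B=1])
next
  assume f: "f \<in> L2 M" and g: "g \<in> L2 M"
  have "(\<lambda>x. (f x, g x)) \<in> borel_measurable M"
    using L2_measurable[OF f] L2_measurable[OF g] by (intro borel_measurable_Pair)
  moreover have "integrable M (\<lambda>x. (norm (f x))\<^sup>2 + (norm (g x))\<^sup>2)"
    using L2_integrable_sq[OF f] L2_integrable_sq[OF g] by simp
  ultimately show "(\<lambda>x. (f x, g x)) \<in> L2 M"
    unfolding L2_def mem_Collect_eq norm_pair_sq by (rule conjI)
qed

lemma L2_fst_snd:
  fixes g :: "'a \<Rightarrow> complex \<times> complex"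
  shows "g \<in> L2 M \<Longrightarrow> (\<lambda>x. fst (g x)) \<in> L2 M" "g \<in> L2 M \<Longrightarrow> (\<lambda>x. snd (g x)) \<in> L2 M"
  using L2_Pair_iff[of "\<lambda>x. fst (g x)" "\<lambda>x. snd (g x)" M] by simp_all

lemma sq_norm_Pair:
  fixes f g :: "'a \<Rightarrow> complex"
  shows "f \<in> L2 M \<Longrightarrow> g \<in> L2 M \<Longrightarrow> sq_norm M (\<lambda>x. (f x, g x)) = sq_norm M f + sq_norm M g"
  by (simp add: L2_def sq_norm_def norm_pair_sq)

lemma sq_norm_cong_AE:
  assumes "AE x in M. f x = g x" "f \<in> borel_measurable M" "g \<in> borel_measurable M"
  shows "sq_norm M f = sq_norm M g"
  unfolding sq_norm_def using assms by (intro integral_cong_AE) (auto elim: eventually_mono)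

lemma L2_cong_AE:
  assumes "AE x in M. f x = g x" "f \<in> L2 M" "g \<in> borel_measurable M"
  shows "g \<in> L2 M"
proof -
  have "integrable M (\<lambda>x. (norm (f x))\<^sup>2) \<longleftrightarrow> integrable M (\<lambda>x. (norm (g x))\<^sup>2)"
    using assms by (intro integrable_cong_AE) (auto simp: L2_def elim: eventually_mono)
  then show ?thesis using assms by (simp add: L2_def)
qed

text \<open>Continuity of the norm, from \<open>| |a|\<^sup>2 - |b|\<^sup>2 | \<le> (1 + 1 / \<eta>) |a - b|\<^sup>2 + \<eta> |b|\<^sup>2\<close> with \<open>\<eta>\<close>
comparable to the $L^2$ distance.\<close>

lemma sq_norm_tendsto:
  fixes f :: "'a \<Rightarrow> 'b::euclidean_space"
  assumes fn: "\<And>n. f' n \<in> L2 M" and f: "f \<in> L2 M" and lim: "(\<lambda>n. sq_norm M (\<lambda>x. f' n x - f x)) \<longlonglongrightarrow> 0"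
  shows "(\<lambda>n. sq_norm M (f' n)) \<longlonglongrightarrow> sq_norm M f"
proof -
  define d where "d n = sqrt (sq_norm M (\<lambda>x. f' n x - f x))" for n
  have d0: "d n \<ge> 0" and d2: "(d n)\<^sup>2 = sq_norm M (\<lambda>x. f' n x - f x)" for n by (simp_all add: d_def)
  have dlim: "d \<longlonglongrightarrow> 0" using tendsto_real_sqrt[OF lim] by (simp add: d_def[abs_def])
  \<comment> \<open>The summand \<open>1 / Suc n\<close> keeps \<open>\<eta>\<close> positive when the distance is \<open>0\<close>.\<close>
  define \<eta> where "\<eta> n = d n + 1 / Suc n" for n
  have \<eta>: "\<eta> n > 0" for n using d0[of n] by (simp add: \<eta>_def add_nonneg_pos)
  have \<eta>lim: "\<eta> \<longlonglongrightarrow> 0"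
    unfolding \<eta>_def using tendsto_add[OF dlim LIMSEQ_Suc[OF lim_1_over_n]] by simp
  have bound: "\<bar>sq_norm M (f' n) - sq_norm M f\<bar> \<le> (d n)\<^sup>2 + d n + \<eta> n * sq_norm M f" for n
  proof -
    have pt: "\<bar>(norm a)\<^sup>2 - (norm b)\<^sup>2\<bar> \<le> (1 + 1 / \<eta> n) * (norm (a - b))\<^sup>2 + \<eta> n * (norm b)\<^sup>2" for a b :: 'b
    proof -
      have "(norm a)\<^sup>2 - (norm b)\<^sup>2 = (norm (a - b))\<^sup>2 + 2 * inner b (a - b)"
        by (simp add: power2_norm_eq_inner inner_diff inner_commute algebra_simps)
      moreover have "\<bar>inner b (a - b)\<bar> \<le> norm b * norm (a - b)" by (rule Cauchy_Schwarz_ineq2)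
      moreover have "2 * (norm b * norm (a - b)) \<le> \<eta> n * (norm b)\<^sup>2 + 1 / \<eta> n * (norm (a - b))\<^sup>2"
      proof -
        have "0 \<le> (\<eta> n * norm b - norm (a - b))\<^sup>2 / \<eta> n" using \<eta>[of n] by simp
        also have "\<dots> = \<eta> n * (norm b)\<^sup>2 + 1 / \<eta> n * (norm (a - b))\<^sup>2 - 2 * (norm b * norm (a - b))"
          using \<eta>[of n] by (simp add: power2_eq_square field_simps)
        finally show ?thesis by simp
      qed
      moreover have "(1 + 1 / \<eta> n) * (norm (a - b))\<^sup>2 = (norm (a - b))\<^sup>2 + 1 / \<eta> n * (norm (a - b))\<^sup>2"
        by (simp add: distrib_right)
      ultimately show ?thesis using zero_le_power2[of "norm (a - b)"] by linarith
    qed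
    note diff = L2_diff(1)[OF fn[of n] f]
    have "sq_norm M (f' n) - sq_norm M f = (\<integral>x. (norm (f' n x))\<^sup>2 - (norm (f x))\<^sup>2 \<partial>M)"
      using L2_integrable_sq[OF fn] L2_integrable_sq[OF f] by (simp add: sq_norm_def)
    then have "\<bar>sq_norm M (f' n) - sq_norm M f\<bar> \<le> (\<integral>x. \<bar>(norm (f' n x))\<^sup>2 - (norm (f x))\<^sup>2\<bar> \<partial>M)"
      by simp
    also have "\<dots> \<le> (\<integral>x. (1 + 1 / \<eta> n) * (norm (f' n x - f x))\<^sup>2 + \<eta> n * (norm (f x))\<^sup>2 \<partial>M)"
      using L2_integrable_sq[OF fn] L2_integrable_sq[OF f] L2_integrable_sq[OF diff] pt
      by (intro integral_mono) auto
    also have "\<dots> = (1 + 1 / \<eta> n) * (d n)\<^sup>2 + \<eta> n * sq_norm M f"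
      using L2_integrable_sq[OF f] L2_integrable_sq[OF diff] by (simp add: d2 sq_norm_def)
    also have "(1 + 1 / \<eta> n) * (d n)\<^sup>2 \<le> (d n)\<^sup>2 + d n"
    proof -
      have "d n * d n \<le> d n * \<eta> n" using d0[of n] by (intro mult_left_mono) (auto simp: \<eta>_def)
      then show ?thesis using \<eta>[of n] by (simp add: power2_eq_square field_simps)
    qed
    finally show ?thesis by simp
  qed
  have "(\<lambda>n. (d n)\<^sup>2 + d n + \<eta> n * sq_norm M f) \<longlonglongrightarrow> 0\<^sup>2 + 0 + 0 * sq_norm M f"
    by (intro tendsto_intros dlim \<eta>lim)
  then have "(\<lambda>n. (d n)\<^sup>2 + d n + \<eta> n * sq_norm M f) \<longlonglongrightarrow> 0" by simp
  then have "(\<lambda>n. sq_norm M (f' n) - sq_norm M f) \<longlonglongrightarrow> 0"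
    by (rule Lim_null_comparison[rotated]) (use bound in \<open>auto intro!: always_eventually\<close>)
  then show ?thesis by (simp add: LIM_zero_iff)
qed

lemma L2_dominated:
  fixes f :: "'a \<Rightarrow> 'b::euclidean_space"
  assumes f: "f \<in> L2 M" and m: "\<And>n. f' n \<in> borel_measurable M"
    and dom: "\<And>n x. norm (f' n x) \<le> B * norm (f x)" and lim: "\<And>x. (\<lambda>n. f' n x) \<longlonglongrightarrow> 0"
  shows "(\<lambda>n. sq_norm M (f' n)) \<longlonglongrightarrow> 0"
proof -
  have "(\<lambda>n. \<integral>x. (norm (f' n x))\<^sup>2 \<partial>M) \<longlonglongrightarrow> integral\<^sup>L M (\<lambda>x. 0::real)"
  proof (rule integral_dominated_convergence[where w="\<lambda>x. B\<^sup>2 * (norm (f x))\<^sup>2"])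
    show "AE x in M. (\<lambda>n. (norm (f' n x))\<^sup>2) \<longlonglongrightarrow> 0"
      using tendsto_power[OF tendsto_norm_zero[OF lim], where n=2] by auto
    have "(norm (f' n x))\<^sup>2 \<le> B\<^sup>2 * (norm (f x))\<^sup>2" for n x
      using power_mono[OF dom norm_ge_zero, of n x 2] by (simp add: power_mult_distrib)
    then show "AE x in M. norm ((norm (f' n x))\<^sup>2) \<le> B\<^sup>2 * (norm (f x))\<^sup>2" for n by auto
  qed (use m f in \<open>auto simp: L2_def\<close>)
  then show ?thesis by (simp add: sq_norm_def)
qed

section \<open>Lebesgue measure on Borel sets\<close>

lemma lebesgue_on_borel:
  fixes U :: "plane set"
  assumes [measurable]: "U \<in> sets borel"
  shows borel_measurable_lebesgue_on: "f \<in> borel_measurable borel \<Longrightarrow> f \<in> borel_measurable (lebesgue_on U)"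
    and integral_lebesgue_on: "q \<in> borel_measurable borel \<Longrightarrow>
      integral\<^sup>L (lebesgue_on U) q = (\<integral>x. indicat_real U x *\<^sub>R (q x :: 'b::{banach, second_countable_topology}) \<partial>lborel)"
    and integrable_lebesgue_on: "q \<in> borel_measurable borel \<Longrightarrow>
      integrable (lebesgue_on U) q \<longleftrightarrow> integrable lborel (\<lambda>x. indicat_real U x *\<^sub>R q x)"
    and nn_integral_lebesgue_on: "integral\<^sup>N (lebesgue_on U) p = (\<integral>\<^sup>+x. p x * indicator U x \<partial>lborel)"
proof -
  have U: "U \<inter> space lebesgue \<in> sets lebesgue" using assms by (auto intro: sets_completionI_sets)
  show "f \<in> borel_measurable borel \<Longrightarrow> f \<in> borel_measurable (lebesgue_on U)"
    by (intro measurable_restrict_space1 measurable_completion) simp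
  show "integral\<^sup>L (lebesgue_on U) q = (\<integral>x. indicat_real U x *\<^sub>R q x \<partial>lborel)"
    if [measurable]: "q \<in> borel_measurable borel" for q :: "plane \<Rightarrow> 'b"
    unfolding integral_restrict_space[OF U] by (rule integral_completion) measurable
  show "integrable (lebesgue_on U) q \<longleftrightarrow> integrable lborel (\<lambda>x. indicat_real U x *\<^sub>R q x)"
    if [measurable]: "q \<in> borel_measurable borel" for q :: "plane \<Rightarrow> 'b"
    unfolding integrable_restrict_space[OF U] by (rule integrable_completion) measurable
  show "integral\<^sup>N (lebesgue_on U) p = (\<integral>\<^sup>+x. p x * indicator U x \<partial>lborel)"
    unfolding nn_integral_restrict_space[OF U] by (rule nn_integral_completion)
qed

lemma borel_representative:
  fixes u :: "plane \<Rightarrow> complex"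
  assumes U: "U \<in> sets borel" and u: "u \<in> borel_measurable (lebesgue_on U)"
  obtains F where "F \<in> borel_measurable borel" "AE x in lebesgue_on U. u x = F x" "\<And>x. x \<notin> U \<Longrightarrow> F x = 0"
proof -
  have UL: "U \<in> sets lebesgue" using U by (auto intro: sets_completionI_sets)
  let ?u = "\<lambda>x. if x \<in> U then u x else 0"
  have "?u \<in> borel_measurable lebesgue" using borel_measurable_if_I[OF u UL] .
  then have m: "(\<lambda>x. Re (?u x)) \<in> borel_measurable (completion lborel)" "(\<lambda>x. Im (?u x)) \<in> borel_measurable (completion lborel)"
    by (auto intro!: borel_measurable_Re borel_measurable_Im)
  obtain p where p: "p \<in> borel_measurable lborel" "AE x in lborel. Re (?u x) = p x"
    using completion_ex_borel_measurable_real[OF m(1)] by blast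
  obtain q where q: "q \<in> borel_measurable lborel" "AE x in lborel. Im (?u x) = q x"
    using completion_ex_borel_measurable_real[OF m(2)] by blast
  have [measurable]: "p \<in> borel_measurable borel" "q \<in> borel_measurable borel" "U \<in> sets borel" using p q U by auto
  show ?thesis
  proof (rule that[of "\<lambda>x. indicat_real U x *\<^sub>R (of_real (p x) + \<i> * of_real (q x))"])
    have "AE x in lborel. ?u x = of_real (p x) + \<i> * of_real (q x)"
      using p(2) q(2) by eventually_elim (simp add: complex_eq_iff)
    then have "AE x in lebesgue. ?u x = of_real (p x) + \<i> * of_real (q x)"
      by (rule AE_completion)
    then have "AE x in lebesgue. x \<in> U \<longrightarrow> u x = indicat_real U x *\<^sub>R (of_real (p x) + \<i> * of_real (q x))"
      by eventually_elim auto
    then show "AE x in lebesgue_on U. u x = indicat_real U x *\<^sub>R (of_real (p x) + \<i> * of_real (q x))"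
      using UL by (subst AE_restrict_space_iff) auto
  qed (auto, measurable)
qed

section \<open>Weak gradients on an open convex cone\<close>

definition grad :: "(plane \<Rightarrow> complex) \<Rightarrow> plane \<Rightarrow> complex \<times> complex" where
  "grad f x = (dx1 f x, dx2 f x)"

lemma weak_gradientD:
  assumes "is_weak_gradient U u g" "\<phi> \<in> test_functions U"
  shows "(\<integral>x. u x * dx1 \<phi> x \<partial>lebesgue_on U) = - (\<integral>x. fst (g x) * \<phi> x \<partial>lebesgue_on U)"
    "(\<integral>x. u x * dx2 \<phi> x \<partial>lebesgue_on U) = - (\<integral>x. snd (g x) * \<phi> x \<partial>lebesgue_on U)"
  using assms by (simp_all add: is_weak_gradient_def)

text \<open>What the density proof uses about the sector: sums of points of \<open>U\<close> stay in \<open>U\<close>, and there are mollifiers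
supported in \<open>U\<close> arbitrarily close to the origin. A translate by \<open>x \<in> U\<close> of such a mollifier is then a test function
on \<open>U\<close>.\<close>

locale cone_domain =
  fixes U :: "plane set"
  assumes open_U: "open U"
    and cone_add: "x \<in> U \<Longrightarrow> y \<in> U \<Longrightarrow> x + y \<in> U"
    and cone_mollifier: "d > 0 \<Longrightarrow> \<exists>r C. mollifier r \<and> compact C \<and> C \<subseteq> U \<inter> ball 0 d \<and> (\<forall>x. x \<notin> C \<longrightarrow> r x = 0)"
begin

abbreviation "L \<equiv> lebesgue_on U"

lemma U_borel [measurable]: "U \<in> sets borel"
  using open_U by auto

lemmas L_borel = borel_measurable_lebesgue_on[OF U_borel]
lemmas L_integral = integral_lebesgue_on[OF U_borel]
lemmas L_integrable = integrable_lebesgue_on[OF U_borel]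
lemmas L_nn_integral = nn_integral_lebesgue_on[OF U_borel]

lemma space_L [simp]: "space L = U"
  by simp

lemma test_functions_L2:
  assumes "\<phi> \<in> test_functions W"
  shows "\<phi> \<in> L2 L"
proof -
  have [measurable]: "\<phi> \<in> borel_measurable borel" using smooth_measurable[OF test_functions_smooth[OF assms]] .
  obtain M where M: "M > 0" "\<And>x. norm (\<phi> x) \<le> M" using test_functions_bounded[OF assms] by blast
  have "integrable lborel (\<lambda>x. (norm (\<phi> x))\<^sup>2)"
  proof (rule Bochner_Integration.integrable_bound)
    show "integrable lborel (\<lambda>x. M * norm (\<phi> x))" using test_functions_integrable[OF assms] by simp
    show "AE x in lborel. norm ((norm (\<phi> x))\<^sup>2) \<le> norm (M * norm (\<phi> x))"
      using M by (intro AE_I2) (auto simp: power2_eq_square abs_mult intro!: mult_right_mono)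
  qed measurable
  then have "integrable L (\<lambda>x. (norm (\<phi> x))\<^sup>2)"
    using integrable_mult_indicator[of U lborel "\<lambda>x. (norm (\<phi> x))\<^sup>2"] by (subst L_integrable) auto
  then show ?thesis by (simp add: L2_def L_borel)
qed

lemma grad_test_functions_L2: "\<phi> \<in> test_functions W \<Longrightarrow> grad \<phi> \<in> L2 L"
  unfolding grad_def[abs_def] L2_Pair_iff using test_functions_dx test_functions_L2 by blast

lemma L2_representative:
  fixes u :: "plane \<Rightarrow> complex"
  assumes u: "u \<in> L2 L"
  obtains F where "F \<in> borel_measurable borel" "AE x in L. u x = F x" "\<And>x. x \<notin> U \<Longrightarrow> F x = 0"
    "integrable lborel (\<lambda>x. (norm (F x))\<^sup>2)"
proof -
  obtain F where F[measurable]: "F \<in> borel_measurable borel" and ae: "AE x in L. u x = F x" and z: "\<And>x. x \<notin> U \<Longrightarrow> F x = 0"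
    using borel_representative[OF U_borel L2_measurable[OF u]] by blast
  have "F \<in> L2 L" by (rule L2_cong_AE[OF ae u L_borel]) fact
  then have "integrable lborel (\<lambda>x. indicat_real U x *\<^sub>R (norm (F x))\<^sup>2)"
    using L_integrable[of "\<lambda>x. (norm (F x))\<^sup>2"] by (simp add: L2_def)
  moreover have "(\<lambda>x. indicat_real U x *\<^sub>R (norm (F x))\<^sup>2) = (\<lambda>x. (norm (F x))\<^sup>2)"
    by (rule ext, rename_tac x, case_tac "x \<in> U") (simp_all add: z)
  ultimately have "integrable lborel (\<lambda>x. (norm (F x))\<^sup>2)" by simp
  show ?thesis by (rule that) fact+
qed

lemma mollifier_shift_test:
  assumes r: "mollifier r" "compact C" "C \<subseteq> U" "\<And>x. x \<notin> C \<Longrightarrow> r x = 0" and x: "x \<in> U"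
  shows "(\<lambda>z. complex_of_real (r (z - x))) \<in> test_functions U"
proof (rule test_functionsI[where C="(\<lambda>z. z + x) ` C"])
  show "smooth (\<lambda>z. complex_of_real (r (z - x)))"
    using r(1) smooth_shift[OF test_functions_smooth, of "\<lambda>x. complex_of_real (r x)" UNIV "- x"] by (simp add: mollifier_def)
  show "compact ((\<lambda>z. z + x) ` C)" using r(2) by (intro compact_continuous_image continuous_intros)
  show "(\<lambda>z. z + x) ` C \<subseteq> U"
    using r(3) x by (intro image_subsetI cone_add) auto
  show "complex_of_real (r (z - x)) = 0" if "z \<notin> (\<lambda>z. z + x) ` C" for z
  proof -
    have "z - x \<notin> C" using that by (metis diff_add_cancel image_eqI)
    then show ?thesis using r(4) by simp
  qed
qed

text \<open>Rewrites a smoothing as the pairing with a translated kernel that occurs in the definition of the weak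
gradient.\<close>

lemma smoothing_inside:
  assumes [measurable]: "F \<in> borel_measurable borel" and ae: "AE x in L. u x = F x" and z: "\<And>x. x \<notin> U \<Longrightarrow> F x = 0"
    and u: "u \<in> borel_measurable L" and [measurable]: "K \<in> borel_measurable borel"
  shows "smoothing K F x = (\<integral>z. u z * K (z - x) \<partial>L)"
proof -
  have "(\<integral>z. u z * K (z - x) \<partial>L) = (\<integral>z. K (z - x) * F z \<partial>L)"
  proof (rule integral_cong_AE)
    show "(\<lambda>z. u z * K (z - x)) \<in> borel_measurable L"
      by (intro borel_measurable_times u L_borel) measurable
    show "(\<lambda>z. K (z - x) * F z) \<in> borel_measurable L"
      by (rule L_borel) measurable
    show "AE z in L. u z * K (z - x) = K (z - x) * F z"
      using ae by eventually_elim simp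
  qed
  also have "\<dots> = (\<integral>z. indicat_real U z *\<^sub>R (K (z - x) * F z) \<partial>lborel)"
    by (rule L_integral) measurable
  also have "\<dots> = smoothing K F x"
    unfolding smoothing_def by (intro Bochner_Integration.integral_cong) (auto simp: indicator_def z)
  finally show ?thesis by simp
qed

text \<open>The smoothings of \<open>u\<close> by cone mollifiers vanish on \<open>U\<close>, and they converge to \<open>u\<close> in $L^2$.\<close>

lemma fundamental_lemma:
  assumes u: "u \<in> L2 L" and 0: "\<And>\<phi>. \<phi> \<in> test_functions U \<Longrightarrow> (\<integral>x. u x * \<phi> x \<partial>L) = 0"
  shows "AE x in L. u x = 0"
proof -
  obtain F where F[measurable]: "F \<in> borel_measurable borel" and ae: "AE x in L. u x = F x" and z: "\<And>x. x \<notin> U \<Longrightarrow> F x = 0"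
    and F2: "integrable lborel (\<lambda>x. (norm (F x))\<^sup>2)"
    using L2_representative[OF u] by blast
  have le: "(\<integral>\<^sup>+x. (norm (F x))\<^sup>2 \<partial>lborel) \<le> 0 + ennreal e" if e: "e > 0" for e
  proof -
    obtain d where d: "d > 0" "\<And>y. norm y < d \<Longrightarrow> (\<integral>\<^sup>+x. (norm (F (x + y) - F x))\<^sup>2 \<partial>lborel) \<le> ennreal e"
      using L2_translation_continuous[OF F F2 e] by blast
    obtain r C where r: "mollifier r" "compact C" "C \<subseteq> U \<inter> ball 0 d" "\<And>x. x \<notin> C \<Longrightarrow> r x = 0"
      using cone_mollifier[OF d(1)] by blast
    let ?r = "\<lambda>x. complex_of_real (r x)"
    have rt: "?r \<in> test_functions UNIV" using r(1) by (simp add: mollifier_def)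
    note [measurable] = smooth_measurable[OF test_functions_smooth[OF rt]]
    have "(\<integral>\<^sup>+x. (norm (F x))\<^sup>2 \<partial>lborel) \<le> (\<integral>\<^sup>+x. (norm (smoothing ?r F x - F x))\<^sup>2 \<partial>lborel)"
    proof (rule nn_integral_mono)
      fix x
      show "ennreal ((norm (F x))\<^sup>2) \<le> ennreal ((norm (smoothing ?r F x - F x))\<^sup>2)"
      proof (cases "x \<in> U")
        case True
        have "smoothing ?r F x = 0"
          using smoothing_inside[OF F ae z L2_measurable[OF u], of ?r x] 0[OF mollifier_shift_test[OF r(1,2) _ r(4) True]] r(3) by simp
        then show ?thesis by simp
      qed (simp add: z)
    qed
    also have "\<dots> \<le> ennreal e"
    proof (rule mollifier_L2_estimate[OF r(1) F F2])
      fix y assume "r y \<noteq> 0"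
      then have "y \<in> C" using r(4)[of y] by metis
      then have "norm y < d" using r(3) by auto
      then show "(\<integral>\<^sup>+x. (norm (F (x + y) - F x))\<^sup>2 \<partial>lborel) \<le> ennreal e" by (rule d(2))
    qed
    finally show ?thesis by simp
  qed
  then have "(\<integral>\<^sup>+x. (norm (F x))\<^sup>2 \<partial>lborel) \<le> 0" by (rule ennreal_le_epsilon)
  then have "AE x in lborel. F x = 0"
    by (simp add: nn_integral_0_iff_AE)
  then have "AE x in lebesgue. F x = 0" by (rule AE_completion)
  then have "AE x in lebesgue. x \<in> U \<longrightarrow> F x = 0" by eventually_elim simp
  then have "AE x in L. F x = 0"
    using U_borel by (subst AE_restrict_space_iff) (auto intro: sets_completionI_sets)
  with ae show ?thesis by eventually_elim simp
qed

lemma weak_gradient_unique: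
  assumes g: "is_weak_gradient U u g" and h: "is_weak_gradient U u h"
  shows "AE x in L. g x = h x"
proof -
  note gL = L2_fst_snd[of g L] and hL = L2_fst_snd[of h L]
  have gL2: "g \<in> L2 L" and hL2: "h \<in> L2 L" using g h by (auto simp: is_weak_gradient_def)
  have "AE x in L. fst (g x) - fst (h x) = 0"
  proof (rule fundamental_lemma)
    show "(\<lambda>x. fst (g x) - fst (h x)) \<in> L2 L" using gL(1)[OF gL2] hL(1)[OF hL2] by (rule L2_diff)
    fix \<phi> assume \<phi>: "\<phi> \<in> test_functions U"
    have "(\<integral>x. fst (g x) * \<phi> x \<partial>L) = (\<integral>x. fst (h x) * \<phi> x \<partial>L)"
      using weak_gradientD(1)[OF g \<phi>] weak_gradientD(1)[OF h \<phi>] by simp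
    then show "(\<integral>x. (fst (g x) - fst (h x)) * \<phi> x \<partial>L) = 0"
      using L2_mult_integrable[OF gL(1)[OF gL2] test_functions_L2[OF \<phi>]] L2_mult_integrable[OF hL(1)[OF hL2] test_functions_L2[OF \<phi>]]
      by (simp add: left_diff_distrib)
  qed
  moreover have "AE x in L. snd (g x) - snd (h x) = 0"
  proof (rule fundamental_lemma)
    show "(\<lambda>x. snd (g x) - snd (h x)) \<in> L2 L" using gL(2)[OF gL2] hL(2)[OF hL2] by (rule L2_diff)
    fix \<phi> assume \<phi>: "\<phi> \<in> test_functions U"
    have "(\<integral>x. snd (g x) * \<phi> x \<partial>L) = (\<integral>x. snd (h x) * \<phi> x \<partial>L)"
      using weak_gradientD(2)[OF g \<phi>] weak_gradientD(2)[OF h \<phi>] by simp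
    then show "(\<integral>x. (snd (g x) - snd (h x)) * \<phi> x \<partial>L) = 0"
      using L2_mult_integrable[OF gL(2)[OF gL2] test_functions_L2[OF \<phi>]] L2_mult_integrable[OF hL(2)[OF hL2] test_functions_L2[OF \<phi>]]
      by (simp add: left_diff_distrib)
  qed
  ultimately show ?thesis by eventually_elim (simp add: prod_eq_iff)
qed

lemma weak_grad_eq:
  assumes "is_weak_gradient U u g"
  shows "AE x in L. weak_grad U u x = g x" "is_weak_gradient U u (weak_grad U u)"
proof -
  show "is_weak_gradient U u (weak_grad U u)"
    unfolding weak_grad_def by (rule someI[of "is_weak_gradient U u", OF assms])
  from weak_gradient_unique[OF this assms] show "AE x in L. weak_grad U u x = g x" .
qed

lemma H1_weak_gradient:
  assumes "u \<in> H1 U"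
  shows "is_weak_gradient U u (weak_grad U u)"
proof -
  obtain g where "is_weak_gradient U u g" using assms by (auto simp: H1_def)
  then show ?thesis by (rule weak_grad_eq(2))
qed

lemma weak_gradient_L2: "is_weak_gradient U u g \<Longrightarrow> g \<in> L2 L"
  by (simp add: is_weak_gradient_def)

lemma H1_norm_eq:
  assumes u: "u \<in> L2 L" and g: "is_weak_gradient U u g"
  shows "(H1_norm U u)\<^sup>2 = sq_norm L g + sq_norm L u"
proof -
  note w = weak_grad_eq[OF g]
  have wL: "weak_grad U u \<in> L2 L" and gL: "g \<in> L2 L" using w(2) g by (auto simp: is_weak_gradient_def)
  have "(\<integral>x. (norm (weak_grad U u x))\<^sup>2 + (norm (u x))\<^sup>2 \<partial>L) = sq_norm L (weak_grad U u) + sq_norm L u"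
    using wL u by (simp add: L2_def sq_norm_def)
  also have "sq_norm L (weak_grad U u) = sq_norm L g"
    using w(1) wL gL by (intro sq_norm_cong_AE) (auto simp: L2_def)
  finally show ?thesis by (simp add: H1_norm_def)
qed

lemma weak_gradient_test:
  assumes \<phi>: "\<phi> \<in> test_functions UNIV"
  shows "is_weak_gradient U \<phi> (grad \<phi>)"
  unfolding is_weak_gradient_def
proof (intro conjI ballI)
  show "grad \<phi> \<in> L2 L" using grad_test_functions_L2[OF \<phi>] .
  fix \<psi> assume \<psi>: "\<psi> \<in> test_functions U"
  note sm = test_functions_smooth[OF \<phi>] test_functions_smooth[OF \<psi>]
  note [measurable] = smooth_measurable[OF sm(1)] smooth_measurable[OF sm(2)] smooth_measurable[OF smooth_dx(1)[OF sm(1)]]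
    smooth_measurable[OF smooth_dx(2)[OF sm(1)]] smooth_measurable[OF smooth_dx(1)[OF sm(2)]] smooth_measurable[OF smooth_dx(2)[OF sm(2)]]
  have off: "\<psi> x = 0" "dx1 \<psi> x = 0" "dx2 \<psi> x = 0" if "x \<notin> U" for x
    using that \<psi> test_functions_dx[OF \<psi>] by (blast elim: test_functionsE)+
  have eq: "(\<integral>x. q x \<partial>L) = (\<integral>x. q x \<partial>lborel)" if [measurable]: "q \<in> borel_measurable borel" and "\<And>x. x \<notin> U \<Longrightarrow> q x = 0"
    for q :: "plane \<Rightarrow> complex"
    unfolding L_integral[OF that(1)] using that(2) by (intro Bochner_Integration.integral_cong) (auto simp: indicator_def)
  show "(\<integral>x. \<phi> x * dx1 \<psi> x \<partial>L) = - (\<integral>x. fst (grad \<phi> x) * \<psi> x \<partial>L)"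
    "(\<integral>x. \<phi> x * dx2 \<psi> x \<partial>L) = - (\<integral>x. snd (grad \<phi> x) * \<psi> x \<partial>L)"
    using integration_by_parts[OF \<psi> sm(1)] by (simp_all add: grad_def eq off)
qed

text \<open>The product rule holds by definition of the weak gradient, because \<open>\<psi> \<phi>\<close> is a test function whenever \<open>\<phi>\<close>
is.\<close>

lemma weak_gradient_mult:
  assumes u: "u \<in> L2 L" and g: "is_weak_gradient U u g"
    and \<psi>: "smooth \<psi>" "\<And>x. norm (\<psi> x) \<le> M" "\<And>x. norm (dx1 \<psi> x) \<le> M" "\<And>x. norm (dx2 \<psi> x) \<le> M"
  shows "(\<lambda>x. \<psi> x * u x) \<in> L2 L"
    "is_weak_gradient U (\<lambda>x. \<psi> x * u x) (\<lambda>x. (\<psi> x * fst (g x) + dx1 \<psi> x * u x, \<psi> x * snd (g x) + dx2 \<psi> x * u x))"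
proof -
  have gL: "(\<lambda>x. fst (g x)) \<in> L2 L" "(\<lambda>x. snd (g x)) \<in> L2 L"
    using L2_fst_snd g by (auto simp: is_weak_gradient_def)
  note m = L_borel[OF smooth_measurable[OF \<psi>(1)]] L_borel[OF smooth_measurable[OF smooth_dx(1)[OF \<psi>(1)]]]
    L_borel[OF smooth_measurable[OF smooth_dx(2)[OF \<psi>(1)]]]
  note b = L2_mult_bounded(1)[OF u m(1) \<psi>(2)] L2_mult_bounded(1)[OF gL(1) m(1) \<psi>(2)] L2_mult_bounded(1)[OF gL(2) m(1) \<psi>(2)]
    L2_mult_bounded(1)[OF u m(2) \<psi>(3)] L2_mult_bounded(1)[OF u m(3) \<psi>(4)]
  show "(\<lambda>x. \<psi> x * u x) \<in> L2 L" by (rule b)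
  show "is_weak_gradient U (\<lambda>x. \<psi> x * u x) (\<lambda>x. (\<psi> x * fst (g x) + dx1 \<psi> x * u x, \<psi> x * snd (g x) + dx2 \<psi> x * u x))"
    unfolding is_weak_gradient_def
  proof (intro conjI ballI)
    show "(\<lambda>x. (\<psi> x * fst (g x) + dx1 \<psi> x * u x, \<psi> x * snd (g x) + dx2 \<psi> x * u x)) \<in> L2 L"
      unfolding L2_Pair_iff using b by (auto intro!: L2_add)
    fix \<phi> assume \<phi>: "\<phi> \<in> test_functions U"
    note d = smooth_differentiable[OF \<psi>(1)] smooth_differentiable[OF test_functions_smooth[OF \<phi>]]
    note t = test_functions_L2[OF \<phi>] test_functions_L2[OF test_functions_dx(1)[OF \<phi>]] test_functions_L2[OF test_functions_dx(2)[OF \<phi>]]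
    have w: "(\<integral>x. u x * dx1 (\<lambda>x. \<psi> x * \<phi> x) x \<partial>L) = - (\<integral>x. fst (g x) * (\<psi> x * \<phi> x) \<partial>L)"
      "(\<integral>x. u x * dx2 (\<lambda>x. \<psi> x * \<phi> x) x \<partial>L) = - (\<integral>x. snd (g x) * (\<psi> x * \<phi> x) \<partial>L)"
      using weak_gradientD[OF g test_functions_mult[OF \<psi>(1) \<phi>]] by simp_all
    have i: "integrable L (\<lambda>x. u x * (\<psi> x * dx1 \<phi> x))" "integrable L (\<lambda>x. u x * (dx1 \<psi> x * \<phi> x))"
      "integrable L (\<lambda>x. u x * (\<psi> x * dx2 \<phi> x))" "integrable L (\<lambda>x. u x * (dx2 \<psi> x * \<phi> x))"
      "integrable L (\<lambda>x. fst (g x) * (\<psi> x * \<phi> x))" "integrable L (\<lambda>x. snd (g x) * (\<psi> x * \<phi> x))"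
      using L2_mult_integrable[OF b(1) t(2)] L2_mult_integrable[OF b(1) t(3)] L2_mult_integrable[OF b(4) t(1)]
        L2_mult_integrable[OF b(5) t(1)] L2_mult_integrable[OF b(2) t(1)] L2_mult_integrable[OF b(3) t(1)]
      by (simp_all add: mult_ac)
    have w1: "(\<integral>x. u x * (\<psi> x * dx1 \<phi> x) \<partial>L) + (\<integral>x. u x * (dx1 \<psi> x * \<phi> x) \<partial>L) = - (\<integral>x. fst (g x) * (\<psi> x * \<phi> x) \<partial>L)"
      using w(1) i unfolding dx_mult[OF d] by (simp add: distrib_left)
    have w2: "(\<integral>x. u x * (\<psi> x * dx2 \<phi> x) \<partial>L) + (\<integral>x. u x * (dx2 \<psi> x * \<phi> x) \<partial>L) = - (\<integral>x. snd (g x) * (\<psi> x * \<phi> x) \<partial>L)"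
      using w(2) i unfolding dx_mult[OF d] by (simp add: distrib_left)
    have e: "\<psi> x * u x * q = u x * (\<psi> x * q)" "(\<psi> x * fst (g x) + dx1 \<psi> x * u x) * q = fst (g x) * (\<psi> x * q) + u x * (dx1 \<psi> x * q)"
      "(\<psi> x * snd (g x) + dx2 \<psi> x * u x) * q = snd (g x) * (\<psi> x * q) + u x * (dx2 \<psi> x * q)" for x q
      by (simp_all add: algebra_simps)
    show "(\<integral>x. \<psi> x * u x * dx1 \<phi> x \<partial>L) = - (\<integral>x. fst (\<psi> x * fst (g x) + dx1 \<psi> x * u x, \<psi> x * snd (g x) + dx2 \<psi> x * u x) * \<phi> x \<partial>L)"
      using w1 i by (simp add: e eq_diff_eq)
    show "(\<integral>x. \<psi> x * u x * dx2 \<phi> x \<partial>L) = - (\<integral>x. snd (\<psi> x * fst (g x) + dx1 \<psi> x * u x, \<psi> x * snd (g x) + dx2 \<psi> x * u x) * \<phi> x \<partial>L)"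
      using w2 i by (simp add: e eq_diff_eq)
  qed
qed

lemma weak_gradient_diff:
  assumes u: "u \<in> L2 L" "is_weak_gradient U u g" and v: "v \<in> L2 L" "is_weak_gradient U v h"
  shows "is_weak_gradient U (\<lambda>x. u x - v x) (\<lambda>x. g x - h x)"
  unfolding is_weak_gradient_def
proof (intro conjI ballI)
  have gL: "g \<in> L2 L" "h \<in> L2 L" using u v by (auto simp: is_weak_gradient_def)
  then show "(\<lambda>x. g x - h x) \<in> L2 L" by (rule L2_diff)
  fix \<phi> assume \<phi>: "\<phi> \<in> test_functions U"
  note t = test_functions_L2[OF \<phi>] test_functions_L2[OF test_functions_dx(1)[OF \<phi>]] test_functions_L2[OF test_functions_dx(2)[OF \<phi>]]
  note i = L2_mult_integrable[OF u(1) t(2)] L2_mult_integrable[OF u(1) t(3)] L2_mult_integrable[OF v(1) t(2)] L2_mult_integrable[OF v(1) t(3)]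
    L2_mult_integrable[OF L2_fst_snd(1)[OF gL(1)] t(1)] L2_mult_integrable[OF L2_fst_snd(2)[OF gL(1)] t(1)]
    L2_mult_integrable[OF L2_fst_snd(1)[OF gL(2)] t(1)] L2_mult_integrable[OF L2_fst_snd(2)[OF gL(2)] t(1)]
  show "(\<integral>x. (u x - v x) * dx1 \<phi> x \<partial>L) = - (\<integral>x. fst (g x - h x) * \<phi> x \<partial>L)"
    "(\<integral>x. (u x - v x) * dx2 \<phi> x \<partial>L) = - (\<integral>x. snd (g x - h x) * \<phi> x \<partial>L)"
    using weak_gradientD[OF u(2) \<phi>] weak_gradientD[OF v(2) \<phi>] i by (simp_all add: left_diff_distrib)
qed

end

section \<open>Density of test functions\<close>

lemma dx_shift:
  assumes "f differentiable at (z + a)"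
  shows "dx1 (\<lambda>z. f (z + a)) z = dx1 f (z + a)" "dx2 (\<lambda>z. f (z + a)) z = dx2 f (z + a)"
proof -
  have "((\<lambda>z. z + a) has_derivative (\<lambda>h. h)) (at z)" by (auto intro!: derivative_eq_intros)
  from dx_has_derivative[OF has_derivative_compose[OF this has_derivative_dx[OF assms]]]
  show "dx1 (\<lambda>z. f (z + a)) z = dx1 f (z + a)" "dx2 (\<lambda>z. f (z + a)) z = dx2 f (z + a)" by simp_all
qed

lemma has_derivative_scale:
  assumes "f differentiable at (a *\<^sub>R z)"
  shows "((\<lambda>z. f (a *\<^sub>R z)) has_derivative (\<lambda>h. fst (a *\<^sub>R h) *\<^sub>R dx1 f (a *\<^sub>R z) + snd (a *\<^sub>R h) *\<^sub>R dx2 f (a *\<^sub>R z))) (at z)"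
proof -
  have "((\<lambda>z. a *\<^sub>R z) has_derivative (\<lambda>h. a *\<^sub>R h)) (at z)" by (auto intro!: derivative_eq_intros)
  from has_derivative_compose[OF this has_derivative_dx[OF assms]] show ?thesis .
qed

lemma dx_scale:
  assumes "f differentiable at (a *\<^sub>R z)"
  shows "dx1 (\<lambda>z. f (a *\<^sub>R z)) z = of_real a * dx1 f (a *\<^sub>R z)" "dx2 (\<lambda>z. f (a *\<^sub>R z)) z = of_real a * dx2 f (a *\<^sub>R z)"
  using dx_has_derivative[OF has_derivative_scale[OF assms]] by (simp_all add: scaleR_conv_of_real)

lemma smooth_scale:
  assumes "smooth f" shows "smooth (\<lambda>z. f (a *\<^sub>R z))"
proof -
  have "C_k k (\<lambda>z. f (a *\<^sub>R z))" if "smooth f" for k f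
    using that
  proof (induction k arbitrary: f)
    case 0
    from continuous_on_compose2[OF smooth_continuous[OF 0], of UNIV "\<lambda>z. a *\<^sub>R z"] show ?case by (simp add: continuous_intros)
  next
    case (Suc k)
    note d = smooth_differentiable[OF Suc.prems]
    have "dx1 (\<lambda>z. f (a *\<^sub>R z)) = (\<lambda>z. of_real a * dx1 f (a *\<^sub>R z))" "dx2 (\<lambda>z. f (a *\<^sub>R z)) = (\<lambda>z. of_real a * dx2 f (a *\<^sub>R z))"
      using dx_scale[OF d] by auto
    moreover have "(\<lambda>z. f (a *\<^sub>R z)) differentiable at z" for z
      using has_derivative_scale[OF d] by (rule differentiableI)
    ultimately show ?case
      using C_k_mult[OF C_k_const Suc.IH[OF smooth_dx(1)[OF Suc.prems]]] C_k_mult[OF C_k_const Suc.IH[OF smooth_dx(2)[OF Suc.prems]]] by simp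
  qed
  then show ?thesis using assms by (simp add: smooth_def)
qed

lemma test_functions_scale:
  assumes "\<phi> \<in> test_functions UNIV" "a > 0"
  shows "(\<lambda>z. \<phi> (a *\<^sub>R z)) \<in> test_functions UNIV"
proof -
  obtain r where r: "r > 0" "\<And>x. norm x > r \<Longrightarrow> \<phi> x = 0" using test_functions_support_ball[OF assms(1)] by blast
  show ?thesis
  proof (rule test_functionsI[where C="cball 0 (r / a)"])
    show "smooth (\<lambda>z. \<phi> (a *\<^sub>R z))" using test_functions_smooth[OF assms(1)] by (rule smooth_scale)
    show "\<phi> (a *\<^sub>R x) = 0" if "x \<notin> cball 0 (r / a)" for x
      using that assms(2) by (intro r) (simp add: field_simps)
  qed auto
qed

lemma cutoff_exists:
  obtains X where "X \<in> test_functions UNIV" "X 0 = 1"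
proof -
  let ?b = "bump 1 (1/2) (1/2)"
  have p: "?b 0 > 0" by (rule bump_pos) simp_all
  have "(\<lambda>x. complex_of_real (1 / ?b 0) * complex_of_real (?b x)) \<in> test_functions UNIV"
    by (intro test_functions_mult smooth_const bump_test_function) auto
  then show ?thesis using p by (intro that[of "\<lambda>x. complex_of_real (1 / ?b 0) * complex_of_real (?b x)"]) (auto simp flip: of_real_mult)
qed

context cone_domain
begin

lemma smooth_L_borel: "smooth f \<Longrightarrow> f \<in> borel_measurable L"
  by (intro L_borel smooth_measurable)

text \<open>Multiplication by \<open>X (a x)\<close> with \<open>X 0 = 1\<close> and \<open>a \<rightarrow> 0\<close>: this tends to \<open>1\<close> boundedly, and its gradient is
\<open>O(a)\<close>.\<close>

lemma density_smooth:
  assumes v: "smooth v" "v \<in> L2 L" and g: "grad v \<in> L2 L" and e: "e > 0"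
  shows "\<exists>\<phi>\<in>test_functions UNIV. sq_norm L (\<lambda>x. \<phi> x - v x) + sq_norm L (\<lambda>x. grad \<phi> x - grad v x) < e"
proof -
  obtain X where X: "X \<in> test_functions UNIV" "X 0 = 1" by (rule cutoff_exists)
  obtain M where M: "M > 0" "\<And>x. norm (X x) \<le> M" using test_functions_bounded[OF X(1)] by blast
  obtain M1 where M1: "M1 > 0" "\<And>x. norm (dx1 X x) \<le> M1" using test_functions_bounded[OF test_functions_dx(1)[OF X(1)]] by blast
  obtain M2 where M2: "M2 > 0" "\<And>x. norm (dx2 X x) \<le> M2" using test_functions_bounded[OF test_functions_dx(2)[OF X(1)]] by blast
  note sX = test_functions_smooth[OF X(1)]
  define a :: "nat \<Rightarrow> real" where "a n = 1 / Suc n" for n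
  have a: "a n > 0" "a n \<le> 1" for n by (auto simp: a_def)
  have alim: "a \<longlonglongrightarrow> 0" unfolding a_def by (rule LIMSEQ_Suc[OF lim_1_over_n])
  define \<eta> where "\<eta> n x = X (a n *\<^sub>R x)" for n x
  define \<phi> where "\<phi> n x = \<eta> n x * v x" for n x
  have \<eta>t: "\<eta> n \<in> test_functions UNIV" for n
    unfolding \<eta>_def[abs_def] by (rule test_functions_scale[OF X(1) a(1)])
  note s\<eta> = test_functions_smooth[OF \<eta>t]
  have \<phi>t: "\<phi> n \<in> test_functions UNIV" for n
    using test_functions_mult[OF v(1) \<eta>t[of n]] unfolding \<phi>_def[abs_def] by (simp add: mult.commute)
  have \<eta>lim: "(\<lambda>n. \<eta> n x - 1) \<longlonglongrightarrow> 0" for x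
  proof -
    have "(\<lambda>n. a n *\<^sub>R x) \<longlonglongrightarrow> 0 *\<^sub>R x" by (intro tendsto_intros alim)
    moreover have "isCont X (0 *\<^sub>R x)" using smooth_continuous[OF sX] unfolding continuous_on_eq_continuous_at[OF open_UNIV] by blast
    ultimately have "(\<lambda>n. \<eta> n x) \<longlonglongrightarrow> 1" unfolding \<eta>_def using X(2) isCont_tendsto_compose by fastforce
    from tendsto_diff[OF this tendsto_const[of 1]] show ?thesis by simp
  qed
  have \<eta>b: "norm (\<eta> n x - 1) \<le> M + 1" for n x
    unfolding \<eta>_def by (rule order_trans[OF norm_triangle_ineq4]) (use M in simp)
  have d1\<eta>: "dx1 (\<eta> n) x = of_real (a n) * dx1 X (a n *\<^sub>R x)" and d2\<eta>: "dx2 (\<eta> n) x = of_real (a n) * dx2 X (a n *\<^sub>R x)" for n x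
    unfolding \<eta>_def[abs_def] by (rule dx_scale[OF smooth_differentiable[OF sX]])+
  have d1b: "norm (dx1 (\<eta> n) x) \<le> a n * M1" and d2b: "norm (dx2 (\<eta> n) x) \<le> a n * M2" for n x
    unfolding d1\<eta> d2\<eta> norm_mult using M1 M2 a[of n] by (auto intro!: mult_mono)
  have d1b': "norm (dx1 (\<eta> n) x) \<le> M1" and d2b': "norm (dx2 (\<eta> n) x) \<le> M2" for n x
    using order_trans[OF d1b[of n x]] order_trans[OF d2b[of n x]] mult_right_mono[OF a(2)[of n]] M1(1) M2(1) by force+
  have d1lim: "(\<lambda>n. dx1 (\<eta> n) x) \<longlonglongrightarrow> 0" and d2lim: "(\<lambda>n. dx2 (\<eta> n) x) \<longlonglongrightarrow> 0" for x
  proof -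
    have l: "(\<lambda>n. a n * M1) \<longlonglongrightarrow> 0" "(\<lambda>n. a n * M2) \<longlonglongrightarrow> 0"
      using tendsto_mult_left_zero[OF alim] by auto
    show "(\<lambda>n. dx1 (\<eta> n) x) \<longlonglongrightarrow> 0"
      by (rule Lim_null_comparison[OF always_eventually l(1)]) (intro allI d1b)
    show "(\<lambda>n. dx2 (\<eta> n) x) \<longlonglongrightarrow> 0"
      by (rule Lim_null_comparison[OF always_eventually l(2)]) (intro allI d2b)
  qed
  have gL: "dx1 v \<in> L2 L" "dx2 v \<in> L2 L" using g unfolding grad_def[abs_def] L2_Pair_iff by auto
  have conv: "(\<lambda>n. sq_norm L (\<lambda>x. q n x * f x)) \<longlonglongrightarrow> 0" "(\<lambda>x. q n x * f x) \<in> L2 L"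
    if f: "f \<in> L2 L" and q: "\<And>n. smooth (q n)" "\<And>n x. norm (q n x) \<le> B" "\<And>x. (\<lambda>n. q n x) \<longlonglongrightarrow> 0" for f q B n
  proof -
    have m: "(\<lambda>x. q n x * f x) \<in> borel_measurable L" for n
      by (intro borel_measurable_times smooth_L_borel q L2_measurable f)
    have b: "norm (q n x * f x) \<le> B * norm (f x)" for n x
      unfolding norm_mult using q(2) by (intro mult_right_mono) auto
    show "(\<lambda>n. sq_norm L (\<lambda>x. q n x * f x)) \<longlonglongrightarrow> 0"
      by (rule L2_dominated[OF f m b]) (intro tendsto_mult_left_zero q)
    show "(\<lambda>x. q n x * f x) \<in> L2 L" by (rule L2_bound(1)[OF f m b])
  qed
  have s1: "smooth (\<lambda>x. \<eta> n x - 1)" for n by (intro smooth_diff smooth_const s\<eta>)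
  note c0 = conv[OF v(2) s1 \<eta>b \<eta>lim] and c1 = conv[OF gL(1) s1 \<eta>b \<eta>lim] and c2 = conv[OF gL(2) s1 \<eta>b \<eta>lim]
    and c3 = conv[OF v(2) smooth_dx(1)[OF s\<eta>] d1b' d1lim] and c4 = conv[OF v(2) smooth_dx(2)[OF s\<eta>] d2b' d2lim]
  define b where "b n = sq_norm L (\<lambda>x. (\<eta> n x - 1) * v x) + (2 * sq_norm L (\<lambda>x. (\<eta> n x - 1) * dx1 v x) + 2 * sq_norm L (\<lambda>x. dx1 (\<eta> n) x * v x)
      + (2 * sq_norm L (\<lambda>x. (\<eta> n x - 1) * dx2 v x) + 2 * sq_norm L (\<lambda>x. dx2 (\<eta> n) x * v x)))" for n
  have bound: "sq_norm L (\<lambda>x. \<phi> n x - v x) + sq_norm L (\<lambda>x. grad (\<phi> n) x - grad v x) \<le> b n" for n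
  proof -
    note d = smooth_differentiable[OF s\<eta>[of n]] smooth_differentiable[OF v(1)]
    have e1: "(\<lambda>x. \<phi> n x - v x) = (\<lambda>x. (\<eta> n x - 1) * v x)" by (auto simp: \<phi>_def algebra_simps)
    have e2: "(\<lambda>x. grad (\<phi> n) x - grad v x) = (\<lambda>x. ((\<eta> n x - 1) * dx1 v x + dx1 (\<eta> n) x * v x, (\<eta> n x - 1) * dx2 v x + dx2 (\<eta> n) x * v x))"
      unfolding grad_def \<phi>_def[abs_def] dx_mult[OF d] by (auto simp: algebra_simps)
    show ?thesis unfolding e1 e2 b_def
      using L2_add[OF c1(2)[of n] c3(2)[of n]] L2_add[OF c2(2)[of n] c4(2)[of n]] by (subst sq_norm_Pair) auto
  qed
  have "b \<longlonglongrightarrow> 0 + (2 * 0 + 2 * 0 + (2 * 0 + 2 * 0))"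
    unfolding b_def[abs_def] by (intro tendsto_intros c0 c1 c2 c3 c4)
  then have "eventually (\<lambda>n. b n < e) sequentially" using e by (intro order_tendstoD) auto
  then obtain n where "b n < e" by (auto simp: eventually_sequentially)
  then show ?thesis using bound[of n] \<phi>t[of n] by (intro bexI[of _ "\<phi> n"]) auto
qed

lemma sq_norm_le_nn:
  fixes f :: "plane \<Rightarrow> complex"
  assumes ae: "AE x in L. f x = F x" and f: "f \<in> borel_measurable L"
    and F: "(\<integral>\<^sup>+x. (norm (F x))\<^sup>2 \<partial>lborel) \<le> ennreal e" and e: "e \<ge> 0"
  shows "f \<in> L2 L" "sq_norm L f \<le> e"
proof -
  have "(\<integral>\<^sup>+x. (norm (f x))\<^sup>2 \<partial>L) = (\<integral>\<^sup>+x. (norm (F x))\<^sup>2 \<partial>L)"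
    using ae by (intro nn_integral_cong_AE) (auto elim: eventually_mono)
  also have "\<dots> \<le> (\<integral>\<^sup>+x. (norm (F x))\<^sup>2 \<partial>lborel)"
    unfolding L_nn_integral by (intro nn_integral_mono) (auto simp: indicator_def)
  finally have le: "(\<integral>\<^sup>+x. (norm (f x))\<^sup>2 \<partial>L) \<le> ennreal e" using F by (rule order_trans)
  have i: "integrable L (\<lambda>x. (norm (f x))\<^sup>2)"
  proof (rule integrableI_bounded)
    show "(\<integral>\<^sup>+x. ennreal (norm ((norm (f x))\<^sup>2)) \<partial>L) < \<infinity>" using le by (simp add: order_le_less_trans)
  qed (use f in measurable)
  then show "f \<in> L2 L" using f by (simp add: L2_def)
  have "ennreal (sq_norm L f) = (\<integral>\<^sup>+x. (norm (f x))\<^sup>2 \<partial>L)"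
    unfolding sq_norm_def using nn_integral_eq_integral[OF i] by simp
  with le have "ennreal (sq_norm L f) \<le> ennreal e" by simp
  then show "sq_norm L f \<le> e" using e by (simp add: ennreal_le_iff)
qed

text \<open>On \<open>U\<close> the classical gradient of a smoothing by a cone mollifier is the smoothing of the weak gradient, so
the function and its gradient are approximated by the same mollification. The result is smooth on the whole plane, also across the
boundary, and a cutoff makes it a test function.\<close>

lemma density:
  assumes u: "u \<in> L2 L" and g: "is_weak_gradient U u g" and e: "e > 0"
  shows "\<exists>\<phi>\<in>test_functions UNIV. sq_norm L (\<lambda>x. \<phi> x - u x) + sq_norm L (\<lambda>x. grad \<phi> x - g x) < e"
proof -
  have g1: "(\<lambda>x. fst (g x)) \<in> L2 L" and g2: "(\<lambda>x. snd (g x)) \<in> L2 L" using L2_fst_snd g by (auto simp: is_weak_gradient_def)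
  obtain F where F[measurable]: "F \<in> borel_measurable borel" and Fae: "AE x in L. u x = F x" and F0: "\<And>x. x \<notin> U \<Longrightarrow> F x = 0"
    and F2: "integrable lborel (\<lambda>x. (norm (F x))\<^sup>2)" using L2_representative[OF u] by blast
  obtain G where G[measurable]: "G \<in> borel_measurable borel" and Gae: "AE x in L. fst (g x) = G x" and G0: "\<And>x. x \<notin> U \<Longrightarrow> G x = 0"
    and G2: "integrable lborel (\<lambda>x. (norm (G x))\<^sup>2)" using L2_representative[OF g1] by blast
  obtain H where H[measurable]: "H \<in> borel_measurable borel" and Hae: "AE x in L. snd (g x) = H x" and H0: "\<And>x. x \<notin> U \<Longrightarrow> H x = 0"
    and H2: "integrable lborel (\<lambda>x. (norm (H x))\<^sup>2)" using L2_representative[OF g2] by blast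
  \<comment> \<open>Two applications of the triangle inequality for squares, each with a factor \<open>2\<close>, add up to at most \<open>8 e\'\<close>.\<close>
  define e' where "e' = e / 16"
  have e': "e' > 0" using e by (simp add: e'_def)
  obtain d1 where d1: "d1 > 0" "\<And>y. norm y < d1 \<Longrightarrow> (\<integral>\<^sup>+x. (norm (F (x + y) - F x))\<^sup>2 \<partial>lborel) \<le> ennreal e'"
    using L2_translation_continuous[OF F F2 e'] by blast
  obtain d2 where d2: "d2 > 0" "\<And>y. norm y < d2 \<Longrightarrow> (\<integral>\<^sup>+x. (norm (G (x + y) - G x))\<^sup>2 \<partial>lborel) \<le> ennreal e'"
    using L2_translation_continuous[OF G G2 e'] by blast
  obtain d3 where d3: "d3 > 0" "\<And>y. norm y < d3 \<Longrightarrow> (\<integral>\<^sup>+x. (norm (H (x + y) - H x))\<^sup>2 \<partial>lborel) \<le> ennreal e'"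
    using L2_translation_continuous[OF H H2 e'] by blast
  have dpos: "min d1 (min d2 d3) > 0" using d1 d2 d3 by simp
  obtain r C where r: "mollifier r" "compact C" "C \<subseteq> U \<inter> ball 0 (min d1 (min d2 d3))" "\<And>x. x \<notin> C \<Longrightarrow> r x = 0"
    using cone_mollifier[OF dpos] by blast
  have rsmall: "norm y < d1 \<and> norm y < d2 \<and> norm y < d3" if "r y \<noteq> 0" for y
  proof -
    have "y \<in> C" using r(4)[of y] that by metis
    then show ?thesis using r(3) by auto
  qed
  have CU: "C \<subseteq> U" using r(3) by auto
  let ?r = "\<lambda>x. complex_of_real (r x)"
  have rt: "?r \<in> test_functions UNIV" using r(1) by (simp add: mollifier_def)
  note sr = test_functions_smooth[OF rt]
  note [measurable] = smooth_measurable[OF sr] smooth_measurable[OF smooth_dx(1)[OF sr]] smooth_measurable[OF smooth_dx(2)[OF sr]]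
  define v where "v = smoothing ?r F"
  have sv: "smooth v" unfolding v_def by (rule smooth_smoothing[OF rt L2_locally_integrable[OF F F2]])
  have dv: "dx1 v x = smoothing ?r G x \<and> dx2 v x = smoothing ?r H x" if x: "x \<in> U" for x
  proof -
    have s: "dx1 (\<lambda>z. ?r (z - x)) z = dx1 ?r (z - x)" "dx2 (\<lambda>z. ?r (z - x)) z = dx2 ?r (z - x)" for z
      using dx_shift[of ?r z "- x"] smooth_differentiable[OF sr] by simp_all
    note w = weak_gradientD[OF g mollifier_shift_test[OF r(1,2) CU r(4) x], unfolded s]
    have "dx1 v x = - smoothing (dx1 ?r) F x" "dx2 v x = - smoothing (dx2 ?r) F x"
      unfolding v_def by (rule dx_smoothing[OF rt L2_locally_integrable[OF F F2]])+
    moreover have "smoothing (dx1 ?r) F x = (\<integral>z. u z * dx1 ?r (z - x) \<partial>L)" "smoothing (dx2 ?r) F x = (\<integral>z. u z * dx2 ?r (z - x) \<partial>L)"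
      by (rule smoothing_inside[OF F Fae F0 L2_measurable[OF u]]; measurable)+
    moreover have "smoothing ?r G x = (\<integral>z. fst (g z) * ?r (z - x) \<partial>L)"
      by (rule smoothing_inside[OF G Gae G0 L2_measurable[OF g1]]) measurable
    moreover have "smoothing ?r H x = (\<integral>z. snd (g z) * ?r (z - x) \<partial>L)"
      by (rule smoothing_inside[OF H Hae H0 L2_measurable[OF g2]]) measurable
    ultimately show ?thesis using w by simp
  qed
  have est: "(\<lambda>x. w x - p x) \<in> L2 L \<and> sq_norm L (\<lambda>x. w x - p x) \<le> e'"
    if P: "P \<in> borel_measurable borel" "integrable lborel (\<lambda>x. (norm (P x))\<^sup>2)" "AE x in L. p x = P x" "p \<in> L2 L"
      and P2: "\<And>y. r y \<noteq> 0 \<Longrightarrow> (\<integral>\<^sup>+x. (norm (P (x + y) - P x))\<^sup>2 \<partial>lborel) \<le> ennreal e'"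
      and w: "smooth w" "\<And>x. x \<in> U \<Longrightarrow> w x = smoothing ?r P x" for P p w
  proof -
    have ae: "AE x in L. w x - p x = smoothing ?r P x - P x"
      using P(3) AE_space[of L] by eventually_elim (simp add: w(2))
    have m: "(\<lambda>x. w x - p x) \<in> borel_measurable L"
      by (intro borel_measurable_diff smooth_L_borel w L2_measurable P)
    show ?thesis
      using sq_norm_le_nn[OF ae m mollifier_L2_estimate[OF r(1) P(1,2) P2]] e' by simp
  qed
  have E1: "(\<lambda>x. v x - u x) \<in> L2 L \<and> sq_norm L (\<lambda>x. v x - u x) \<le> e'"
    by (rule est[OF F F2 Fae u _ sv]) (use d1(2) rsmall v_def in auto)
  have E2: "(\<lambda>x. dx1 v x - fst (g x)) \<in> L2 L \<and> sq_norm L (\<lambda>x. dx1 v x - fst (g x)) \<le> e'"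
    by (rule est[OF G G2 Gae g1 _ smooth_dx(1)[OF sv]]) (use d2(2) rsmall dv in auto)
  have E3: "(\<lambda>x. dx2 v x - snd (g x)) \<in> L2 L \<and> sq_norm L (\<lambda>x. dx2 v x - snd (g x)) \<le> e'"
    by (rule est[OF H H2 Hae g2 _ smooth_dx(2)[OF sv]]) (use d3(2) rsmall dv in auto)
  have vL: "v \<in> L2 L" using L2_add(1)[OF conjunct1[OF E1] u] by simp
  have "dx1 v \<in> L2 L" "dx2 v \<in> L2 L" using L2_add(1)[OF conjunct1[OF E2] g1] L2_add(1)[OF conjunct1[OF E3] g2] by simp_all
  then have gvL: "grad v \<in> L2 L" unfolding grad_def[abs_def] L2_Pair_iff by simp
  obtain \<phi> where \<phi>: "\<phi> \<in> test_functions UNIV" "sq_norm L (\<lambda>x. \<phi> x - v x) + sq_norm L (\<lambda>x. grad \<phi> x - grad v x) < e'"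
    using density_smooth[OF sv vL gvL e'] by blast
  have "sq_norm L (\<lambda>x. \<phi> x - u x) \<le> 2 * sq_norm L (\<lambda>x. \<phi> x - v x) + 2 * sq_norm L (\<lambda>x. v x - u x)"
    by (rule sq_norm_triangle[OF test_functions_L2[OF \<phi>(1)] vL u])
  moreover have "sq_norm L (\<lambda>x. grad \<phi> x - g x) \<le> 2 * sq_norm L (\<lambda>x. grad \<phi> x - grad v x) + 2 * sq_norm L (\<lambda>x. grad v x - g x)"
    by (rule sq_norm_triangle[OF grad_test_functions_L2[OF \<phi>(1)] gvL weak_gradient_L2[OF g]])
  moreover have "sq_norm L (\<lambda>x. grad v x - g x) = sq_norm L (\<lambda>x. (dx1 v x - fst (g x), dx2 v x - snd (g x)))"
    by (intro arg_cong[where f="sq_norm L"]) (auto simp: grad_def fun_eq_iff prod_eq_iff)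
  moreover have "\<dots> = sq_norm L (\<lambda>x. dx1 v x - fst (g x)) + sq_norm L (\<lambda>x. dx2 v x - snd (g x))"
    using E2 E3 by (intro sq_norm_Pair) auto
  ultimately have "sq_norm L (\<lambda>x. \<phi> x - u x) + sq_norm L (\<lambda>x. grad \<phi> x - g x) < e"
    using \<phi>(2) E1 E2 E3 sq_norm_nonneg[of L "\<lambda>x. \<phi> x - v x"] sq_norm_nonneg[of L "\<lambda>x. grad \<phi> x - grad v x"] unfolding e'_def by linarith
  then show ?thesis using \<phi>(1) by blast
qed

end

section \<open>Length of rays and slices of the plane\<close>

lemma sets_hausdorff1 [simp, measurable_cong]: "sets (hausdorff1 :: 'a::metric_space measure) = sets borel"
  unfolding hausdorff1_def by (simp add: sets_measure_of_conv sets.sigma_sets_eq[of borel, simplified])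

lemma space_hausdorff1 [simp]: "space (hausdorff1 :: 'a::metric_space measure) = UNIV"
  unfolding hausdorff1_def by (simp add: space_measure_of_conv)

text \<open>Holds in either case of the definition of \<^const>\<open>measure_of\<close>, which returns the given set function or \<open>0\<close>.\<close>

lemma emeasure_hausdorff1_le: "emeasure hausdorff1 A \<le> hausdorff1_outer A"
  unfolding hausdorff1_def by (simp add: emeasure_measure_of_conv)

text \<open>Cut the segment into equal pieces shorter than \<open>\<delta>\<close>.\<close>

lemma hausdorff1_outer_segment:
  fixes p :: "'a::real_normed_vector"
  assumes p: "norm p = 1" and ab: "a \<le> b"
  shows "hausdorff1_outer ((\<lambda>s. s *\<^sub>R p) ` {a..b}) \<le> ennreal (b - a)"
  unfolding hausdorff1_outer_def
proof (rule SUP_least)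
  fix \<delta> :: real assume "\<delta> \<in> {0<..}"
  then have \<delta>: "\<delta> > 0" by simp
  obtain m :: nat where m: "(b - a) / \<delta> < m" using reals_Archimedean2 by blast
  then have m0: "m > 0" using ab \<delta> by (cases m) (auto simp: divide_less_0_iff)
  define h where "h = (b - a) / m"
  have h0: "h \<ge> 0" using ab by (simp add: h_def)
  have h: "h \<le> \<delta>" using m m0 \<delta> by (simp add: h_def field_simps)
  define C where "C n = (if n < m then (\<lambda>s. s *\<^sub>R p) ` {a + n * h..a + Suc n * h} else {})" for n :: nat
  have dC: "diameter (C n) \<le> h" for n
    unfolding C_def
  proof (cases "n < m", simp_all only: if_True if_False)
    show "diameter ((\<lambda>s. s *\<^sub>R p) ` {a + real n * h..a + real (Suc n) * h}) \<le> h"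
    proof (rule diameter_le)
      fix x y assume "x \<in> (\<lambda>s. s *\<^sub>R p) ` {a + real n * h..a + real (Suc n) * h}" "y \<in> (\<lambda>s. s *\<^sub>R p) ` {a + real n * h..a + real (Suc n) * h}"
      then obtain s t where st: "x = s *\<^sub>R p" "y = t *\<^sub>R p" "s \<in> {a + real n * h..a + real (Suc n) * h}" "t \<in> {a + real n * h..a + real (Suc n) * h}"
        by blast
      then have "\<bar>s - t\<bar> \<le> h" by (auto simp: distrib_right abs_le_iff)
      then show "norm (x - y) \<le> h" using st p by (simp flip: scaleR_diff_left)
    qed (use h0 in simp)
  qed (use h0 in simp)
  have bC: "bounded (C n)" for n
    unfolding C_def by (auto intro!: compact_imp_bounded compact_continuous_image continuous_intros)
  have cover: "(\<lambda>s. s *\<^sub>R p) ` {a..b} \<subseteq> (\<Union>n. C n)"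
  proof (rule image_subsetI)
    fix s assume s: "s \<in> {a..b}"
    show "s *\<^sub>R p \<in> (\<Union>n. C n)"
    proof (cases "s = b")
      case True
      have "b \<in> {a + real (m - 1) * h..a + real (Suc (m - 1)) * h}"
        using m0 h0 ab by (auto simp: h_def of_nat_diff field_simps)
      then show ?thesis using True m0 by (auto simp: C_def intro!: exI[of _ "m - 1"])
    next
      case False
      then have "b > a" using s by auto
      then have hp: "h > 0" using m0 by (simp add: h_def)
      define n where "n = nat \<lfloor>(s - a) / h\<rfloor>"
      have n: "real n \<le> (s - a) / h" "(s - a) / h < real n + 1"
        using s hp unfolding n_def by (auto simp: of_nat_nat) 
      have "(s - a) / h < m" using s False hp m0 \<open>b > a\<close> by (simp add: h_def field_simps)
      then have "n < m" using n(1) by linarith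
      moreover have "s \<in> {a + n * h..a + Suc n * h}" using n hp by (auto simp: field_simps)
      ultimately show ?thesis by (auto simp: C_def intro!: exI[of _ n])
    qed
  qed
  have "hausdorff1_pre \<delta> ((\<lambda>s. s *\<^sub>R p) ` {a..b}) \<le> (\<Sum>n. ennreal (diameter (C n)))"
    unfolding hausdorff1_pre_def using cover bC order_trans[OF dC h] by (intro INF_lower) auto
  also have "\<dots> = (\<Sum>n<m. ennreal (diameter (C n)))"
    by (rule suminf_finite) (auto simp: C_def)
  also have "\<dots> \<le> (\<Sum>n<m. ennreal h)" using dC by (intro sum_mono ennreal_leI)
  also have "\<dots> = ennreal (m * h)" using h0 by (simp add: ennreal_mult' ennreal_of_nat_eq_real_of_nat)
  also have "m * h = b - a" using m0 by (simp add: h_def)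
  finally show "hausdorff1_pre \<delta> ((\<lambda>s. s *\<^sub>R p) ` {a..b}) \<le> ennreal (b - a)" .
qed

text \<open>A Borel set of the line is covered up to \<open>e\<close> by intervals with disjoint interiors. The comparison is made on
these interiors, where both measures are additive; the endpoints that are left out form a countable set, and points
are null for \<open>\<nu>\<close>.\<close>

lemma measure_le_lborel:
  fixes \<nu> :: "real measure"
  assumes sets[measurable_cong]: "sets \<nu> = sets borel" and seg: "\<And>a b. a \<le> b \<Longrightarrow> emeasure \<nu> {a..b} \<le> ennreal (b - a)"
  shows "\<nu> \<le> lborel"
proof -
  have null: "emeasure \<nu> E = 0" if E: "countable E" for E
  proof -
    have "emeasure \<nu> (\<Union>x\<in>E. {x}) = (\<integral>\<^sup>+x. emeasure \<nu> {x} \<partial>count_space E)"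
      by (rule emeasure_UN_countable) (auto simp: E disjoint_family_on_def)
    also have "\<dots> = (\<integral>\<^sup>+x. 0 \<partial>count_space E)"
      using seg[of x x for x] by (intro nn_integral_cong) (simp add: antisym)
    finally show ?thesis by simp
  qed
  have bounded: "emeasure \<nu> B \<le> emeasure lborel B" if [measurable]: "B \<in> sets borel" and Bab: "B \<subseteq> {a..b}" for B a b
  proof (rule ennreal_le_epsilon)
    fix e :: real assume e: "e > 0"
    have Bl: "B \<in> lmeasurable" using Bab
      by (intro bounded_set_imp_lmeasurable bounded_subset[OF bounded_closed_interval]) (auto intro: sets_completionI_sets)
    obtain \<D> where D: "countable \<D>" "\<And>K. K \<in> \<D> \<Longrightarrow> K \<subseteq> cbox a b \<and> K \<noteq> {} \<and> (\<exists>c d. K = cbox c d)"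
        "pairwise (\<lambda>A B. interior A \<inter> interior B = {}) \<D>" "B \<subseteq> \<Union>\<D>" "\<Union>\<D> \<in> lmeasurable"
        "measure lebesgue (\<Union>\<D>) \<le> measure lebesgue B + e"
      using measurable_outer_intervals_bounded[OF Bl _ e, of a b] Bab by (metis cbox_interval)
    have Kb [measurable]: "K \<in> sets borel" "interior K \<in> sets borel" if "K \<in> \<D>" for K using D(2)[OF that] by auto
    have disj: "disjoint_family_on interior \<D>" using D(3) by (auto simp: disjoint_family_on_def pairwise_def)
    have Kint: "emeasure \<nu> (interior K) \<le> emeasure lborel (interior K)" "countable (K - interior K)" if KD: "K \<in> \<D>" for K
    proof -
      obtain c d where K: "K = cbox c d" "c \<le> d" using D(2)[OF KD] by (metis cbox_interval atLeastatMost_empty_iff)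
      have "emeasure \<nu> (interior K) \<le> emeasure \<nu> {c..d}" using K by (intro emeasure_mono) (auto simp: sets)
      also have "\<dots> \<le> ennreal (d - c)" by (rule seg) fact
      also have "\<dots> = emeasure lborel (interior K)" using K by (simp add: interior_cbox)
      finally show "emeasure \<nu> (interior K) \<le> emeasure lborel (interior K)" .
      have "K - interior K \<subseteq> {c, d}" using K by (auto simp: interior_cbox)
      then show "countable (K - interior K)" by (rule countable_subset) simp
    qed
    have mE: "(\<Union>K\<in>\<D>. K - interior K) \<in> sets borel" "(\<Union>K\<in>\<D>. interior K) \<in> sets borel" "\<Union>\<D> \<in> sets borel"
      using D(1) Kb by (auto intro!: sets.countable_UN' sets.countable_Union)
    have "emeasure \<nu> B \<le> emeasure \<nu> ((\<Union>K\<in>\<D>. interior K) \<union> (\<Union>K\<in>\<D>. K - interior K))"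
      using D(4) mE by (intro emeasure_mono) (auto simp: sets)
    also have "\<dots> \<le> emeasure \<nu> (\<Union>K\<in>\<D>. interior K) + emeasure \<nu> (\<Union>K\<in>\<D>. K - interior K)"
      using mE by (intro emeasure_subadditive) (auto simp: sets)
    also have "emeasure \<nu> (\<Union>K\<in>\<D>. K - interior K) = 0"
      using D(1) Kint(2) by (intro null countable_UN)
    also have "emeasure \<nu> (\<Union>K\<in>\<D>. interior K) = (\<integral>\<^sup>+K. emeasure \<nu> (interior K) \<partial>count_space \<D>)"
      using D(1) disj Kb by (intro emeasure_UN_countable) (auto simp: sets)
    also have "\<dots> \<le> (\<integral>\<^sup>+K. emeasure lborel (interior K) \<partial>count_space \<D>)"
      using Kint(1) by (intro nn_integral_mono) auto
    also have "\<dots> = emeasure lborel (\<Union>K\<in>\<D>. interior K)"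
      using D(1) disj Kb by (intro emeasure_UN_countable[symmetric]) auto
    also have "\<dots> \<le> emeasure lborel (\<Union>\<D>)"
    proof (rule emeasure_mono)
      show "(\<Union>K\<in>\<D>. interior K) \<subseteq> \<Union>\<D>"
        by (intro UN_least order_trans[OF interior_subset Union_upper])
    qed (use mE in simp)
    also have "\<dots> = ennreal (measure lebesgue (\<Union>\<D>))"
      using emeasure_eq_measure2[OF D(5)] emeasure_completion[of "\<Union>\<D>" lborel] mE(3) by simp
    also have "\<dots> \<le> ennreal (measure lebesgue B + e)" using D(6) by (rule ennreal_leI)
    also have "\<dots> = ennreal (measure lebesgue B) + ennreal e" using e by (intro ennreal_plus) auto
    also have "ennreal (measure lebesgue B) = emeasure lborel B"
      using emeasure_eq_measure2[OF Bl] emeasure_completion[of B lborel] that(1) by simp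
    finally show "emeasure \<nu> B \<le> emeasure lborel B + ennreal e" by simp
  qed
  have "emeasure \<nu> B \<le> emeasure lborel B" if [measurable]: "B \<in> sets borel" for B
  proof -
    have 2: "(\<Union>n::nat. B \<inter> {- real n..real n}) = B"
    proof -
      have "\<exists>n::nat. x \<in> {- real n..real n}" for x :: real
      proof -
        obtain n :: nat where "\<bar>x\<bar> \<le> real n" using real_arch_simple[of "\<bar>x\<bar>"] by blast
        then show ?thesis by (intro exI[of _ n]) auto
      qed
      then show ?thesis by blast
    qed
    have 1: "(SUP n::nat. emeasure \<nu> (B \<inter> {- real n..real n})) = emeasure \<nu> (\<Union>n::nat. B \<inter> {- real n..real n})"
      by (rule SUP_emeasure_incseq) (auto simp: sets incseq_def)
    have le: "emeasure \<nu> (B \<inter> {- real n..real n}) \<le> emeasure lborel B" for n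
      using bounded[of "B \<inter> {- real n..real n}" "- real n" "real n"]
      by (rule order_trans) (auto intro!: emeasure_mono)
    have "emeasure \<nu> B = (SUP n::nat. emeasure \<nu> (B \<inter> {- real n..real n}))" unfolding 1 2 ..
    also have "\<dots> \<le> emeasure lborel B" by (rule SUP_least) (rule le)
    finally show ?thesis .
  qed
  then have "emeasure \<nu> B \<le> emeasure lborel B" for B
    by (cases "B \<in> sets borel") (simp_all add: emeasure_notin_sets sets)
  then have "emeasure \<nu> \<le> emeasure lborel" by (rule le_funI)
  then show ?thesis using sets sets_eq_imp_space_eq[OF sets] by (simp add: le_measure_iff)
qed

text \<open>Along the line spanned by \<open>p\<close>, the Hausdorff measure is transported to the real axis by the inner product with
\<open>p\<close>, and compared there with Lebesgue measure.\<close>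

lemma nn_integral_ray_le:
  fixes p :: plane and g :: "plane \<Rightarrow> ennreal"
  assumes p: "norm p = 1" and g[measurable]: "g \<in> borel_measurable borel"
  shows "(\<integral>\<^sup>+x. g x * indicator ((\<lambda>s. s *\<^sub>R p) ` {0..}) x \<partial>hausdorff1) \<le> (\<integral>\<^sup>+s. g (s *\<^sub>R p) * indicator {0..} s \<partial>lborel)"
proof -
  let ?\<gamma> = "\<lambda>s::real. s *\<^sub>R p"
  define A where "A = {x::plane. x = (x \<bullet> p) *\<^sub>R p}"
  have pp: "p \<bullet> p = 1" using p by (simp add: dot_square_norm)
  have "closed A" unfolding A_def by (intro closed_Collect_eq continuous_intros)
  then have [measurable]: "A \<in> sets borel" by simp
  define \<nu> where "\<nu> = distr (restrict_space hausdorff1 A) borel (\<lambda>x. x \<bullet> p)"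
  have m: "(\<lambda>x. x \<bullet> p) \<in> restrict_space hausdorff1 A \<rightarrow>\<^sub>M borel"
    by (intro measurable_restrict_space1) measurable
  have seg: "emeasure \<nu> {a..b} \<le> ennreal (b - a)" if "a \<le> b" for a b
  proof -
    have "emeasure \<nu> {a..b} = emeasure (restrict_space hausdorff1 A) ((\<lambda>x. x \<bullet> p) -` {a..b} \<inter> A)"
      unfolding \<nu>_def by (subst emeasure_distr[OF m]) (simp_all add: space_restrict_space)
    also have "\<dots> = emeasure hausdorff1 ((\<lambda>x. x \<bullet> p) -` {a..b} \<inter> A)"
      by (rule emeasure_restrict_space) auto
    also have "(\<lambda>x. x \<bullet> p) -` {a..b} \<inter> A = ?\<gamma> ` {a..b}"
      using pp by (auto simp: A_def)
    also have "emeasure hausdorff1 \<dots> \<le> ennreal (b - a)"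
      using emeasure_hausdorff1_le hausdorff1_outer_segment[OF p that] by (rule order_trans)
    finally show ?thesis .
  qed
  have le: "\<nu> \<le> lborel" by (rule measure_le_lborel) (use seg in \<open>auto simp: \<nu>_def\<close>)
  let ?G = "\<lambda>s. g (s *\<^sub>R p) * indicator {0..} s"
  have "(\<integral>\<^sup>+x. g x * indicator (?\<gamma> ` {0..}) x \<partial>hausdorff1) = (\<integral>\<^sup>+x. ?G (x \<bullet> p) * indicator A x \<partial>hausdorff1)"
  proof (rule nn_integral_cong)
    fix x :: plane
    have "x \<in> ?\<gamma> ` {0..} \<longleftrightarrow> x \<in> A \<and> x \<bullet> p \<ge> 0" using pp by (auto simp: A_def)
    moreover have "x \<in> A \<Longrightarrow> (x \<bullet> p) *\<^sub>R p = x" by (simp add: A_def)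
    ultimately show "g x * indicator (?\<gamma> ` {0..}) x = ?G (x \<bullet> p) * indicator A x"
      by (simp add: indicator_def)
  qed
  also have "\<dots> = (\<integral>\<^sup>+x. ?G (x \<bullet> p) \<partial>restrict_space hausdorff1 A)"
    by (rule nn_integral_restrict_space[symmetric]) simp
  also have "\<dots> = (\<integral>\<^sup>+s. ?G s \<partial>\<nu>)"
    unfolding \<nu>_def by (rule nn_integral_distr[symmetric, OF m]) measurable
  also have "\<dots> \<le> (\<integral>\<^sup>+s. ?G s \<partial>lborel)"
    by (rule nn_integral_mono_measure[OF _ le]) (simp add: \<nu>_def)
  finally show ?thesis .
qed

text \<open>Integrate the derivative of \<open>(1 - t / L) |f t|\<^sup>2\<close>, which is \<open>0\<close> at \<open>L\<close>. The derivative of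
the cutoff costs \<open>1 / L\<close>, and the mixed term is split with the parameter \<open>a\<close>. For \<open>a = 1\<close> and \<open>L\<close> large this is the sharp bound
by \<open>-1\<close> for the half-line with the same boundary condition.\<close>

lemma half_line_trace_inequality:
  fixes f f' :: "real \<Rightarrow> complex"
  assumes f: "\<And>t. (f has_vector_derivative f' t) (at t)" and f': "continuous_on UNIV f'"
    and a: "a > 0" and L: "L > 0"
  shows "ennreal ((norm (f 0))\<^sup>2) \<le> (\<integral>\<^sup>+t. ennreal (a * (norm (f' t))\<^sup>2 + (1 / a + 1 / L) * (norm (f t))\<^sup>2) * indicator {0<..<L} t \<partial>lborel)"
proof -
  have fc: "continuous_on UNIV f"
    using f by (auto simp: continuous_on_eq_continuous_at intro: has_vector_derivative_continuous)
  define q where "q t = (norm (f t))\<^sup>2 / L - (1 - t / L) * (2 * (f t \<bullet> f' t))" for t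
  define W where "W t = a * (norm (f' t))\<^sup>2 + (1 / a + 1 / L) * (norm (f t))\<^sup>2" for t
  have qc: "continuous_on UNIV q" and Wc: "continuous_on UNIV W" unfolding q_def W_def using f' fc L
    by (auto intro!: continuous_intros)
  have D: "((\<lambda>t. - ((1 - t / L) * (f t \<bullet> f t))) has_real_derivative q t) (at t)" for t
  proof -
    have "((\<lambda>t. f t \<bullet> f t) has_derivative (\<lambda>h. f t \<bullet> (h *\<^sub>R f' t) + (h *\<^sub>R f' t) \<bullet> f t)) (at t)"
      using f[of t] unfolding has_vector_derivative_def by (intro has_derivative_inner)
    then have "((\<lambda>t. f t \<bullet> f t) has_real_derivative 2 * (f t \<bullet> f' t)) (at t)"
      unfolding has_field_derivative_def by (rule has_derivative_eq_rhs) (auto simp: inner_commute)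
    moreover have "((\<lambda>t. 1 - t / L) has_real_derivative - (1 / L)) (at t)"
      using L by (auto intro!: derivative_eq_intros)
    ultimately have "((\<lambda>t. - ((1 - t / L) * (f t \<bullet> f t))) has_real_derivative
        - ((1 - t / L) * (2 * (f t \<bullet> f' t)) + - (1 / L) * (f t \<bullet> f t))) (at t)"
      by (intro DERIV_minus) (rule DERIV_mult')
    then show ?thesis
      unfolding q_def by (rule DERIV_cong) (simp add: dot_square_norm)
  qed
  have "has_bochner_integral lborel (\<lambda>t. q t * indicator {0..L} t) (- ((1 - L / L) * (f L \<bullet> f L)) - (- ((1 - 0 / L) * (f 0 \<bullet> f 0))))"
    using D qc L by (intro has_bochner_integral_FTC_Icc_real) (auto simp: continuous_on_eq_continuous_at)
  then have q0: "integrable lborel (\<lambda>t. q t * indicator {0..L} t)" "(\<integral>t. q t * indicator {0..L} t \<partial>lborel) = (norm (f 0))\<^sup>2"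
    using L by (auto simp: has_bochner_integral_iff dot_square_norm)
  have Wi: "integrable lborel (\<lambda>t. W t * indicator {0..L} t)"
    using borel_integrable_atLeastAtMost[of 0 L W] Wc by (simp add: continuous_on_eq_continuous_at mult.commute)
  have qW: "q t \<le> W t" if "t \<in> {0..L}" for t
  proof -
    have G: "0 \<le> 1 - t / L" "1 - t / L \<le> 1" using that L by auto
    have "\<bar>f t \<bullet> f' t\<bar> \<le> norm (f t) * norm (f' t)" by (rule Cauchy_Schwarz_ineq2)
    moreover have "\<bar>(1 - t / L) * (2 * (f t \<bullet> f' t))\<bar> \<le> 1 * \<bar>2 * (f t \<bullet> f' t)\<bar>"
      unfolding abs_mult[of "1 - t / L"] using G by (intro mult_right_mono) auto
    ultimately have "- ((1 - t / L) * (2 * (f t \<bullet> f' t))) \<le> 2 * (norm (f t) * norm (f' t))" by linarith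
    also have "\<dots> \<le> a * (norm (f' t))\<^sup>2 + (1 / a) * (norm (f t))\<^sup>2"
    proof -
      have "0 \<le> (a * norm (f' t) - norm (f t))\<^sup>2 / a" using a by simp
      also have "\<dots> = a * (norm (f' t))\<^sup>2 + (1 / a) * (norm (f t))\<^sup>2 - 2 * (norm (f t) * norm (f' t))"
        using a by (simp add: power2_eq_square field_simps)
      finally show ?thesis by simp
    qed
    finally show ?thesis by (simp add: q_def W_def algebra_simps)
  qed
  have Wnn: "W t \<ge> 0" for t using a L by (simp add: W_def)
  have "(norm (f 0))\<^sup>2 \<le> (\<integral>t. W t * indicator {0..L} t \<partial>lborel)"
    unfolding q0(2)[symmetric] by (rule integral_mono[OF q0(1) Wi]) (auto simp: indicator_def qW)
  then have "ennreal ((norm (f 0))\<^sup>2) \<le> ennreal (\<integral>t. W t * indicator {0..L} t \<partial>lborel)" by (rule ennreal_leI)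
  also have "\<dots> = (\<integral>\<^sup>+t. ennreal (W t * indicator {0..L} t) \<partial>lborel)"
    using Wi Wnn by (intro nn_integral_eq_integral[symmetric]) auto
  also have "\<dots> = (\<integral>\<^sup>+t. ennreal (W t) * indicator {0<..<L} t \<partial>lborel)"
  proof (rule nn_integral_cong_AE)
    show "AE t in lborel. ennreal (W t * indicator {0..L} t) = ennreal (W t) * indicator {0<..<L} t"
      using AE_lborel_singleton[of 0] AE_lborel_singleton[of L]
      by eventually_elim (auto simp: indicator_def)
  qed
  finally show ?thesis by (simp add: W_def)
qed

text \<open>The linear substitution is a composition of two shears, each of which is an affine substitution in one
variable for a fixed value of the other.\<close>

lemma nn_integral_linear_plane:
  fixes g :: "plane \<Rightarrow> ennreal"
  assumes [measurable]: "g \<in> borel_measurable borel" and a: "a \<noteq> 0" and D: "a * d - b * c \<noteq> 0"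
  shows "ennreal \<bar>a * d - b * c\<bar> * (\<integral>\<^sup>+s. \<integral>\<^sup>+t. g (s * a + t * c, s * b + t * d) \<partial>lborel \<partial>lborel) = (\<integral>\<^sup>+x. g x \<partial>lborel)"
proof -
  let ?D = "a * d - b * c"
  have [measurable]: "g \<in> borel_measurable (borel \<Otimes>\<^sub>M borel)" by (simp add: borel_prod)
  define J where "J x = (\<integral>\<^sup>+t. g (x, x * b / a + ?D / a * t) \<partial>lborel)" for x
  have Jm [measurable]: "J \<in> borel_measurable borel" unfolding J_def by measurable
  have "(\<integral>\<^sup>+s. \<integral>\<^sup>+t. g (s * a + t * c, s * b + t * d) \<partial>lborel \<partial>lborel) = (\<integral>\<^sup>+t. \<integral>\<^sup>+s. g (s * a + t * c, s * b + t * d) \<partial>lborel \<partial>lborel)"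
    by (rule lborel_pair.Fubini') measurable
  also have "\<dots> = (\<integral>\<^sup>+t. ennreal \<bar>1 / a\<bar> * (\<integral>\<^sup>+x. g (x, x * b / a + ?D / a * t) \<partial>lborel) \<partial>lborel)"
  proof (rule nn_integral_cong)
    fix t
    have e: "((- (t * c) / a + 1 / a * x) * a + t * c, (- (t * c) / a + 1 / a * x) * b + t * d) = (x, x * b / a + ?D / a * t)" for x
      using a by (simp add: field_simps)
    have "(\<integral>\<^sup>+s. g (s * a + t * c, s * b + t * d) \<partial>lborel) =
       ennreal \<bar>1 / a\<bar> * (\<integral>\<^sup>+x. g ((- (t * c) / a + 1 / a * x) * a + t * c, (- (t * c) / a + 1 / a * x) * b + t * d) \<partial>lborel)"
      by (rule nn_integral_real_affine[of "\<lambda>s. g (s * a + t * c, s * b + t * d)" "1 / a" "- (t * c) / a"]) (use a in auto)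
    then show "(\<integral>\<^sup>+s. g (s * a + t * c, s * b + t * d) \<partial>lborel) = ennreal \<bar>1 / a\<bar> * (\<integral>\<^sup>+x. g (x, x * b / a + ?D / a * t) \<partial>lborel)"
      unfolding e .
  qed
  also have "\<dots> = ennreal \<bar>1 / a\<bar> * (\<integral>\<^sup>+t. \<integral>\<^sup>+x. g (x, x * b / a + ?D / a * t) \<partial>lborel \<partial>lborel)"
    by (rule nn_integral_cmult) measurable
  also have "(\<integral>\<^sup>+t. \<integral>\<^sup>+x. g (x, x * b / a + ?D / a * t) \<partial>lborel \<partial>lborel) = (\<integral>\<^sup>+x. J x \<partial>lborel)"
    unfolding J_def by (rule lborel_pair.Fubini') measurable
  finally have I: "(\<integral>\<^sup>+s. \<integral>\<^sup>+t. g (s * a + t * c, s * b + t * d) \<partial>lborel \<partial>lborel) = ennreal \<bar>1 / a\<bar> * (\<integral>\<^sup>+x. J x \<partial>lborel)" .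
  have "(\<integral>\<^sup>+x. g x \<partial>lborel) = (\<integral>\<^sup>+x. g x \<partial>(lborel \<Otimes>\<^sub>M lborel))" by (simp add: lborel_prod)
  also have "\<dots> = (\<integral>\<^sup>+x. \<integral>\<^sup>+y. g (x, y) \<partial>lborel \<partial>lborel)"
    by (rule lborel.nn_integral_fst[symmetric]) simp
  also have "\<dots> = (\<integral>\<^sup>+x. ennreal \<bar>?D / a\<bar> * J x \<partial>lborel)"
    unfolding J_def using a D by (intro nn_integral_cong nn_integral_real_affine) auto
  also have "\<dots> = ennreal \<bar>?D / a\<bar> * (\<integral>\<^sup>+x. J x \<partial>lborel)"
    by (rule nn_integral_cmult) measurable
  also have "ennreal \<bar>?D / a\<bar> = ennreal \<bar>?D\<bar> * ennreal \<bar>1 / a\<bar>"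
    by (simp flip: ennreal_mult' add: abs_mult[symmetric])
  finally show ?thesis unfolding I by (simp add: mult.assoc)
qed

text \<open>The inequality on the half-line is applied on each segment \<open>s p + t q\<close>, \<open>0 < t < L\<close>, and integrated over \<open>s\<close>. The
same lemma serves for segments parallel to the axis of the sector and for segments normal to the edge.\<close>

lemma slice_estimate:
  assumes \<phi>: "\<phi> \<in> test_functions UNIV" and q: "norm q = 1" and p: "fst p \<noteq> 0"
    and D: "fst p * snd q - snd p * fst q \<noteq> 0" and a: "a > 0" and L: "L > 0" and S[measurable]: "S \<in> sets borel"
    and sub: "\<And>s t. s > s0 \<Longrightarrow> 0 < t \<Longrightarrow> t < L \<Longrightarrow> s *\<^sub>R p + t *\<^sub>R q \<in> S"
  shows "ennreal \<bar>fst p * snd q - snd p * fst q\<bar> * (\<integral>\<^sup>+s. ennreal ((norm (\<phi> (s *\<^sub>R p)))\<^sup>2) * indicator {s0<..} s \<partial>lborel) \<le>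
    (\<integral>\<^sup>+x. ennreal (a * (norm (grad \<phi> x))\<^sup>2 + (1 / a + 1 / L) * (norm (\<phi> x))\<^sup>2) * indicator S x \<partial>lborel)"
proof -
  note sm = test_functions_smooth[OF \<phi>]
  note cont = smooth_continuous[OF sm] smooth_continuous[OF smooth_dx(1)[OF sm]] smooth_continuous[OF smooth_dx(2)[OF sm]]
  define W where "W x = a * (norm (grad \<phi> x))\<^sup>2 + (1 / a + 1 / L) * (norm (\<phi> x))\<^sup>2" for x
  have "continuous_on UNIV W" unfolding W_def grad_def using cont by (intro continuous_intros) auto
  then have [measurable]: "W \<in> borel_measurable borel" by (rule borel_measurable_continuous_onI)
  have pw: "ennreal ((norm (\<phi> (s *\<^sub>R p)))\<^sup>2) * indicator {s0<..} s \<le>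
     (\<integral>\<^sup>+t. ennreal (W (s * fst p + t * fst q, s * snd p + t * snd q)) * indicator S (s * fst p + t * fst q, s * snd p + t * snd q) \<partial>lborel)" for s
  proof (cases "s > s0")
    case True
    define f where "f t = \<phi> (s *\<^sub>R p + t *\<^sub>R q)" for t
    define f' where "f' t = fst q *\<^sub>R dx1 \<phi> (s *\<^sub>R p + t *\<^sub>R q) + snd q *\<^sub>R dx2 \<phi> (s *\<^sub>R p + t *\<^sub>R q)" for t
    have fd: "(f has_vector_derivative f' t) (at t)" for t
    proof -
      have "((\<lambda>t. s *\<^sub>R p + t *\<^sub>R q) has_derivative (\<lambda>h. h *\<^sub>R q)) (at t)" by (auto intro!: derivative_eq_intros)
      from has_derivative_compose[OF this has_derivative_dx[OF smooth_differentiable[OF sm]]]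
      show ?thesis unfolding has_vector_derivative_def f_def f'_def by (simp add: scaleR_add_right mult.commute)
    qed
    have line: "continuous_on UNIV (\<lambda>t. s *\<^sub>R p + t *\<^sub>R q)" by (intro continuous_intros)
    have f'c: "continuous_on UNIV f'" unfolding f'_def
      by (intro continuous_intros continuous_on_compose2[OF cont(2) line] continuous_on_compose2[OF cont(3) line]) auto
    have "norm (f' t) \<le> norm (grad \<phi> (s *\<^sub>R p + t *\<^sub>R q))" for t
    proof -
      let ?x = "s *\<^sub>R p + t *\<^sub>R q"
      have "norm (f' t) \<le> \<bar>fst q\<bar> * norm (dx1 \<phi> ?x) + \<bar>snd q\<bar> * norm (dx2 \<phi> ?x)"
        unfolding f'_def by (rule order_trans[OF norm_triangle_ineq]) simp
      also have "\<dots> = (\<bar>fst q\<bar>, \<bar>snd q\<bar>) \<bullet> (norm (dx1 \<phi> ?x), norm (dx2 \<phi> ?x))" by simp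
      also have "\<dots> \<le> norm (\<bar>fst q\<bar>, \<bar>snd q\<bar>) * norm (norm (dx1 \<phi> ?x), norm (dx2 \<phi> ?x))" by (rule norm_cauchy_schwarz)
      also have "norm (\<bar>fst q\<bar>, \<bar>snd q\<bar>) = norm (fst q, snd q)" by (simp only: norm_Pair real_norm_def abs_abs)
      also have "norm (norm (dx1 \<phi> ?x), norm (dx2 \<phi> ?x)) = norm (grad \<phi> ?x)" by (simp add: norm_Pair grad_def)
      finally show ?thesis using q by simp
    qed
    then have f'le: "a * (norm (f' t))\<^sup>2 + (1 / a + 1 / L) * (norm (f t))\<^sup>2 \<le> W (s *\<^sub>R p + t *\<^sub>R q)" for t
      unfolding W_def f_def using a by (intro add_right_mono mult_left_mono power_mono) auto
    have "ennreal ((norm (\<phi> (s *\<^sub>R p)))\<^sup>2) = ennreal ((norm (f 0))\<^sup>2)" by (simp add: f_def)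
    also have "\<dots> \<le> (\<integral>\<^sup>+t. ennreal (a * (norm (f' t))\<^sup>2 + (1 / a + 1 / L) * (norm (f t))\<^sup>2) * indicator {0<..<L} t \<partial>lborel)"
      by (rule half_line_trace_inequality[OF fd f'c a L])
    also have "\<dots> \<le> (\<integral>\<^sup>+t. ennreal (W (s *\<^sub>R p + t *\<^sub>R q)) * indicator S (s *\<^sub>R p + t *\<^sub>R q) \<partial>lborel)"
      using sub[OF True] f'le by (intro nn_integral_mono mult_mono ennreal_leI) (auto simp: indicator_def)
    also have "(\<lambda>t. s *\<^sub>R p + t *\<^sub>R q) = (\<lambda>t. (s * fst p + t * fst q, s * snd p + t * snd q))"
      by (auto simp: prod_eq_iff)
    finally show ?thesis using True by (simp add: prod_eq_iff scaleR_prod_def)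
  qed simp
  have "ennreal \<bar>fst p * snd q - snd p * fst q\<bar> * (\<integral>\<^sup>+s. ennreal ((norm (\<phi> (s *\<^sub>R p)))\<^sup>2) * indicator {s0<..} s \<partial>lborel) \<le>
    ennreal \<bar>fst p * snd q - snd p * fst q\<bar> * (\<integral>\<^sup>+s. \<integral>\<^sup>+t. ennreal (W (s * fst p + t * fst q, s * snd p + t * snd q)) * indicator S (s * fst p + t * fst q, s * snd p + t * snd q) \<partial>lborel \<partial>lborel)"
    by (intro mult_left_mono nn_integral_mono pw) simp
  also have "\<dots> = (\<integral>\<^sup>+x. ennreal (W x) * indicator S x \<partial>lborel)"
    using nn_integral_linear_plane[of "\<lambda>x. ennreal (W x) * indicator S x" "fst p" "snd q" "snd p" "fst q"] p D by simp
  finally show ?thesis unfolding W_def .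
qed

section \<open>The edges of the sector\<close>

text \<open>A bump on the box, divided by its integral.\<close>

lemma mollifier_in_box:
  assumes a: "a > 0"
  obtains r where "mollifier r" "\<And>x. x \<notin> cbox (- b / a, - c / a) ((1 - b) / a, (1 - c) / a) \<Longrightarrow> r x = 0"
proof -
  let ?b = "bump a b c"
  have bt: "(\<lambda>x. complex_of_real (?b x)) \<in> test_functions UNIV" using a by (intro bump_test_function) auto
  have bi: "integrable lborel ?b" using integrable_Re[OF test_functions_integrable[OF bt]] by simp
  then have [measurable]: "?b \<in> borel_measurable borel" by simp
  define I where "I = (\<integral>x. ?b x \<partial>lborel)"
  have "I \<noteq> 0"
  proof
    assume "I = 0"
    then have "AE x in lborel. ?b x = 0"
      unfolding I_def using integral_nonneg_eq_0_iff_AE[OF bi] by simp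
    define N where "N = {x. ?b x \<noteq> 0}"
    have [measurable]: "N \<in> sets borel" unfolding N_def by measurable
    have N0: "N \<in> null_sets lborel"
      using \<open>AE x in lborel. ?b x = 0\<close> by (subst AE_iff_null_sets) (auto simp: N_def)
    have sub: "box (- b / a, - c / a) ((1 - b) / a, (1 - c) / a) \<subseteq> N"
    proof
      fix x :: plane assume "x \<in> box (- b / a, - c / a) ((1 - b) / a, (1 - c) / a)"
      then have "fst x \<in> {- b / a<..<(1 - b) / a}" "snd x \<in> {- c / a<..<(1 - c) / a}"
        by (auto simp: box_def Basis_prod_def inner_prod_def)
      then have "bump a b c x > 0" using a by (intro bump_pos) (auto simp: field_simps)
      then show "x \<in> N" by (simp add: N_def)
    qed
    have "(box (- b / a, - c / a) ((1 - b) / a, (1 - c) / a) :: plane set) \<in> null_sets lborel"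
      by (rule null_sets_subset[OF N0 _ sub]) simp
    then have "emeasure lborel (box (- b / a, - c / a) ((1 - b) / a, (1 - c) / a) :: plane set) = 0"
      by (rule null_setsD1)
    moreover have "emeasure lborel (box (- b / a, - c / a) ((1 - b) / a, (1 - c) / a) :: plane set) = ennreal (1 / a * (1 / a))"
      using a by (subst emeasure_lborel_box) (auto simp: Basis_prod_def field_simps sum.union_disjoint prod.union_disjoint)
    ultimately show False using a by simp
  qed
  moreover have "I \<ge> 0" unfolding I_def by simp
  ultimately have Ipos: "I > 0" by simp
  show ?thesis
  proof (rule that[of "\<lambda>x. 1 / I * ?b x"])
    show "mollifier (\<lambda>x. 1 / I * ?b x)"
      unfolding mollifier_def
    proof (intro conjI allI)
      show "(\<lambda>x. complex_of_real (1 / I * ?b x)) \<in> test_functions UNIV"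
        using test_functions_mult[OF smooth_const[of "complex_of_real (1 / I)"] bt] by simp
      show "(\<integral>x. 1 / I * ?b x \<partial>lborel) = 1" using Ipos by (simp add: I_def[symmetric])
    qed (use Ipos in simp)
    fix x assume "x \<notin> cbox (- b / a, - c / a) ((1 - b) / a, (1 - c) / a)"
    then have "x \<notin> closure {x. complex_of_real (?b x) \<noteq> 0}" using bump_support[OF a, of b c] by auto
    then show "1 / I * ?b x = 0" using subsetD[OF closure_subset, of x "{x. complex_of_real (?b x) \<noteq> 0}"] by auto
  qed
qed

text \<open>Completeness of $L^2$ for sequences with a geometric rate. The rate makes \<open>\<Sum> 2\<^sup>n |f\<^sub>n\<^sub>+\<^sub>1 - f\<^sub>n|\<^sup>2\<close> integrable,
hence finite almost everywhere, which forces pointwise convergence; Fatou's lemma then gives convergence in norm.\<close>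

lemma L2_Cauchy_limit:
  fixes f :: "nat \<Rightarrow> 'a \<Rightarrow> complex"
  assumes f: "\<And>n. f n \<in> L2 M" and c: "c \<ge> 0"
    and cauchy: "\<And>n m. sq_norm M (\<lambda>x. f n x - f m x) \<le> c * ((1/4)^n + (1/4)^m)"
  obtains h where "h \<in> L2 M" "(\<lambda>n. sq_norm M (\<lambda>x. f n x - h x)) \<longlonglongrightarrow> 0"
proof -
  note [measurable] = L2_measurable[OF f]
  define h where "h x = lim (\<lambda>n. f n x)" for x
  have [measurable]: "h \<in> borel_measurable M" unfolding h_def by measurable
  have sqi: "integrable M (\<lambda>x. (norm (f n x - f m x))\<^sup>2)" for n m using L2_diff(1)[OF f f] by (rule L2_integrable_sq)
  have sqnn: "(\<integral>\<^sup>+x. (norm (f n x - f m x))\<^sup>2 \<partial>M) = ennreal (sq_norm M (\<lambda>x. f n x - f m x))" for n m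
    unfolding sq_norm_def by (rule nn_integral_eq_integral[OF sqi]) simp
  \<comment> \<open>Any factor between \<open>1\<close> and \<open>4\<close> would do in place of \<open>2\<close>: the sum still converges, and finiteness gives geometric decay.\<close>
  have fin: "(\<integral>\<^sup>+x. (\<Sum>n. ennreal (2 ^ n * (norm (f (Suc n) x - f n x))\<^sup>2)) \<partial>M) \<noteq> \<infinity>"
  proof -
    have "(\<integral>\<^sup>+x. (\<Sum>n. ennreal (2 ^ n * (norm (f (Suc n) x - f n x))\<^sup>2)) \<partial>M) = (\<Sum>n. \<integral>\<^sup>+x. ennreal (2 ^ n * (norm (f (Suc n) x - f n x))\<^sup>2) \<partial>M)"
      by (rule nn_integral_suminf) measurable
    also have "\<dots> \<le> (\<Sum>n. ennreal (2 * c * (1/2)^n))"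
    proof (rule suminf_le)
      fix n
      have "(\<integral>\<^sup>+x. ennreal (2 ^ n * (norm (f (Suc n) x - f n x))\<^sup>2) \<partial>M) = ennreal (2 ^ n) * (\<integral>\<^sup>+x. (norm (f (Suc n) x - f n x))\<^sup>2 \<partial>M)"
        by (subst nn_integral_cmult[symmetric]) (auto simp: ennreal_mult')
      also have "\<dots> = ennreal (2 ^ n * sq_norm M (\<lambda>x. f (Suc n) x - f n x))"
        unfolding sqnn by (rule ennreal_mult'[symmetric]) simp
      also have "\<dots> \<le> ennreal (2 * c * (1/2)^n)"
      proof (rule ennreal_leI)
        have "2 ^ n * sq_norm M (\<lambda>x. f (Suc n) x - f n x) \<le> 2 ^ n * (c * ((1/4)^Suc n + (1/4)^n))"
          by (intro mult_left_mono cauchy) simp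
        also have "\<dots> \<le> 2 ^ n * (c * (2 * (1/4)^n))"
          using c by (intro mult_left_mono) auto
        also have "\<dots> = 2 * c * (2 ^ n * (1/4)^n)" by simp
        also have "(2::real) ^ n * (1/4)^n = (1/2)^n" by (simp flip: power_mult_distrib)
        finally show "2 ^ n * sq_norm M (\<lambda>x. f (Suc n) x - f n x) \<le> 2 * c * (1/2)^n" .
      qed
      finally show "(\<integral>\<^sup>+x. ennreal (2 ^ n * (norm (f (Suc n) x - f n x))\<^sup>2) \<partial>M) \<le> ennreal (2 * c * (1/2)^n)" .
    qed auto
    also have "\<dots> = ennreal (\<Sum>n. 2 * c * (1/2)^n)"
      using c by (intro suminf_ennreal2 summable_mult summable_geometric) auto
    finally show ?thesis by (auto simp: top_unique)
  qed
  have "AE x in M. (\<Sum>n. ennreal (2 ^ n * (norm (f (Suc n) x - f n x))\<^sup>2)) \<noteq> \<infinity>"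
    by (rule nn_integral_PInf_AE[OF _ fin]) measurable
  then have conv: "AE x in M. (\<lambda>n. f n x) \<longlonglongrightarrow> h x"
  proof eventually_elim
    case (elim x)
    define d where "d n = f (Suc n) x - f n x" for n
    have "summable (\<lambda>n. 2 ^ n * (norm (d n))\<^sup>2)"
      using elim by (intro summable_suminf_not_top) (auto simp: d_def)
    then have "Bseq (\<lambda>n. 2 ^ n * (norm (d n))\<^sup>2)"
      using summable_LIMSEQ_zero convergentI convergent_imp_Bseq by blast
    then obtain K where K: "K > 0" "\<And>n. norm (2 ^ n * (norm (d n))\<^sup>2) \<le> K" unfolding Bseq_def by blast
    have dn: "norm (d n) \<le> sqrt K * (sqrt (1/2)) ^ n" for n
    proof (rule power2_le_imp_le)
      have "(norm (d n))\<^sup>2 \<le> K / 2 ^ n" using K(2)[of n] by (simp add: field_simps)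
      also have "\<dots> = (sqrt K * (sqrt (1/2)) ^ n)\<^sup>2"
      proof -
        have "((sqrt (1/2)) ^ n)\<^sup>2 = ((sqrt (1/2))\<^sup>2) ^ n" by (metis power_mult mult.commute)
        also have "\<dots> = (1/2) ^ n" by simp
        finally show ?thesis using K(1) by (simp add: power_mult_distrib power_one_over)
      qed
      finally show "(norm (d n))\<^sup>2 \<le> (sqrt K * (sqrt (1/2)) ^ n)\<^sup>2" .
    qed (use K in simp)
    have "summable d"
    proof (rule summable_comparison_test')
      have "sqrt (1/2) < 1" by (simp add: real_sqrt_lt_1_iff)
      then show "summable (\<lambda>n. sqrt K * (sqrt (1/2)) ^ n)" by (intro summable_mult summable_geometric) simp
      show "norm (d n) \<le> sqrt K * (sqrt (1/2)) ^ n" for n by (rule dn)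
    qed
    then have "convergent (\<lambda>n. \<Sum>k<n. d k)" using summable_LIMSEQ convergentI by blast
    moreover have "(\<Sum>k<n. d k) = f n x - f 0 x" for n
      unfolding d_def by (rule sum_lessThan_telescope)
    ultimately obtain l where "(\<lambda>n. f n x - f 0 x) \<longlonglongrightarrow> l" unfolding convergent_def by auto
    from tendsto_add[OF this tendsto_const[of "f 0 x"]] have "convergent (\<lambda>n. f n x)" by (auto simp: convergent_def)
    then show ?case unfolding h_def by (rule convergent_LIMSEQ_iff[THEN iffD1])
  qed
  have le: "(\<integral>\<^sup>+x. (norm (f n x - h x))\<^sup>2 \<partial>M) \<le> ennreal (2 * c * (1/4)^n)" for n
  proof -
    have "(\<integral>\<^sup>+x. (norm (f n x - h x))\<^sup>2 \<partial>M) = (\<integral>\<^sup>+x. liminf (\<lambda>m. ennreal ((norm (f n x - f m x))\<^sup>2)) \<partial>M)"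
    proof (rule nn_integral_cong_AE)
      show "AE x in M. ennreal ((norm (f n x - h x))\<^sup>2) = liminf (\<lambda>m. ennreal ((norm (f n x - f m x))\<^sup>2))"
        using conv
      proof eventually_elim
        case (elim x)
        have "(\<lambda>m. ennreal ((norm (f n x - f m x))\<^sup>2)) \<longlonglongrightarrow> ennreal ((norm (f n x - h x))\<^sup>2)"
          by (intro tendsto_ennrealI tendsto_intros elim)
        then show ?case by (intro lim_imp_Liminf[symmetric]) auto
      qed
    qed
    also have "\<dots> \<le> liminf (\<lambda>m. \<integral>\<^sup>+x. (norm (f n x - f m x))\<^sup>2 \<partial>M)"
      by (rule nn_integral_liminf) measurable
    also have "\<dots> \<le> ennreal (2 * c * (1/4)^n)"
    proof (rule Liminf_le)
      show "eventually (\<lambda>m. (\<integral>\<^sup>+x. (norm (f n x - f m x))\<^sup>2 \<partial>M) \<le> ennreal (2 * c * (1/4)^n)) sequentially"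
        using eventually_ge_at_top[of n]
      proof eventually_elim
        case (elim m)
        have "(1/4::real)^m \<le> (1/4)^n" using elim by (intro power_decreasing) auto
        then have "c * ((1/4)^n + (1/4)^m) \<le> c * ((1/4)^n + (1/4)^n)" using c by (intro mult_left_mono) auto
        then show ?case unfolding sqnn using cauchy[of n m] by (intro ennreal_leI) auto
      qed
    qed simp
    finally show ?thesis .
  qed
  have di: "integrable M (\<lambda>x. (norm (f n x - h x))\<^sup>2)" for n
  proof (rule integrableI_bounded)
    show "(\<integral>\<^sup>+x. ennreal (norm ((norm (f n x - h x))\<^sup>2)) \<partial>M) < \<infinity>" using le[of n] by (simp add: order_le_less_trans)
  qed measurable
  then have dL: "(\<lambda>x. f n x - h x) \<in> L2 M" for n by (simp add: L2_def)
  have "h \<in> L2 M" using L2_diff(1)[OF f[of 0] dL[of 0]] by simp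
  moreover have "(\<lambda>n. sq_norm M (\<lambda>x. f n x - h x)) \<longlonglongrightarrow> 0"
  proof (rule real_tendsto_sandwich[where f="\<lambda>n. 0" and h="\<lambda>n. 2 * c * (1/4)^n"])
    have "sq_norm M (\<lambda>x. f n x - h x) \<le> 2 * c * (1/4)^n" for n
      using le[of n] nn_integral_eq_integral[OF di[of n]] c by (simp add: sq_norm_def)
    then show "eventually (\<lambda>n. sq_norm M (\<lambda>x. f n x - h x) \<le> 2 * c * (1/4)^n) sequentially" by simp
    have "(\<lambda>n. 2 * c * (1/4)^n) \<longlonglongrightarrow> 2 * c * 0" by (intro tendsto_intros LIMSEQ_power_zero) auto
    then show "(\<lambda>n. 2 * c * (1/4)^n) \<longlonglongrightarrow> 0" by simp
  qed auto
  ultimately show ?thesis by (rule that)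
qed

locale acute_sector =
  fixes \<alpha> :: real
  assumes \<alpha>_pos: "0 < \<alpha>" and \<alpha>_less: "\<alpha> < pi / 2"
begin

definition U :: "plane set" where "U = sector \<alpha>"

lemma trig_pos: "sin \<alpha> > 0" "cos \<alpha> > 0" "tan \<alpha> > 0"
  using \<alpha>_pos \<alpha>_less by (auto intro: sin_gt_zero cos_gt_zero tan_gt_zero)

lemma sin_eq: "sin \<alpha> = cos \<alpha> * tan \<alpha>"
  using trig_pos by (simp add: tan_def)

text \<open>The description by linear inequalities, which makes openness and the cone property evident.\<close>

lemma U_eq: "U = {x. fst x > 0 \<and> \<bar>snd x\<bar> < fst x * tan \<alpha>}"
proof -
  have "(x1, x2) \<in> U \<longleftrightarrow> x1 > 0 \<and> \<bar>x2\<bar> < x1 * tan \<alpha>" for x1 x2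
  proof (cases "x1 > 0")
    case True
    let ?z = "Complex x1 x2"
    let ?\<theta> = "Arg ?z"
    have z0: "?z \<noteq> 0" using True by (simp add: complex_eq_iff)
    have \<theta>: "\<bar>?\<theta>\<bar> < pi / 2" using Arg_Re_pos[of ?z] True by simp
    have z: "rcis (norm ?z) ?\<theta> = ?z" by (rule rcis_cmod_Arg)
    have x: "x1 = norm ?z * cos ?\<theta>" "x2 = norm ?z * sin ?\<theta>"
      using arg_cong[OF z, of Re] arg_cong[OF z, of Im] by simp_all
    have c: "cos ?\<theta> > 0" using \<theta> by (intro cos_gt_zero_pi) auto
    have x2: "x2 = x1 * tan ?\<theta>" using c by (subst x(2), subst x(1)) (simp add: tan_def)
    have "\<bar>x2\<bar> = x1 * \<bar>tan ?\<theta>\<bar>" using arg_cong[OF x2, of abs] True by (simp add: abs_mult)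
    also have "\<bar>tan ?\<theta>\<bar> = tan \<bar>?\<theta>\<bar>"
    proof (cases "?\<theta> \<ge> 0")
      case True
      then show ?thesis using \<theta> by (cases "?\<theta> = 0") (auto intro!: abs_of_pos tan_gt_zero)
    next
      case False
      then have "tan (- ?\<theta>) > 0" using \<theta> by (intro tan_gt_zero) auto
      then show ?thesis using False by simp
    qed
    finally have "\<bar>x2\<bar> < x1 * tan \<alpha> \<longleftrightarrow> tan \<bar>?\<theta>\<bar> < tan \<alpha>" using True by simp
    also have "\<dots> \<longleftrightarrow> \<bar>?\<theta>\<bar> < \<alpha>"
      using \<theta> \<alpha>_pos \<alpha>_less by (intro tan_monotone'[symmetric]) auto
    finally show ?thesis using True by (simp add: U_def sector_def)
  next
    case False
    have "(x1, x2) \<notin> U"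
    proof
      assume "(x1, x2) \<in> U"
      then have "(x1, x2) \<noteq> (0, 0)" "\<bar>Arg (Complex x1 x2)\<bar> < pi / 2" using \<alpha>_less by (auto simp: U_def sector_def)
      then show False using False Arg_Re_pos[of "Complex x1 x2"] by (auto simp: complex_eq_iff)
    qed
    then show ?thesis using False by simp
  qed
  then show ?thesis by (auto simp: set_eq_iff)
qed

lemma open_U: "open U"
  unfolding U_eq by (intro open_Collect_conj open_Collect_less continuous_intros)

sublocale cone_domain U
proof
  show "open U" by (rule open_U)
  show "x + y \<in> U" if "x \<in> U" "y \<in> U" for x y
    using that abs_triangle_ineq[of "snd x" "snd y"] by (simp add: U_eq distrib_right)
  show "\<exists>r C. mollifier r \<and> compact C \<and> C \<subseteq> U \<inter> ball 0 d \<and> (\<forall>x. x \<notin> C \<longrightarrow> r x = 0)" if d: "d > 0" for d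
  proof -
    obtain m :: nat where m: "1 / tan \<alpha> < m" using reals_Archimedean2 by blast
    \<comment> \<open>The unit square with lower left corner \<open>(m, 0)\<close> lies in the sector; scaling it down brings it near the origin.\<close>
    then have mt: "1 < m * tan \<alpha>" using trig_pos by (simp add: field_simps)
    have m0: "real m > 0" using m trig_pos by (meson less_trans zero_less_divide_1_iff)
    define a where "a = (m + 3) / d"
    have a: "a > 0" using d by (simp add: a_def)
    let ?C = "cbox (- (- real m) / a, - 0 / a) ((1 - (- real m)) / a, (1 - 0) / a) :: plane set"
    obtain r where r: "mollifier r" "\<And>x. x \<notin> ?C \<Longrightarrow> r x = 0" using mollifier_in_box[OF a, of "- real m" 0] by blast
    have "?C \<subseteq> U \<inter> ball 0 d"
    proof
      fix x assume "x \<in> ?C"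
      then have x: "m / a \<le> fst x" "fst x \<le> (1 + m) / a" "0 \<le> snd x" "snd x \<le> 1 / a"
        by (auto simp: cbox_def Basis_prod_def inner_prod_def)
      have f0: "fst x > 0" using x(1) m0 a by (smt (verit) divide_pos_pos)
      have "snd x \<le> 1 / a" by fact
      also have "\<dots> < m * tan \<alpha> / a" using mt a by (simp add: divide_strict_right_mono)
      also have "\<dots> = m / a * tan \<alpha>" by simp
      also have "\<dots> \<le> fst x * tan \<alpha>" using x(1) trig_pos by (intro mult_right_mono) auto
      finally have xU: "x \<in> U" using f0 x(3) by (simp add: U_eq)
      have "norm x \<le> \<bar>fst x\<bar> + \<bar>snd x\<bar>" using norm_Pair_le[of "fst x" "snd x"] by simp
      also have "\<dots> \<le> (1 + m) / a + 1 / a" using x f0 by auto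
      also have "\<dots> = (m + 2) / a" using a by (simp add: field_simps)
      also have "\<dots> < d" using a d by (simp add: a_def field_simps)
      finally show "x \<in> U \<inter> ball 0 d" using xU by simp
    qed
    then show ?thesis using r by (intro exI[of _ r] exI[of _ ?C]) auto
  qed
qed

definition M :: "plane measure" where "M = boundary_measure U"

text \<open>The unit vector along the upper edge for \<open>\<sigma> = 1\<close> and along the lower edge for \<open>\<sigma> = -1\<close>.\<close>

definition edge :: "real \<Rightarrow> plane" where "edge \<sigma> = (cos \<alpha>, \<sigma> * sin \<alpha>)"

lemma norm_edge: "\<bar>\<sigma>\<bar> = 1 \<Longrightarrow> norm (edge \<sigma>) = 1"
  using power2_abs[of \<sigma>] by (simp add: edge_def norm_Pair power_mult_distrib)

lemma frontier_subset: "frontier U \<subseteq> (\<lambda>s. s *\<^sub>R edge 1) ` {0..} \<union> (\<lambda>s. s *\<^sub>R edge (-1)) ` {0..}"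
proof
  fix x assume x: "x \<in> frontier U"
  have "closed {x::plane. fst x \<ge> 0 \<and> \<bar>snd x\<bar> \<le> fst x * tan \<alpha>}"
    by (intro closed_Collect_conj closed_Collect_le continuous_intros)
  moreover have "U \<subseteq> {x. fst x \<ge> 0 \<and> \<bar>snd x\<bar> \<le> fst x * tan \<alpha>}" by (auto simp: U_eq)
  ultimately have "closure U \<subseteq> {x. fst x \<ge> 0 \<and> \<bar>snd x\<bar> \<le> fst x * tan \<alpha>}" by (rule closure_minimal[rotated])
  moreover have "x \<in> closure U" "x \<notin> U" using x open_U by (auto simp: frontier_def interior_open)
  ultimately have c: "fst x \<ge> 0" "\<bar>snd x\<bar> \<le> fst x * tan \<alpha>" "\<not> (fst x > 0 \<and> \<bar>snd x\<bar> < fst x * tan \<alpha>)"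
    by (auto simp: U_eq)
  then have e: "\<bar>snd x\<bar> = fst x * tan \<alpha>" by (cases "fst x = 0") auto
  define s where "s = fst x / cos \<alpha>"
  have s: "s \<ge> 0" "fst x = s * cos \<alpha>" using c trig_pos by (auto simp: s_def)
  have "s * sin \<alpha> = fst x * tan \<alpha>" using s(2) by (simp add: sin_eq)
  then have "snd x = s * sin \<alpha> \<or> snd x = - (s * sin \<alpha>)" using e by auto
  then have "x = s *\<^sub>R edge 1 \<or> x = s *\<^sub>R edge (-1)" using s(2) by (auto simp: edge_def prod_eq_iff)
  then show "x \<in> (\<lambda>s. s *\<^sub>R edge 1) ` {0..} \<union> (\<lambda>s. s *\<^sub>R edge (-1)) ` {0..}" using s(1) by auto
qed

lemma M_borel: "f \<in> borel_measurable borel \<Longrightarrow> f \<in> borel_measurable M"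
  unfolding M_def boundary_measure_def by (intro measurable_restrict_space1) (simp cong: measurable_cong_sets)

lemma nn_integral_M_le:
  fixes g :: "plane \<Rightarrow> ennreal"
  assumes g[measurable]: "g \<in> borel_measurable borel"
  shows "(\<integral>\<^sup>+x. g x \<partial>M) \<le> (\<integral>\<^sup>+s. g (s *\<^sub>R edge 1) * indicator {0<..} s \<partial>lborel) + (\<integral>\<^sup>+s. g (s *\<^sub>R edge (-1)) * indicator {0<..} s \<partial>lborel)"
proof -
  have open_ray: "(\<integral>\<^sup>+s. g (s *\<^sub>R edge \<sigma>) * indicator {0..} s \<partial>lborel) = (\<integral>\<^sup>+s. g (s *\<^sub>R edge \<sigma>) * indicator {0<..} s \<partial>lborel)" for \<sigma>
  proof (rule nn_integral_cong_AE)
    show "AE s in lborel. g (s *\<^sub>R edge \<sigma>) * indicator {0..} s = g (s *\<^sub>R edge \<sigma>) * indicator {0<..} s"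
      using AE_lborel_singleton[of 0] by eventually_elim (auto simp: indicator_def)
  qed
  have fr: "frontier U \<in> sets borel" by simp
  have "closed ((\<lambda>s. s *\<^sub>R p) ` {0..})" if "norm p = 1" for p :: plane
  proof -
    have "p \<bullet> p = 1" using that by (simp add: dot_square_norm)
    then have "(\<lambda>s. s *\<^sub>R p) ` {0..} = {x. x = (x \<bullet> p) *\<^sub>R p \<and> 0 \<le> x \<bullet> p}" by (auto simp: image_iff)
    moreover have "closed {x. x = (x \<bullet> p) *\<^sub>R p \<and> 0 \<le> x \<bullet> p}"
      by (intro closed_Collect_conj closed_Collect_eq closed_Collect_le continuous_intros)
    ultimately show ?thesis by simp
  qed
  then have cl: "closed ((\<lambda>s. s *\<^sub>R edge 1) ` {0..})" "closed ((\<lambda>s. s *\<^sub>R edge (-1)) ` {0..})"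
    using norm_edge by simp_all
  have "(\<integral>\<^sup>+x. g x \<partial>M) = (\<integral>\<^sup>+x. g x * indicator (frontier U) x \<partial>hausdorff1)"
    unfolding M_def boundary_measure_def by (rule nn_integral_restrict_space) (use fr in simp)
  also have "\<dots> \<le> (\<integral>\<^sup>+x. g x * indicator ((\<lambda>s. s *\<^sub>R edge 1) ` {0..}) x + g x * indicator ((\<lambda>s. s *\<^sub>R edge (-1)) ` {0..}) x \<partial>hausdorff1)"
  proof (rule nn_integral_mono)
    fix x
    show "g x * indicator (frontier U) x \<le> g x * indicator ((\<lambda>s. s *\<^sub>R edge 1) ` {0..}) x + g x * indicator ((\<lambda>s. s *\<^sub>R edge (-1)) ` {0..}) x"
    proof (cases "x \<in> frontier U")
      case True
      then have "x \<in> (\<lambda>s. s *\<^sub>R edge 1) ` {0..} \<or> x \<in> (\<lambda>s. s *\<^sub>R edge (-1)) ` {0..}" using frontier_subset by auto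
      then show ?thesis by (elim disjE) (simp_all add: True)
    qed simp
  qed
  also have "\<dots> = (\<integral>\<^sup>+x. g x * indicator ((\<lambda>s. s *\<^sub>R edge 1) ` {0..}) x \<partial>hausdorff1) + (\<integral>\<^sup>+x. g x * indicator ((\<lambda>s. s *\<^sub>R edge (-1)) ` {0..}) x \<partial>hausdorff1)"
    using cl g by (intro nn_integral_add borel_measurable_times_ennreal borel_measurable_indicator) (auto cong: measurable_cong_sets)
  also have "\<dots> \<le> (\<integral>\<^sup>+s. g (s *\<^sub>R edge 1) * indicator {0..} s \<partial>lborel) + (\<integral>\<^sup>+s. g (s *\<^sub>R edge (-1)) * indicator {0..} s \<partial>lborel)"
    by (intro add_mono nn_integral_ray_le norm_edge g) auto
  also have "\<dots> = (\<integral>\<^sup>+s. g (s *\<^sub>R edge 1) * indicator {0<..} s \<partial>lborel) + (\<integral>\<^sup>+s. g (s *\<^sub>R edge (-1)) * indicator {0<..} s \<partial>lborel)"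
    by (simp only: open_ray)
  finally show ?thesis .
qed

text \<open>Sums the slice estimate over the two edges. The segments that start at the upper edge lie in the upper half of
the sector and those from the lower edge in the lower half, so the gradient is counted once. This matters: with a factor \<open>2\<close>
in front of the gradient the constant in \<open>trace_inequality_far\<close> would be lost.\<close>

lemma boundary_estimate:
  assumes \<phi>: "\<phi> \<in> test_functions UNIV" and a: "a > 0" and L0: "depth > 0" and d: "jac > 0"
    and q: "\<And>\<sigma>. \<bar>\<sigma>\<bar> = 1 \<Longrightarrow> norm (q \<sigma>) = 1" "\<And>\<sigma>. \<bar>\<sigma>\<bar> = 1 \<Longrightarrow> \<bar>fst (edge \<sigma>) * snd (q \<sigma>) - snd (edge \<sigma>) * fst (q \<sigma>)\<bar> = jac"
    and sub: "\<And>\<sigma> s t. \<bar>\<sigma>\<bar> = 1 \<Longrightarrow> s > start \<Longrightarrow> 0 < t \<Longrightarrow> t < depth \<Longrightarrow> s *\<^sub>R edge \<sigma> + t *\<^sub>R q \<sigma> \<in> U \<and> \<sigma> * snd (s *\<^sub>R edge \<sigma> + t *\<^sub>R q \<sigma>) > 0"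
    and z: "\<And>\<sigma> s. \<bar>\<sigma>\<bar> = 1 \<Longrightarrow> 0 < s \<Longrightarrow> s \<le> start \<Longrightarrow> \<phi> (s *\<^sub>R edge \<sigma>) = 0"
  shows "\<phi> \<in> L2 M" "jac * sq_norm M \<phi> \<le> a * sq_norm L (grad \<phi>) + (1 / a + 1 / depth) * sq_norm L \<phi>"
proof -
  note sm = test_functions_smooth[OF \<phi>]
  note [measurable] = smooth_measurable[OF sm]
  define W where "W x = a * (norm (grad \<phi> x))\<^sup>2 + (1 / a + 1 / depth) * (norm (\<phi> x))\<^sup>2" for x
  have "continuous_on UNIV W" unfolding W_def grad_def
    using smooth_continuous[OF sm] smooth_continuous[OF smooth_dx(1)[OF sm]] smooth_continuous[OF smooth_dx(2)[OF sm]] by (intro continuous_intros) auto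
  then have [measurable]: "W \<in> borel_measurable borel" by (rule borel_measurable_continuous_onI)
  have Wnn: "W x \<ge> 0" for x unfolding W_def using a L0 by simp
  define S where "S \<sigma> = {x \<in> U. \<sigma> * snd x > 0}" for \<sigma>
  have Sm [measurable]: "S \<sigma> \<in> sets borel" for \<sigma>
  proof -
    have "open (S \<sigma>)" unfolding S_def Collect_conj_eq Collect_mem_eq
      by (intro open_Int open_U open_Collect_less continuous_intros)
    then show ?thesis by simp
  qed
  let ?B = "\<lambda>\<sigma>. \<integral>\<^sup>+s. ennreal ((norm (\<phi> (s *\<^sub>R edge \<sigma>)))\<^sup>2) * indicator {0<..} s \<partial>lborel"
  have one: "ennreal jac * ?B \<sigma> \<le> (\<integral>\<^sup>+x. ennreal (W x) * indicator (S \<sigma>) x \<partial>lborel)" if \<sigma>: "\<bar>\<sigma>\<bar> = 1" for \<sigma>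
  proof -
    have "?B \<sigma> \<le> (\<integral>\<^sup>+s. ennreal ((norm (\<phi> (s *\<^sub>R edge \<sigma>)))\<^sup>2) * indicator {start<..} s \<partial>lborel)"
    proof (rule nn_integral_mono)
      fix s
      show "ennreal ((norm (\<phi> (s *\<^sub>R edge \<sigma>)))\<^sup>2) * indicator {0<..} s \<le> ennreal ((norm (\<phi> (s *\<^sub>R edge \<sigma>)))\<^sup>2) * indicator {start<..} s"
        using z[OF \<sigma>, of s] by (cases "s > start") (auto simp: indicator_def)
    qed
    then have "ennreal jac * ?B \<sigma> \<le> ennreal \<bar>fst (edge \<sigma>) * snd (q \<sigma>) - snd (edge \<sigma>) * fst (q \<sigma>)\<bar> * (\<integral>\<^sup>+s. ennreal ((norm (\<phi> (s *\<^sub>R edge \<sigma>)))\<^sup>2) * indicator {start<..} s \<partial>lborel)"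
      unfolding q(2)[OF \<sigma>] by (rule mult_left_mono) simp
    also have "\<dots> \<le> (\<integral>\<^sup>+x. ennreal (W x) * indicator (S \<sigma>) x \<partial>lborel)"
      unfolding W_def
    proof (rule slice_estimate[OF \<phi> q(1)[OF \<sigma>] _ _ a L0 Sm])
      show "fst (edge \<sigma>) \<noteq> 0" using trig_pos by (simp add: edge_def)
      show "fst (edge \<sigma>) * snd (q \<sigma>) - snd (edge \<sigma>) * fst (q \<sigma>) \<noteq> 0" using q(2)[OF \<sigma>] d by auto
      show "s *\<^sub>R edge \<sigma> + t *\<^sub>R q \<sigma> \<in> S \<sigma>" if "s > start" "0 < t" "t < depth" for s t
        using sub[OF \<sigma> that] by (simp add: S_def)
    qed
    finally show ?thesis .
  qed
  have "ennreal jac * (\<integral>\<^sup>+x. ennreal ((norm (\<phi> x))\<^sup>2) \<partial>M) \<le> ennreal jac * (?B 1 + ?B (-1))"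
    by (intro mult_left_mono nn_integral_M_le) auto
  also have "\<dots> = ennreal jac * ?B 1 + ennreal jac * ?B (-1)" by (rule distrib_left)
  also have "\<dots> \<le> (\<integral>\<^sup>+x. ennreal (W x) * indicator (S 1) x \<partial>lborel) + (\<integral>\<^sup>+x. ennreal (W x) * indicator (S (-1)) x \<partial>lborel)"
    by (intro add_mono one) auto
  also have "\<dots> = (\<integral>\<^sup>+x. ennreal (W x) * indicator (S 1) x + ennreal (W x) * indicator (S (-1)) x \<partial>lborel)"
    by (rule nn_integral_add[symmetric]) measurable
  also have "\<dots> \<le> (\<integral>\<^sup>+x. ennreal (W x) * indicator U x \<partial>lborel)"
    by (intro nn_integral_mono) (auto simp: S_def indicator_def)
  also have "\<dots> = (\<integral>\<^sup>+x. ennreal (W x) \<partial>L)" by (rule L_nn_integral[symmetric])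
  also have "\<dots> = ennreal (\<integral>x. W x \<partial>L)"
  proof (rule nn_integral_eq_integral)
    show "integrable L W" unfolding W_def
      using L2_integrable_sq[OF test_functions_L2[OF \<phi>]] L2_integrable_sq[OF grad_test_functions_L2[OF \<phi>]] by simp
  qed (use Wnn in simp)
  also have "(\<integral>x. W x \<partial>L) = a * sq_norm L (grad \<phi>) + (1 / a + 1 / depth) * sq_norm L \<phi>"
    unfolding W_def sq_norm_def
    using L2_integrable_sq[OF test_functions_L2[OF \<phi>]] L2_integrable_sq[OF grad_test_functions_L2[OF \<phi>]] by simp
  finally have le: "ennreal jac * (\<integral>\<^sup>+x. ennreal ((norm (\<phi> x))\<^sup>2) \<partial>M) \<le> ennreal (a * sq_norm L (grad \<phi>) + (1 / a + 1 / depth) * sq_norm L \<phi>)" .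
  have mM: "\<phi> \<in> borel_measurable M" by (rule M_borel) measurable
  have i: "integrable M (\<lambda>x. (norm (\<phi> x))\<^sup>2)"
  proof (rule integrableI_bounded)
    have "ennreal jac * (\<integral>\<^sup>+x. ennreal ((norm (\<phi> x))\<^sup>2) \<partial>M) < top" using le by (simp add: order_le_less_trans)
    then show "(\<integral>\<^sup>+x. ennreal (norm ((norm (\<phi> x))\<^sup>2)) \<partial>M) < \<infinity>" using d by (auto simp: ennreal_mult_less_top)
  qed (use mM in measurable)
  then show "\<phi> \<in> L2 M" using mM by (simp add: L2_def)
  have "(\<integral>\<^sup>+x. ennreal ((norm (\<phi> x))\<^sup>2) \<partial>M) = ennreal (sq_norm M \<phi>)"
    unfolding sq_norm_def using nn_integral_eq_integral[OF i] by simp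
  then have "ennreal (jac * sq_norm M \<phi>) \<le> ennreal (a * sq_norm L (grad \<phi>) + (1 / a + 1 / depth) * sq_norm L \<phi>)"
    using le d by (simp add: ennreal_mult')
  then show "jac * sq_norm M \<phi> \<le> a * sq_norm L (grad \<phi>) + (1 / a + 1 / depth) * sq_norm L \<phi>"
    using a L0 by (subst (asm) ennreal_le_iff) auto
qed

definition trace_const :: real where "trace_const = (2 / sin \<alpha> + 1) / sin \<alpha>"

lemma trace_const_nonneg: "trace_const \<ge> 0"
  using trig_pos by (simp add: trace_const_def)

text \<open>Segments of length \<open>1\<close> parallel to the axis stay in the sector from every point of the edges, including points near
the corner. The parameter \<open>a = sin \<alpha> / 2\<close> gives the gradient the coefficient \<open>1/2\<close>, so that it can be absorbed later.\<close>

lemma trace_inequality_test: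
  assumes \<phi>: "\<phi> \<in> test_functions UNIV"
  shows "\<phi> \<in> L2 M" "sq_norm M \<phi> \<le> 1 / 2 * sq_norm L (grad \<phi>) + trace_const * sq_norm L \<phi>"
proof -
  have a: "sin \<alpha> / 2 > 0" using trig_pos by simp
  have sub: "s *\<^sub>R edge \<sigma> + t *\<^sub>R (1, 0) \<in> U \<and> \<sigma> * snd (s *\<^sub>R edge \<sigma> + t *\<^sub>R (1, 0)) > 0"
    if \<sigma>: "\<bar>\<sigma>\<bar> = 1" and s: "s > 0" and t: "0 < t" for \<sigma> s t :: real
  proof -
    have "\<sigma> * \<sigma> = 1" using \<sigma> abs_mult_self_eq[of \<sigma>] by simp
    moreover have "\<sigma> * (s * (\<sigma> * sin \<alpha>)) = (\<sigma> * \<sigma>) * (s * sin \<alpha>)" by (simp only: mult_ac)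
    ultimately have "\<sigma> * (s * (\<sigma> * sin \<alpha>)) = s * sin \<alpha>" by (simp only: mult_1)
    then have "\<sigma> * (s * (\<sigma> * sin \<alpha>)) > 0" using s trig_pos by (simp only: mult_pos_pos)
    moreover have "\<bar>s * (\<sigma> * sin \<alpha>)\<bar> = s * (cos \<alpha> * tan \<alpha>)"
      using \<sigma> s trig_pos by (simp add: abs_mult sin_eq[symmetric])
    moreover have "s * (cos \<alpha> * tan \<alpha>) < (s * cos \<alpha> + t) * tan \<alpha>" using t trig_pos by (simp add: algebra_simps)
    moreover have "s * cos \<alpha> + t > 0" using s t trig_pos by (simp add: add_pos_pos)
    ultimately show ?thesis by (simp add: U_eq edge_def)
  qed
  have q2: "\<bar>fst (edge \<sigma>) * snd ((1, 0)::plane) - snd (edge \<sigma>) * fst ((1, 0)::plane)\<bar> = sin \<alpha>" if "\<bar>\<sigma>\<bar> = 1" for \<sigma>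
    using that trig_pos by (simp add: edge_def abs_mult)
  note b = boundary_estimate[OF \<phi> a zero_less_one trig_pos(1), where q="\<lambda>_. (1, 0)" and start=0]
  show "\<phi> \<in> L2 M" by (rule b(1)) (use sub q2 in \<open>auto simp: norm_Pair\<close>)
  have "sin \<alpha> * sq_norm M \<phi> \<le> sin \<alpha> / 2 * sq_norm L (grad \<phi>) + (1 / (sin \<alpha> / 2) + 1 / 1) * sq_norm L \<phi>"
    by (rule b(2)) (use sub q2 in \<open>auto simp: norm_Pair\<close>)
  also have "\<dots> = sin \<alpha> * (1 / 2 * sq_norm L (grad \<phi>) + trace_const * sq_norm L \<phi>)"
    using trig_pos by (simp add: trace_const_def field_simps)
  finally show "sq_norm M \<phi> \<le> 1 / 2 * sq_norm L (grad \<phi>) + trace_const * sq_norm L \<phi>"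
    using trig_pos by simp
qed

text \<open>Normal segments of length \<open>R tan \<alpha>\<close> that start at distance more than \<open>R\<close> from the corner do not reach the axis.
With \<open>a = 1\<close> the gradient has the coefficient \<open>1\<close>, exactly that of the form.\<close>

lemma trace_inequality_far:
  assumes \<phi>: "\<phi> \<in> test_functions UNIV" and R: "R > 0" and z: "\<And>x. fst x \<le> R \<Longrightarrow> \<phi> x = 0"
  shows "sq_norm M \<phi> \<le> sq_norm L (grad \<phi>) + (1 + 1 / (R * tan \<alpha>)) * sq_norm L \<phi>"
proof -
  define q where "q \<sigma> = (sin \<alpha>, - (\<sigma> * cos \<alpha>))" for \<sigma> :: real
  have depth: "R * tan \<alpha> > 0" using R trig_pos by simp
  have sub: "s *\<^sub>R edge \<sigma> + t *\<^sub>R q \<sigma> \<in> U \<and> \<sigma> * snd (s *\<^sub>R edge \<sigma> + t *\<^sub>R q \<sigma>) > 0"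
    if \<sigma>: "\<bar>\<sigma>\<bar> = 1" and s: "s > R" and t: "0 < t" "t < R * tan \<alpha>" for \<sigma> s t :: real
  proof -
    have "t * cos \<alpha> < R * tan \<alpha> * cos \<alpha>" using t(2) trig_pos by (intro mult_strict_right_mono)
    also have "\<dots> = R * sin \<alpha>" by (simp add: sin_eq)
    also have "\<dots> < s * sin \<alpha>" using s trig_pos by simp
    finally have p: "s * sin \<alpha> - t * cos \<alpha> > 0" by simp
    have e: "s * (\<sigma> * sin \<alpha>) + t * - (\<sigma> * cos \<alpha>) = \<sigma> * (s * sin \<alpha> - t * cos \<alpha>)" by (simp add: algebra_simps)
    have ss: "\<sigma> * \<sigma> = 1" using \<sigma> abs_mult_self_eq[of \<sigma>] by simp
    have 1: "\<sigma> * (\<sigma> * (s * sin \<alpha> - t * cos \<alpha>)) > 0"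
      unfolding mult.assoc[symmetric] ss using p by (simp only: mult_1 mult.assoc)
    have 2: "\<bar>\<sigma> * (s * sin \<alpha> - t * cos \<alpha>)\<bar> = s * sin \<alpha> - t * cos \<alpha>" using \<sigma> p by (simp add: abs_mult)
    have "s * sin \<alpha> - t * cos \<alpha> < s * sin \<alpha> + t * (sin \<alpha> * tan \<alpha>)"
      using t(1) trig_pos by (smt (verit) mult_pos_pos)
    also have "\<dots> = (s * cos \<alpha> + t * sin \<alpha>) * tan \<alpha>" by (simp add: sin_eq algebra_simps)
    finally have 3: "s * sin \<alpha> - t * cos \<alpha> < (s * cos \<alpha> + t * sin \<alpha>) * tan \<alpha>" .
    have 4: "s * cos \<alpha> + t * sin \<alpha> > 0" using s R t trig_pos by (simp add: add_pos_pos)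
    show ?thesis using 1 2 3 4 unfolding U_eq edge_def q_def scaleR_Pair add_Pair real_scaleR_def mem_Collect_eq fst_conv snd_conv e by simp
  qed
  have "1 * sq_norm M \<phi> \<le> 1 * sq_norm L (grad \<phi>) + (1 / 1 + 1 / (R * tan \<alpha>)) * sq_norm L \<phi>"
  proof (rule boundary_estimate(2)[OF \<phi> zero_less_one depth zero_less_one, where q=q and start=R])
    fix \<sigma> :: real assume \<sigma>: "\<bar>\<sigma>\<bar> = 1"
    then have \<sigma>2: "\<sigma>\<^sup>2 = 1" using power2_abs[of \<sigma>] by simp
    show "norm (q \<sigma>) = 1" using \<sigma>2 by (simp add: q_def norm_Pair power_mult_distrib)
    have "fst (edge \<sigma>) * snd (q \<sigma>) - snd (edge \<sigma>) * fst (q \<sigma>) = - (\<sigma> * (cos \<alpha> * cos \<alpha> + sin \<alpha> * sin \<alpha>))"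
      by (simp only: edge_def q_def fst_conv snd_conv) algebra
    also have "\<dots> = - \<sigma>" using sin_cos_squared_add3[of \<alpha>] by simp
    finally show "\<bar>fst (edge \<sigma>) * snd (q \<sigma>) - snd (edge \<sigma>) * fst (q \<sigma>)\<bar> = 1" using \<sigma> by simp
    show "\<phi> (s *\<^sub>R edge \<sigma>) = 0" if "0 < s" "s \<le> R" for s
    proof (rule z)
      have "s * cos \<alpha> \<le> s * 1" using that by (intro mult_left_mono) auto
      moreover have "fst (s *\<^sub>R edge \<sigma>) = s * cos \<alpha>" by (simp add: edge_def)
      ultimately show "fst (s *\<^sub>R edge \<sigma>) \<le> R" using that by linarith
    qed
  qed (use sub in auto)
  then show ?thesis by simp
qed

end

section \<open>Traces of Sobolev functions\<close>

text \<open>Closed under products; multiplication by such a function preserves $H^1(U)$ and obeys the product rule.\<close>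

definition smooth_multiplier :: "(plane \<Rightarrow> complex) \<Rightarrow> bool" where
  "smooth_multiplier \<psi> \<longleftrightarrow> smooth \<psi> \<and> (\<exists>B. \<forall>x. norm (\<psi> x) \<le> B \<and> norm (dx1 \<psi> x) \<le> B \<and> norm (dx2 \<psi> x) \<le> B)"

text \<open>The gradient of \<open>\<psi> u\<close> by the product rule, when \<open>g\<close> is the gradient of \<open>u\<close>.\<close>

definition product_gradient :: "(plane \<Rightarrow> complex) \<Rightarrow> (plane \<Rightarrow> complex) \<Rightarrow> (plane \<Rightarrow> complex \<times> complex) \<Rightarrow> plane \<Rightarrow> complex \<times> complex" where
  "product_gradient \<psi> u g x = (\<psi> x * fst (g x) + dx1 \<psi> x * u x, \<psi> x * snd (g x) + dx2 \<psi> x * u x)"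

lemma smooth_multiplier_smooth: "smooth_multiplier \<psi> \<Longrightarrow> smooth \<psi>"
  by (simp add: smooth_multiplier_def)

lemma smooth_multiplierE:
  assumes "smooth_multiplier \<psi>"
  obtains B where "B \<ge> 0" "\<And>x. norm (\<psi> x) \<le> B" "\<And>x. norm (dx1 \<psi> x) \<le> B" "\<And>x. norm (dx2 \<psi> x) \<le> B"
proof -
  obtain B where B: "\<And>x. norm (\<psi> x) \<le> B \<and> norm (dx1 \<psi> x) \<le> B \<and> norm (dx2 \<psi> x) \<le> B" using assms by (auto simp: smooth_multiplier_def)
  have "B \<ge> 0" using B[of 0] norm_ge_zero[of "\<psi> 0"] by linarith
  then show ?thesis using B by (intro that[of B]) auto
qed

lemma smooth_multiplier_mult:
  assumes \<phi>: "smooth_multiplier \<phi>" and \<psi>: "smooth_multiplier \<psi>"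
  shows "smooth_multiplier (\<lambda>x. \<phi> x * \<psi> x)"
proof -
  obtain B where B: "B \<ge> 0" "\<And>x. norm (\<phi> x) \<le> B" "\<And>x. norm (dx1 \<phi> x) \<le> B" "\<And>x. norm (dx2 \<phi> x) \<le> B" using smooth_multiplierE[OF \<phi>] by blast
  obtain C where C: "C \<ge> 0" "\<And>x. norm (\<psi> x) \<le> C" "\<And>x. norm (dx1 \<psi> x) \<le> C" "\<And>x. norm (dx2 \<psi> x) \<le> C" using smooth_multiplierE[OF \<psi>] by blast
  note sm = smooth_multiplier_smooth[OF \<phi>] smooth_multiplier_smooth[OF \<psi>]
  note d = smooth_differentiable[OF sm(1)] smooth_differentiable[OF sm(2)]
  have p: "norm (a * b) \<le> B * C" if "norm a \<le> B" "norm b \<le> C" for a b :: complex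
    unfolding norm_mult using that B(1) by (intro mult_mono) auto
  have BC: "B * C \<ge> 0" using B(1) C(1) by simp
  have q: "norm (a * b + a' * b') \<le> 2 * (B * C)" if "norm a \<le> B" "norm b \<le> C" "norm a' \<le> B" "norm b' \<le> C" for a b a' b' :: complex
    using norm_triangle_ineq[of "a * b" "a' * b'"] p[OF that(1,2)] p[OF that(3,4)] by linarith
  have "norm (\<phi> x * \<psi> x) \<le> 2 * (B * C) \<and> norm (dx1 (\<lambda>x. \<phi> x * \<psi> x) x) \<le> 2 * (B * C) \<and> norm (dx2 (\<lambda>x. \<phi> x * \<psi> x) x) \<le> 2 * (B * C)" for x
    unfolding dx_mult[OF d] using q[OF B(2) C(3) B(3) C(2), of x x x x] q[OF B(2) C(4) B(4) C(2), of x x x x] p[OF B(2) C(2), of x x] BC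
    by (intro conjI) linarith+
  then show ?thesis unfolding smooth_multiplier_def using smooth_mult[OF sm] by blast
qed

lemma L2_norm_sq_norm: "L2_norm M f = sqrt (sq_norm M f)"
  by (simp add: L2_norm_def sq_norm_def)

context acute_sector
begin

lemma product_gradient_weak:
  assumes u: "u \<in> L2 L" "is_weak_gradient U u g" and \<psi>: "smooth_multiplier \<psi>"
  shows "(\<lambda>x. \<psi> x * u x) \<in> L2 L" "is_weak_gradient U (\<lambda>x. \<psi> x * u x) (product_gradient \<psi> u g)"
proof -
  obtain B where B: "B \<ge> 0" "\<And>x. norm (\<psi> x) \<le> B" "\<And>x. norm (dx1 \<psi> x) \<le> B" "\<And>x. norm (dx2 \<psi> x) \<le> B" using smooth_multiplierE[OF \<psi>] by blast
  show "(\<lambda>x. \<psi> x * u x) \<in> L2 L" by (rule weak_gradient_mult(1)[OF u smooth_multiplier_smooth[OF \<psi>] B(2-4)])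
  show "is_weak_gradient U (\<lambda>x. \<psi> x * u x) (product_gradient \<psi> u g)"
    unfolding product_gradient_def[abs_def] by (rule weak_gradient_mult(2)[OF u smooth_multiplier_smooth[OF \<psi>] B(2-4)])
qed

lemma trace_sequence:
  assumes u: "u \<in> L2 L" "is_weak_gradient U u g" and h: "is_trace U u h"
  obtains \<phi> where "\<forall>n. \<phi> n \<in> test_functions UNIV" "(\<lambda>n. sq_norm L (\<lambda>x. \<phi> n x - u x)) \<longlonglongrightarrow> 0"
    "(\<lambda>n. sq_norm L (\<lambda>x. grad (\<phi> n) x - g x)) \<longlonglongrightarrow> 0" "(\<lambda>n. sq_norm M (\<lambda>x. \<phi> n x - h x)) \<longlonglongrightarrow> 0"
proof -
  obtain \<phi> where \<phi>: "\<And>n. \<phi> n \<in> test_functions UNIV" and lim: "(\<lambda>n. H1_norm U (\<lambda>x. \<phi> n x - u x)) \<longlonglongrightarrow> 0"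
    and b: "(\<lambda>n. L2_norm M (\<lambda>x. \<phi> n x - h x)) \<longlonglongrightarrow> 0"
    using h unfolding is_trace_def M_def by auto
  have eq: "(H1_norm U (\<lambda>x. \<phi> n x - u x))\<^sup>2 = sq_norm L (\<lambda>x. grad (\<phi> n) x - g x) + sq_norm L (\<lambda>x. \<phi> n x - u x)" for n
    by (rule H1_norm_eq[OF L2_diff(1)[OF test_functions_L2[OF \<phi>] u(1)] weak_gradient_diff[OF test_functions_L2[OF \<phi>] weak_gradient_test[OF \<phi>] u]])
  have s: "(\<lambda>n. sq_norm L (\<lambda>x. grad (\<phi> n) x - g x) + sq_norm L (\<lambda>x. \<phi> n x - u x)) \<longlonglongrightarrow> 0"
    using tendsto_power[OF lim, where n=2] unfolding eq by simp
  show ?thesis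
  proof (rule that)
    show "\<forall>n. \<phi> n \<in> test_functions UNIV" using \<phi> by simp
    show "(\<lambda>n. sq_norm L (\<lambda>x. \<phi> n x - u x)) \<longlonglongrightarrow> 0"
      by (rule real_tendsto_sandwich[OF _ _ tendsto_const s]) auto
    show "(\<lambda>n. sq_norm L (\<lambda>x. grad (\<phi> n) x - g x)) \<longlonglongrightarrow> 0"
      by (rule real_tendsto_sandwich[OF _ _ tendsto_const s]) auto
    have "(\<lambda>n. (sqrt (sq_norm M (\<lambda>x. \<phi> n x - h x)))\<^sup>2) \<longlonglongrightarrow> 0"
      using tendsto_power[OF b, where n=2] unfolding L2_norm_sq_norm by simp
    then show "(\<lambda>n. sq_norm M (\<lambda>x. \<phi> n x - h x)) \<longlonglongrightarrow> 0" by simp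
  qed
qed

lemma trace_intro:
  assumes u: "u \<in> L2 L" "is_weak_gradient U u g" and h: "h \<in> L2 M"
    and \<phi>: "\<And>n. \<phi> n \<in> test_functions UNIV" and l: "(\<lambda>n. sq_norm L (\<lambda>x. \<phi> n x - u x)) \<longlonglongrightarrow> 0"
    "(\<lambda>n. sq_norm L (\<lambda>x. grad (\<phi> n) x - g x)) \<longlonglongrightarrow> 0" "(\<lambda>n. sq_norm M (\<lambda>x. \<phi> n x - h x)) \<longlonglongrightarrow> 0"
  shows "is_trace U u h"
proof -
  have eq: "H1_norm U (\<lambda>x. \<phi> n x - u x) = sqrt (sq_norm L (\<lambda>x. grad (\<phi> n) x - g x) + sq_norm L (\<lambda>x. \<phi> n x - u x))" for n
  proof -
    have "(H1_norm U (\<lambda>x. \<phi> n x - u x))\<^sup>2 = sq_norm L (\<lambda>x. grad (\<phi> n) x - g x) + sq_norm L (\<lambda>x. \<phi> n x - u x)"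
      by (rule H1_norm_eq[OF L2_diff(1)[OF test_functions_L2[OF \<phi>] u(1)] weak_gradient_diff[OF test_functions_L2[OF \<phi>] weak_gradient_test[OF \<phi>] u]])
    moreover have "H1_norm U (\<lambda>x. \<phi> n x - u x) \<ge> 0" by (simp add: H1_norm_def)
    ultimately show ?thesis by (metis real_sqrt_unique)
  qed
  have "(\<lambda>n. H1_norm U (\<lambda>x. \<phi> n x - u x)) \<longlonglongrightarrow> 0"
    unfolding eq using tendsto_real_sqrt[OF tendsto_add[OF l(2,1)]] by simp
  moreover have "(\<lambda>n. L2_norm M (\<lambda>x. \<phi> n x - h x)) \<longlonglongrightarrow> 0"
    unfolding L2_norm_sq_norm using tendsto_real_sqrt[OF l(3)] by simp
  ultimately show ?thesis
    unfolding is_trace_def using h \<phi> by (auto simp: M_def[symmetric])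
qed

lemma trace_bound_test_diff:
  assumes \<phi>: "\<phi> \<in> test_functions UNIV" and \<psi>: "\<psi> \<in> test_functions UNIV" and u: "u \<in> L2 L" "is_weak_gradient U u g"
  shows "sq_norm M (\<lambda>x. \<phi> x - \<psi> x) \<le> (1 + 2 * trace_const) *
    ((sq_norm L (\<lambda>x. \<phi> x - u x) + sq_norm L (\<lambda>x. grad \<phi> x - g x)) + (sq_norm L (\<lambda>x. \<psi> x - u x) + sq_norm L (\<lambda>x. grad \<psi> x - g x)))"
proof -
  note d = smooth_differentiable[OF test_functions_smooth[OF \<phi>]] smooth_differentiable[OF test_functions_smooth[OF \<psi>]]
  have gr: "grad (\<lambda>x. \<phi> x - \<psi> x) = (\<lambda>x. grad \<phi> x - grad \<psi> x)" by (auto simp: grad_def dx_diff[OF d])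
  let ?a = "sq_norm L (\<lambda>x. \<phi> x - u x)" and ?b = "sq_norm L (\<lambda>x. grad \<phi> x - g x)"
  let ?c = "sq_norm L (\<lambda>x. \<psi> x - u x)" and ?d = "sq_norm L (\<lambda>x. grad \<psi> x - g x)"
  have 1: "sq_norm M (\<lambda>x. \<phi> x - \<psi> x) \<le> 1 / 2 * sq_norm L (\<lambda>x. grad \<phi> x - grad \<psi> x) + trace_const * sq_norm L (\<lambda>x. \<phi> x - \<psi> x)"
    using trace_inequality_test(2)[OF test_functions_diff[OF \<phi> \<psi>]] unfolding gr .
  have 2: "sq_norm L (\<lambda>x. \<phi> x - \<psi> x) \<le> 2 * ?a + 2 * ?c"
    using sq_norm_triangle[OF test_functions_L2[OF \<phi>] u(1) test_functions_L2[OF \<psi>]] sq_norm_commute[of L \<psi> u] by simp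
  have 3: "sq_norm L (\<lambda>x. grad \<phi> x - grad \<psi> x) \<le> 2 * ?b + 2 * ?d"
    using sq_norm_triangle[OF grad_test_functions_L2[OF \<phi>] weak_gradient_L2[OF u(2)] grad_test_functions_L2[OF \<psi>]] sq_norm_commute[of L "grad \<psi>" g] by simp
  have "trace_const * sq_norm L (\<lambda>x. \<phi> x - \<psi> x) \<le> trace_const * (2 * ?a + 2 * ?c)"
    using 2 trace_const_nonneg by (rule mult_left_mono)
  then have "sq_norm M (\<lambda>x. \<phi> x - \<psi> x) \<le> ?b + ?d + trace_const * (2 * ?a + 2 * ?c)" using 1 3 by linarith
  also have "\<dots> \<le> (1 + 2 * trace_const) * ((?a + ?b) + (?c + ?d))"
  proof -
    have "0 \<le> trace_const * ?b" "0 \<le> trace_const * ?d" "0 \<le> ?a" "0 \<le> ?c" using trace_const_nonneg by auto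
    then show ?thesis by (simp add: algebra_simps)
  qed
  finally show ?thesis .
qed

text \<open>An approximating sequence of test functions with geometric rate has boundary values that converge with the same
rate, by the trace inequality.\<close>

lemma trace_exists:
  assumes "u \<in> H1 U"
  shows "is_trace U u (trace_on_boundary U u)"
proof -
  have u: "u \<in> L2 L" "is_weak_gradient U u (weak_grad U u)" using assms H1_weak_gradient by (auto simp: H1_def)
  let ?g = "weak_grad U u"
  have "\<exists>\<phi>. \<phi> \<in> test_functions UNIV \<and> sq_norm L (\<lambda>x. \<phi> x - u x) + sq_norm L (\<lambda>x. grad \<phi> x - ?g x) < (1/4)^n" for n
    using density[OF u, of "(1/4)^n"] by (simp add: Bex_def)
  then have "\<exists>\<phi>. \<forall>n. \<phi> n \<in> test_functions UNIV \<and> sq_norm L (\<lambda>x. \<phi> n x - u x) + sq_norm L (\<lambda>x. grad (\<phi> n) x - ?g x) < (1/4)^n"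
    by (intro choice allI)
  then obtain \<phi> where \<phi>le: "\<forall>n. \<phi> n \<in> test_functions UNIV \<and> sq_norm L (\<lambda>x. \<phi> n x - u x) + sq_norm L (\<lambda>x. grad (\<phi> n) x - ?g x) < (1/4)^n"
    by (rule exE)
  have \<phi>: "\<phi> n \<in> test_functions UNIV" and le: "sq_norm L (\<lambda>x. \<phi> n x - u x) + sq_norm L (\<lambda>x. grad (\<phi> n) x - ?g x) < (1/4)^n" for n
    using \<phi>le by simp_all
  let ?c = "1 + 2 * trace_const"
  have c: "?c \<ge> 0" using trace_const_nonneg by simp
  have ca: "sq_norm M (\<lambda>x. \<phi> n x - \<phi> m x) \<le> ?c * ((1/4)^n + (1/4)^m)" for n m
    by (rule order_trans[OF trace_bound_test_diff[OF \<phi> \<phi> u]]) (intro mult_left_mono add_mono less_imp_le le c)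
  obtain h where h: "h \<in> L2 M" "(\<lambda>n. sq_norm M (\<lambda>x. \<phi> n x - h x)) \<longlonglongrightarrow> 0"
    by (rule L2_Cauchy_limit[OF trace_inequality_test(1)[OF \<phi>] c ca])
  have z: "(\<lambda>n. (1/4)^n :: real) \<longlonglongrightarrow> 0" by (rule LIMSEQ_power_zero) simp
  have n1: "sq_norm L (\<lambda>x. \<phi> n x - u x) \<le> (1/4)^n" for n
    using le[of n] sq_norm_nonneg[of L "\<lambda>x. grad (\<phi> n) x - ?g x"] by linarith
  have n2: "sq_norm L (\<lambda>x. grad (\<phi> n) x - ?g x) \<le> (1/4)^n" for n
    using le[of n] sq_norm_nonneg[of L "\<lambda>x. \<phi> n x - u x"] by linarith
  have "is_trace U u h"
  proof (rule trace_intro[OF u h(1) \<phi> _ _ h(2)])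
    show "(\<lambda>n. sq_norm L (\<lambda>x. \<phi> n x - u x)) \<longlonglongrightarrow> 0"
      by (rule real_tendsto_sandwich[OF _ _ tendsto_const z]) (auto simp: n1)
    show "(\<lambda>n. sq_norm L (\<lambda>x. grad (\<phi> n) x - ?g x)) \<longlonglongrightarrow> 0"
      by (rule real_tendsto_sandwich[OF _ _ tendsto_const z]) (auto simp: n2)
  qed
  then show ?thesis unfolding trace_on_boundary_def by (rule someI[of "is_trace U u"])
qed

lemma trace_L2: "is_trace U u h \<Longrightarrow> h \<in> L2 M"
  by (simp add: is_trace_def M_def)

lemma trace_unique:
  assumes u: "u \<in> L2 L" "is_weak_gradient U u g" and h: "is_trace U u h" and k: "is_trace U u k"
  shows "AE x in M. h x = k x"
proof -
  obtain \<phi> where \<phi>0: "\<forall>n. \<phi> n \<in> test_functions UNIV" "(\<lambda>n. sq_norm L (\<lambda>x. \<phi> n x - u x)) \<longlonglongrightarrow> 0"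
    "(\<lambda>n. sq_norm L (\<lambda>x. grad (\<phi> n) x - g x)) \<longlonglongrightarrow> 0" "(\<lambda>n. sq_norm M (\<lambda>x. \<phi> n x - h x)) \<longlonglongrightarrow> 0"
    by (rule trace_sequence[OF u h])
  note \<phi> = \<phi>0(1)[rule_format] \<phi>0(2-4)
  obtain \<psi> where \<psi>0: "\<forall>n. \<psi> n \<in> test_functions UNIV" "(\<lambda>n. sq_norm L (\<lambda>x. \<psi> n x - u x)) \<longlonglongrightarrow> 0"
    "(\<lambda>n. sq_norm L (\<lambda>x. grad (\<psi> n) x - g x)) \<longlonglongrightarrow> 0" "(\<lambda>n. sq_norm M (\<lambda>x. \<psi> n x - k x)) \<longlonglongrightarrow> 0"
    by (rule trace_sequence[OF u k])
  note \<psi> = \<psi>0(1)[rule_format] \<psi>0(2-4)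
  note hL = trace_L2[OF h] and kL = trace_L2[OF k]
  define S where "S n = (1 + 2 * trace_const) *
    ((sq_norm L (\<lambda>x. \<phi> n x - u x) + sq_norm L (\<lambda>x. grad (\<phi> n) x - g x)) + (sq_norm L (\<lambda>x. \<psi> n x - u x) + sq_norm L (\<lambda>x. grad (\<psi> n) x - g x)))" for n
  have le: "sq_norm M (\<lambda>x. h x - k x) \<le> 2 * sq_norm M (\<lambda>x. \<phi> n x - h x) + 4 * S n + 4 * sq_norm M (\<lambda>x. \<psi> n x - k x)" for n
  proof -
    note p = trace_inequality_test(1)[OF \<phi>(1)[of n]] and q = trace_inequality_test(1)[OF \<psi>(1)[of n]]
    have "sq_norm M (\<lambda>x. h x - k x) \<le> 2 * sq_norm M (\<lambda>x. h x - \<phi> n x) + 2 * sq_norm M (\<lambda>x. \<phi> n x - k x)"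
      by (rule sq_norm_triangle[OF hL p kL])
    moreover have "sq_norm M (\<lambda>x. \<phi> n x - k x) \<le> 2 * sq_norm M (\<lambda>x. \<phi> n x - \<psi> n x) + 2 * sq_norm M (\<lambda>x. \<psi> n x - k x)"
      by (rule sq_norm_triangle[OF p q kL])
    moreover have "sq_norm M (\<lambda>x. \<phi> n x - \<psi> n x) \<le> S n" unfolding S_def by (rule trace_bound_test_diff[OF \<phi>(1) \<psi>(1) u])
    ultimately show ?thesis using sq_norm_commute[of M h "\<phi> n"] by linarith
  qed
  have "(\<lambda>n. 2 * sq_norm M (\<lambda>x. \<phi> n x - h x) + 4 * S n + 4 * sq_norm M (\<lambda>x. \<psi> n x - k x)) \<longlonglongrightarrow>
     2 * 0 + 4 * ((1 + 2 * trace_const) * ((0 + 0) + (0 + 0))) + 4 * 0"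
    unfolding S_def by (intro tendsto_intros \<phi> \<psi>)
  then have "(\<lambda>n. 2 * sq_norm M (\<lambda>x. \<phi> n x - h x) + 4 * S n + 4 * sq_norm M (\<lambda>x. \<psi> n x - k x)) \<longlonglongrightarrow> 0" by simp
  from LIMSEQ_le_const[OF this] have "sq_norm M (\<lambda>x. h x - k x) \<le> 0" using le by blast
  then have "sq_norm M (\<lambda>x. h x - k x) = 0" using sq_norm_nonneg[of M "\<lambda>x. h x - k x"] by linarith
  then have "AE x in M. (norm (h x - k x))\<^sup>2 = 0"
    unfolding sq_norm_def using integral_nonneg_eq_0_iff_AE[OF L2_integrable_sq[OF L2_diff(1)[OF hL kL]]] by simp
  then show ?thesis by eventually_elim simp
qed

text \<open>If \<open>\<phi>\<^sub>n\<close> approximates \<open>u\<close> then \<open>\<psi> \<phi>\<^sub>n\<close> approximates \<open>\<psi> u\<close>. Hence a trace inequality that is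
known for the test functions \<open>\<psi> \<phi>\<close> passes to the limit; in the second part the support of \<open>\<psi>\<close> may enter.\<close>

lemma trace_mult:
  assumes u: "u \<in> L2 L" "is_weak_gradient U u g" and h: "is_trace U u h" and \<psi>: "smooth_multiplier \<psi>"
  shows "is_trace U (\<lambda>x. \<psi> x * u x) (\<lambda>x. \<psi> x * h x)"
    and "(\<And>\<phi>. \<phi> \<in> test_functions UNIV \<Longrightarrow> sq_norm M (\<lambda>x. \<psi> x * \<phi> x) \<le> A * sq_norm L (grad (\<lambda>x. \<psi> x * \<phi> x)) + N * sq_norm L (\<lambda>x. \<psi> x * \<phi> x)) \<Longrightarrow>
      sq_norm M (\<lambda>x. \<psi> x * h x) \<le> A * sq_norm L (product_gradient \<psi> u g) + N * sq_norm L (\<lambda>x. \<psi> x * u x)"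
proof -
  obtain \<phi> where \<phi>0: "\<forall>n. \<phi> n \<in> test_functions UNIV" "(\<lambda>n. sq_norm L (\<lambda>x. \<phi> n x - u x)) \<longlonglongrightarrow> 0"
    "(\<lambda>n. sq_norm L (\<lambda>x. grad (\<phi> n) x - g x)) \<longlonglongrightarrow> 0" "(\<lambda>n. sq_norm M (\<lambda>x. \<phi> n x - h x)) \<longlonglongrightarrow> 0"
    by (rule trace_sequence[OF u h])
  note \<phi> = \<phi>0(1)[rule_format] \<phi>0(2-4)
  obtain B where B: "B \<ge> 0" "\<And>x. norm (\<psi> x) \<le> B" "\<And>x. norm (dx1 \<psi> x) \<le> B" "\<And>x. norm (dx2 \<psi> x) \<le> B" using smooth_multiplierE[OF \<psi>] by blast
  note s\<psi> = smooth_multiplier_smooth[OF \<psi>]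
  note hL = trace_L2[OF h] and gL = weak_gradient_L2[OF u(2)]
  note w = product_gradient_weak[OF u \<psi>]
  define \<phi>' where "\<phi>' n x = \<psi> x * \<phi> n x" for n x
  have t: "\<phi>' n \<in> test_functions UNIV" for n unfolding \<phi>'_def[abs_def] by (rule test_functions_mult[OF s\<psi> \<phi>(1)])
  have hm: "(\<lambda>x. \<psi> x * h x) \<in> L2 M" by (rule L2_mult_bounded(1)[OF hL M_borel[OF smooth_measurable[OF s\<psi>]] B(2)])
  note diffL = L2_diff(1)[OF test_functions_L2[OF \<phi>(1)] u(1)]
  have l1: "(\<lambda>n. sq_norm L (\<lambda>x. \<phi>' n x - \<psi> x * u x)) \<longlonglongrightarrow> 0"
  proof (rule real_tendsto_sandwich[OF _ _ tendsto_const])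
    have "sq_norm L (\<lambda>x. \<phi>' n x - \<psi> x * u x) \<le> B\<^sup>2 * sq_norm L (\<lambda>x. \<phi> n x - u x)" for n
      using L2_mult_bounded(2)[OF diffL[of n] smooth_L_borel[OF s\<psi>] B(2)] by (simp add: \<phi>'_def right_diff_distrib)
    then show "eventually (\<lambda>n. sq_norm L (\<lambda>x. \<phi>' n x - \<psi> x * u x) \<le> B\<^sup>2 * sq_norm L (\<lambda>x. \<phi> n x - u x)) sequentially" by simp
    show "(\<lambda>n. B\<^sup>2 * sq_norm L (\<lambda>x. \<phi> n x - u x)) \<longlonglongrightarrow> 0" using tendsto_mult_right_zero[OF \<phi>(2)] .
  qed simp
  have l3: "(\<lambda>n. sq_norm M (\<lambda>x. \<phi>' n x - \<psi> x * h x)) \<longlonglongrightarrow> 0"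
  proof (rule real_tendsto_sandwich[OF _ _ tendsto_const])
    have "sq_norm M (\<lambda>x. \<phi>' n x - \<psi> x * h x) \<le> B\<^sup>2 * sq_norm M (\<lambda>x. \<phi> n x - h x)" for n
      using L2_mult_bounded(2)[OF L2_diff(1)[OF trace_inequality_test(1)[OF \<phi>(1)[of n]] hL] M_borel[OF smooth_measurable[OF s\<psi>]] B(2)]
      by (simp add: \<phi>'_def right_diff_distrib)
    then show "eventually (\<lambda>n. sq_norm M (\<lambda>x. \<phi>' n x - \<psi> x * h x) \<le> B\<^sup>2 * sq_norm M (\<lambda>x. \<phi> n x - h x)) sequentially" by simp
    show "(\<lambda>n. B\<^sup>2 * sq_norm M (\<lambda>x. \<phi> n x - h x)) \<longlonglongrightarrow> 0" using tendsto_mult_right_zero[OF \<phi>(4)] .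
  qed simp
  have l2: "(\<lambda>n. sq_norm L (\<lambda>x. grad (\<phi>' n) x - product_gradient \<psi> u g x)) \<longlonglongrightarrow> 0"
  proof (rule real_tendsto_sandwich[OF _ _ tendsto_const])
    have "sq_norm L (\<lambda>x. grad (\<phi>' n) x - product_gradient \<psi> u g x) \<le> 2 * (B\<^sup>2 * sq_norm L (\<lambda>x. grad (\<phi> n) x - g x)) + 2 * (2 * B\<^sup>2 * sq_norm L (\<lambda>x. \<phi> n x - u x))" for n
    proof -
      note d = smooth_differentiable[OF s\<psi>] smooth_differentiable[OF test_functions_smooth[OF \<phi>(1)[of n]]]
      note dL = L2_diff(1)[OF grad_test_functions_L2[OF \<phi>(1)[of n]] gL]
      note dL' = L2_fst_snd[OF dL]
      note m = smooth_L_borel[OF s\<psi>] smooth_L_borel[OF smooth_dx(1)[OF s\<psi>]] smooth_L_borel[OF smooth_dx(2)[OF s\<psi>]]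
      let ?p = "\<lambda>x. (\<psi> x * fst (grad (\<phi> n) x - g x), \<psi> x * snd (grad (\<phi> n) x - g x))"
      let ?q = "\<lambda>x. (dx1 \<psi> x * (\<phi> n x - u x), dx2 \<psi> x * (\<phi> n x - u x))"
      note p1 = L2_mult_bounded[OF dL'(1) m(1) B(2)] and p2 = L2_mult_bounded[OF dL'(2) m(1) B(2)]
        and q1 = L2_mult_bounded[OF diffL[of n] m(2) B(3)] and q2 = L2_mult_bounded[OF diffL[of n] m(3) B(4)]
      have pL: "?p \<in> L2 L" and qL: "?q \<in> L2 L" unfolding L2_Pair_iff using p1(1) p2(1) q1(1) q2(1) by simp_all
      have "(\<lambda>x. grad (\<phi>' n) x - product_gradient \<psi> u g x) = (\<lambda>x. ?p x + ?q x)"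
        unfolding \<phi>'_def[abs_def] grad_def product_gradient_def dx_mult[OF d] by (auto simp: algebra_simps)
      then have "sq_norm L (\<lambda>x. grad (\<phi>' n) x - product_gradient \<psi> u g x) \<le> 2 * sq_norm L ?p + 2 * sq_norm L ?q"
        using L2_add(2)[OF pL qL] by simp
      moreover have "sq_norm L ?p \<le> B\<^sup>2 * sq_norm L (\<lambda>x. grad (\<phi> n) x - g x)"
      proof -
        have "sq_norm L ?p = sq_norm L (\<lambda>x. \<psi> x * fst (grad (\<phi> n) x - g x)) + sq_norm L (\<lambda>x. \<psi> x * snd (grad (\<phi> n) x - g x))"
          by (rule sq_norm_Pair[OF p1(1) p2(1)])
        also have "\<dots> \<le> B\<^sup>2 * (sq_norm L (\<lambda>x. fst (grad (\<phi> n) x - g x)) + sq_norm L (\<lambda>x. snd (grad (\<phi> n) x - g x)))"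
          using p1(2) p2(2) by (simp add: distrib_left)
        also have "sq_norm L (\<lambda>x. fst (grad (\<phi> n) x - g x)) + sq_norm L (\<lambda>x. snd (grad (\<phi> n) x - g x)) = sq_norm L (\<lambda>x. grad (\<phi> n) x - g x)"
          using sq_norm_Pair[OF dL'] unfolding prod.collapse by (rule sym)
        finally show ?thesis .
      qed
      moreover have "sq_norm L ?q \<le> 2 * B\<^sup>2 * sq_norm L (\<lambda>x. \<phi> n x - u x)"
        using sq_norm_Pair[OF q1(1) q2(1)] q1(2) q2(2) by simp
      ultimately show ?thesis by linarith
    qed
    then show "eventually (\<lambda>n. sq_norm L (\<lambda>x. grad (\<phi>' n) x - product_gradient \<psi> u g x) \<le> 2 * (B\<^sup>2 * sq_norm L (\<lambda>x. grad (\<phi> n) x - g x)) + 2 * (2 * B\<^sup>2 * sq_norm L (\<lambda>x. \<phi> n x - u x))) sequentially" by simp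
    have "(\<lambda>n. 2 * (B\<^sup>2 * sq_norm L (\<lambda>x. grad (\<phi> n) x - g x)) + 2 * (2 * B\<^sup>2 * sq_norm L (\<lambda>x. \<phi> n x - u x))) \<longlonglongrightarrow> 2 * (B\<^sup>2 * 0) + 2 * (2 * B\<^sup>2 * 0)"
      by (intro tendsto_intros \<phi>)
    then show "(\<lambda>n. 2 * (B\<^sup>2 * sq_norm L (\<lambda>x. grad (\<phi> n) x - g x)) + 2 * (2 * B\<^sup>2 * sq_norm L (\<lambda>x. \<phi> n x - u x))) \<longlonglongrightarrow> 0" by simp
  qed simp
  show "is_trace U (\<lambda>x. \<psi> x * u x) (\<lambda>x. \<psi> x * h x)" by (rule trace_intro[OF w hm t l1 l2 l3])
  assume ineq: "\<And>\<phi>. \<phi> \<in> test_functions UNIV \<Longrightarrow> sq_norm M (\<lambda>x. \<psi> x * \<phi> x) \<le> A * sq_norm L (grad (\<lambda>x. \<psi> x * \<phi> x)) + N * sq_norm L (\<lambda>x. \<psi> x * \<phi> x)"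
  have c1: "(\<lambda>n. sq_norm L (\<phi>' n)) \<longlonglongrightarrow> sq_norm L (\<lambda>x. \<psi> x * u x)" by (rule sq_norm_tendsto[OF test_functions_L2[OF t] w(1) l1])
  have c2: "(\<lambda>n. sq_norm L (grad (\<phi>' n))) \<longlonglongrightarrow> sq_norm L (product_gradient \<psi> u g)" by (rule sq_norm_tendsto[OF grad_test_functions_L2[OF t] weak_gradient_L2[OF w(2)] l2])
  have c3: "(\<lambda>n. sq_norm M (\<phi>' n)) \<longlonglongrightarrow> sq_norm M (\<lambda>x. \<psi> x * h x)" by (rule sq_norm_tendsto[OF trace_inequality_test(1)[OF t] hm l3])
  have "(\<lambda>n. A * sq_norm L (grad (\<phi>' n)) + N * sq_norm L (\<phi>' n)) \<longlonglongrightarrow> A * sq_norm L (product_gradient \<psi> u g) + N * sq_norm L (\<lambda>x. \<psi> x * u x)"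
    by (intro tendsto_intros c1 c2)
  then show "sq_norm M (\<lambda>x. \<psi> x * h x) \<le> A * sq_norm L (product_gradient \<psi> u g) + N * sq_norm L (\<lambda>x. \<psi> x * u x)"
    by (rule LIMSEQ_le[OF c3]) (use ineq[OF \<phi>(1)] in \<open>auto simp: \<phi>'_def[abs_def]\<close>)
qed

end

section \<open>Weighted test functions in the eigenvalue equation\<close>

lemma real_valued_dx:
  assumes f: "f differentiable at x" and re: "\<And>x. Im (f x) = 0"
  shows "Im (dx1 f x) = 0" "Im (dx2 f x) = 0"
proof -
  let ?D = "\<lambda>h. fst h *\<^sub>R dx1 f x + snd h *\<^sub>R dx2 f x"
  have "((\<lambda>x. Im (f x)) has_derivative (\<lambda>h. Im (?D h))) (at x)"
    using has_derivative_dx[OF f] by (rule has_derivative_Im)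
  moreover have "((\<lambda>x. Im (f x)) has_derivative (\<lambda>h. 0)) (at x)" unfolding re by simp
  ultimately have D: "(\<lambda>h. Im (?D h)) = (\<lambda>h. 0)" by (rule has_derivative_unique)
  show "Im (dx1 f x) = 0" using fun_cong[OF D, of "(1, 0)"] by simp
  show "Im (dx2 f x) = 0" using fun_cong[OF D, of "(0, 1)"] by simp
qed

text \<open>The identity behind Agmon's method, for one component: \<open>a\<close> is the weight, \<open>b\<close> its derivative, \<open>v\<close> the function
and \<open>g\<close> its derivative.\<close>

lemma agmon_pointwise:
  fixes a b g v :: complex
  assumes "Im a = 0" "Im b = 0"
  shows "Re (g * cnj (a * a * g + (a * b + b * a) * v)) = (norm (a * g + b * v))\<^sup>2 - (norm (b * v))\<^sup>2"
  using assms unfolding cmod_power2 by (simp add: power2_eq_square algebra_simps)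

context acute_sector
begin

text \<open>The function \<open>u \<nabla>\<psi>\<close>, the price for moving the weight across the gradient.\<close>

definition gradient_term :: "(plane \<Rightarrow> complex) \<Rightarrow> (plane \<Rightarrow> complex) \<Rightarrow> plane \<Rightarrow> complex \<times> complex" where
  "gradient_term \<psi> u x = (dx1 \<psi> x * u x, dx2 \<psi> x * u x)"

lemma gradient_term_L2:
  assumes u: "u \<in> L2 L" and \<psi>: "smooth_multiplier \<psi>"
  shows "gradient_term \<psi> u \<in> L2 L"
proof -
  obtain B where B: "B \<ge> 0" "\<And>x. norm (\<psi> x) \<le> B" "\<And>x. norm (dx1 \<psi> x) \<le> B" "\<And>x. norm (dx2 \<psi> x) \<le> B" using smooth_multiplierE[OF \<psi>] by blast
  note s = smooth_multiplier_smooth[OF \<psi>]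
  show ?thesis unfolding gradient_term_def[abs_def] L2_Pair_iff
    using L2_mult_bounded(1)[OF u smooth_L_borel[OF smooth_dx(1)[OF s]] B(3)] L2_mult_bounded(1)[OF u smooth_L_borel[OF smooth_dx(2)[OF s]] B(4)] by simp
qed

lemma eigen_identity:
  assumes V: "(V, \<lambda>x. complex_of_real E * V x) \<in> robin_laplacian \<alpha>" and \<psi>: "smooth_multiplier \<psi>" and re: "\<And>x. Im (\<psi> x) = 0"
  shows "sq_norm L (product_gradient \<psi> V (weak_grad U V)) = sq_norm L (gradient_term \<psi> V)
     + sq_norm M (\<lambda>x. \<psi> x * trace_on_boundary U V x) + E * sq_norm L (\<lambda>x. \<psi> x * V x)"
proof -
  let ?g = "weak_grad U V" and ?h = "trace_on_boundary U V"
  have VH: "V \<in> H1 U" and eq: "\<And>v. v \<in> H1 U \<Longrightarrow> robin_form \<alpha> V v = L2_inner L (\<lambda>x. complex_of_real E * V x) v"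
    using V unfolding robin_laplacian_def form_operator_def U_def by auto
  have u: "V \<in> L2 L" "is_weak_gradient U V ?g" using VH H1_weak_gradient by (auto simp: H1_def)
  note gL = weak_gradient_L2[OF u(2)]
  note tr = trace_exists[OF VH] and hL = trace_L2[OF trace_exists[OF VH]]
  \<comment> \<open>The test function is \<open>\<psi>\<^sup>2 V\<close>.\<close>
  define \<eta> where "\<eta> x = \<psi> x * \<psi> x" for x
  have \<eta>: "smooth_multiplier \<eta>" unfolding \<eta>_def[abs_def] by (rule smooth_multiplier_mult[OF \<psi> \<psi>])
  define v where "v x = \<eta> x * V x" for x
  define w where "w = product_gradient \<eta> V ?g"
  have v: "v \<in> L2 L" "is_weak_gradient U v w" using product_gradient_weak[OF u \<eta>] by (auto simp: v_def[abs_def] w_def)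
  have vH: "v \<in> H1 U" unfolding H1_def using v by auto
  have gv: "AE x in L. weak_grad U v x = w x" by (rule weak_grad_eq(1)[OF v(2)])
  have "is_trace U v (\<lambda>x. \<eta> x * ?h x)" unfolding v_def[abs_def] by (rule trace_mult(1)[OF u tr \<eta>])
  then have tv: "AE x in M. trace_on_boundary U v x = \<eta> x * ?h x"
    by (rule trace_unique[OF v trace_exists[OF vH]])
  note wL = weak_gradient_L2[OF v(2)] and w'L = weak_gradient_L2[OF H1_weak_gradient[OF vH]]
  note g12 = L2_fst_snd[OF gL] and w12 = L2_fst_snd[OF wL] and w'12 = L2_fst_snd[OF w'L]
  note ic = L2_mult_integrable[OF g12(1) L2_cnj[OF w12(1)]] L2_mult_integrable[OF g12(2) L2_cnj[OF w12(2)]]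
  note ic' = L2_mult_integrable[OF g12(1) L2_cnj[OF w'12(1)]] L2_mult_integrable[OF g12(2) L2_cnj[OF w'12(2)]]
  note \<psi>s = smooth_multiplier_smooth[OF \<psi>]
  note d = smooth_differentiable[OF \<psi>s]
  have w1: "fst (w x) = \<psi> x * \<psi> x * fst (?g x) + (\<psi> x * dx1 \<psi> x + dx1 \<psi> x * \<psi> x) * V x"
    and w2: "snd (w x) = \<psi> x * \<psi> x * snd (?g x) + (\<psi> x * dx2 \<psi> x + dx2 \<psi> x * \<psi> x) * V x" for x
    unfolding w_def product_gradient_def \<eta>_def[abs_def] dx_mult[OF d d] by simp_all
  note WL = weak_gradient_L2[OF product_gradient_weak(2)[OF u \<psi>]] and PL = gradient_term_L2[OF u(1) \<psi>]
  let ?I = "\<integral>x. fst (?g x) * cnj (fst (w x)) + snd (?g x) * cnj (snd (w x)) \<partial>L"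
  have I: "(\<integral>x. fst (?g x) * cnj (fst (weak_grad U v x)) + snd (?g x) * cnj (snd (weak_grad U v x)) \<partial>L) = ?I"
  proof (rule integral_cong_AE)
    show "(\<lambda>x. fst (?g x) * cnj (fst (weak_grad U v x)) + snd (?g x) * cnj (snd (weak_grad U v x))) \<in> borel_measurable L"
      using ic' by (intro borel_measurable_add) auto
    show "(\<lambda>x. fst (?g x) * cnj (fst (w x)) + snd (?g x) * cnj (snd (w x))) \<in> borel_measurable L"
      using ic by (intro borel_measurable_add) auto
    show "AE x in L. fst (?g x) * cnj (fst (weak_grad U v x)) + snd (?g x) * cnj (snd (weak_grad U v x)) = fst (?g x) * cnj (fst (w x)) + snd (?g x) * cnj (snd (w x))"
      using gv by eventually_elim simp
  qed
  have "Re ?I = (\<integral>x. Re (fst (?g x) * cnj (fst (w x)) + snd (?g x) * cnj (snd (w x))) \<partial>L)"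
    using ic by (intro integral_Re[symmetric]) simp
  also have "\<dots> = (\<integral>x. (norm (product_gradient \<psi> V ?g x))\<^sup>2 - (norm (gradient_term \<psi> V x))\<^sup>2 \<partial>L)"
  proof (rule Bochner_Integration.integral_cong[OF refl])
    fix x
    show "Re (fst (?g x) * cnj (fst (w x)) + snd (?g x) * cnj (snd (w x))) = (norm (product_gradient \<psi> V ?g x))\<^sup>2 - (norm (gradient_term \<psi> V x))\<^sup>2"
      unfolding w1 w2 plus_complex.sel agmon_pointwise[OF re real_valued_dx(1)[OF d re]] agmon_pointwise[OF re real_valued_dx(2)[OF d re]]
        product_gradient_def gradient_term_def norm_pair_sq by simp
  qed
  also have "\<dots> = sq_norm L (product_gradient \<psi> V ?g) - sq_norm L (gradient_term \<psi> V)"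
    unfolding sq_norm_def by (rule Bochner_Integration.integral_diff[OF L2_integrable_sq[OF WL] L2_integrable_sq[OF PL]])
  finally have ReI: "Re ?I = sq_norm L (product_gradient \<psi> V ?g) - sq_norm L (gradient_term \<psi> V)" .
  have sq: "z * cnj (\<psi> x * \<psi> x * z) = complex_of_real ((norm (\<psi> x * z))\<^sup>2)" for x z
  proof -
    have "cnj (\<psi> x) = \<psi> x" using re[of x] by (simp add: complex_eq_iff)
    then show ?thesis unfolding complex_norm_square by (simp add: mult_ac)
  qed
  have B: "L2_inner M ?h (trace_on_boundary U v) = complex_of_real (sq_norm M (\<lambda>x. \<psi> x * ?h x))"
  proof -
    have "L2_inner M ?h (trace_on_boundary U v) = (\<integral>x. ?h x * cnj (\<psi> x * \<psi> x * ?h x) \<partial>M)"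
      unfolding L2_inner_def
    proof (rule integral_cong_AE)
      have \<eta>h: "(\<lambda>x. \<psi> x * \<psi> x * ?h x) \<in> L2 M"
        using trace_L2[OF \<open>is_trace U v (\<lambda>x. \<eta> x * ?h x)\<close>] by (simp add: \<eta>_def)
      show "(\<lambda>x. ?h x * cnj (trace_on_boundary U v x)) \<in> borel_measurable M"
        using L2_mult_integrable[OF hL L2_cnj[OF trace_L2[OF trace_exists[OF vH]]]] by simp
      show "(\<lambda>x. ?h x * cnj (\<psi> x * \<psi> x * ?h x)) \<in> borel_measurable M"
        using borel_measurable_integrable[OF L2_mult_integrable[OF hL L2_cnj[OF \<eta>h]]] .
      show "AE x in M. ?h x * cnj (trace_on_boundary U v x) = ?h x * cnj (\<psi> x * \<psi> x * ?h x)"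
        using tv by eventually_elim (simp add: \<eta>_def)
    qed
    then show ?thesis unfolding sq sq_norm_def by (simp only: integral_complex_of_real)
  qed
  have R: "L2_inner L (\<lambda>x. complex_of_real E * V x) v = complex_of_real (E * sq_norm L (\<lambda>x. \<psi> x * V x))"
  proof -
    have "L2_inner L (\<lambda>x. complex_of_real E * V x) v = (\<integral>x. complex_of_real E * (V x * cnj (\<psi> x * \<psi> x * V x)) \<partial>L)"
      unfolding L2_inner_def v_def \<eta>_def by (simp only: mult.assoc)
    also have "\<dots> = complex_of_real E * complex_of_real (sq_norm L (\<lambda>x. \<psi> x * V x))"
      unfolding sq sq_norm_def by (simp only: integral_mult_right_zero integral_complex_of_real)
    finally show ?thesis by simp
  qed
  have "robin_form \<alpha> V v = ?I - L2_inner M ?h (trace_on_boundary U v)"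
    unfolding robin_form_def Let_def U_def[symmetric] M_def[symmetric] I ..
  then have "?I - complex_of_real (sq_norm M (\<lambda>x. \<psi> x * ?h x)) = complex_of_real (E * sq_norm L (\<lambda>x. \<psi> x * V x))"
    using eq[OF vH] unfolding B R by simp
  then have "Re (?I - complex_of_real (sq_norm M (\<lambda>x. \<psi> x * ?h x))) = Re (complex_of_real (E * sq_norm L (\<lambda>x. \<psi> x * V x)))"
    by (rule arg_cong)
  then have "Re ?I - sq_norm M (\<lambda>x. \<psi> x * ?h x) = E * sq_norm L (\<lambda>x. \<psi> x * V x)"
    by (simp only: minus_complex.sel Re_complex_of_real)
  then show ?thesis unfolding ReI by simp
qed

text \<open>The far trace inequality has the coefficient \<open>1\<close> in front of the gradient, which therefore cancels in the identity.\<close>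

lemma agmon_far:
  assumes V: "(V, \<lambda>x. complex_of_real E * V x) \<in> robin_laplacian \<alpha>" and \<psi>: "smooth_multiplier \<psi>" and re: "\<And>x. Im (\<psi> x) = 0"
    and R: "R > 0" and z: "\<And>x. fst x \<le> R \<Longrightarrow> \<psi> x = 0"
  shows "(- 1 - E - 1 / (R * tan \<alpha>)) * sq_norm L (\<lambda>x. \<psi> x * V x) \<le> sq_norm L (gradient_term \<psi> V)"
proof -
  have VH: "V \<in> H1 U" using V unfolding robin_laplacian_def form_operator_def U_def by auto
  have u: "V \<in> L2 L" "is_weak_gradient U V (weak_grad U V)" using VH H1_weak_gradient by (auto simp: H1_def)
  have "sq_norm M (\<lambda>x. \<psi> x * trace_on_boundary U V x) \<le> 1 * sq_norm L (product_gradient \<psi> V (weak_grad U V)) + (1 + 1 / (R * tan \<alpha>)) * sq_norm L (\<lambda>x. \<psi> x * V x)"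
  proof (rule trace_mult(2)[OF u trace_exists[OF VH] \<psi>])
    fix \<phi> assume "\<phi> \<in> test_functions UNIV"
    then have "(\<lambda>x. \<psi> x * \<phi> x) \<in> test_functions UNIV" by (rule test_functions_mult[OF smooth_multiplier_smooth[OF \<psi>]])
    from trace_inequality_far[OF this R] z
    show "sq_norm M (\<lambda>x. \<psi> x * \<phi> x) \<le> 1 * sq_norm L (grad (\<lambda>x. \<psi> x * \<phi> x)) + (1 + 1 / (R * tan \<alpha>)) * sq_norm L (\<lambda>x. \<psi> x * \<phi> x)" by simp
  qed
  then show ?thesis using eigen_identity[OF V \<psi> re] by (simp add: algebra_simps)
qed

text \<open>Here half of the gradient is absorbed.\<close>

lemma agmon_gradient:
  assumes V: "(V, \<lambda>x. complex_of_real E * V x) \<in> robin_laplacian \<alpha>" and \<psi>: "smooth_multiplier \<psi>" and re: "\<And>x. Im (\<psi> x) = 0"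
  shows "sq_norm L (product_gradient \<psi> V (weak_grad U V)) \<le> 2 * sq_norm L (gradient_term \<psi> V) + 2 * (trace_const + E) * sq_norm L (\<lambda>x. \<psi> x * V x)"
proof -
  have VH: "V \<in> H1 U" using V unfolding robin_laplacian_def form_operator_def U_def by auto
  have u: "V \<in> L2 L" "is_weak_gradient U V (weak_grad U V)" using VH H1_weak_gradient by (auto simp: H1_def)
  have "sq_norm M (\<lambda>x. \<psi> x * trace_on_boundary U V x) \<le> 1 / 2 * sq_norm L (product_gradient \<psi> V (weak_grad U V)) + trace_const * sq_norm L (\<lambda>x. \<psi> x * V x)"
    by (rule trace_mult(2)[OF u trace_exists[OF VH] \<psi>]) (rule trace_inequality_test(2)[OF test_functions_mult[OF smooth_multiplier_smooth[OF \<psi>]]])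
  then show ?thesis using eigen_identity[OF V \<psi> re] by (simp add: algebra_simps)
qed

end

section \<open>Exponential weights\<close>

text \<open>A smooth substitute for \<^term>\<open>norm x\<close> that dominates it and has a gradient of norm at most \<open>1\<close>.\<close>

definition japanese_bracket :: "plane \<Rightarrow> real" where "japanese_bracket x = sqrt (1 + ((fst x)\<^sup>2 + (snd x)\<^sup>2))"

text \<open>The truncation \<open>s / (1 + s / n)\<close> is smooth, is bounded by \<open>n\<close>, tends to \<open>s\<close>, and has derivative at most \<open>1\<close>. So the
weights are bounded and smooth, with a logarithmic gradient bounded by \<open>c\<close> uniformly in \<open>n\<close>.\<close>

definition weight :: "real \<Rightarrow> real \<Rightarrow> plane \<Rightarrow> real" where
  "weight c n x = exp (c * (japanese_bracket x / (1 + japanese_bracket x / n)))"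

lemma norm_sq_plane: "(norm x)\<^sup>2 = (fst x)\<^sup>2 + (snd x)\<^sup>2" for x :: plane
  by (metis norm_pair_sq power2_abs prod.collapse real_norm_def)

lemma japanese_bracket_bounds: "japanese_bracket x \<ge> 1" "norm x \<le> japanese_bracket x" "japanese_bracket x \<le> 1 + norm x"
proof -
  have e: "japanese_bracket x = sqrt (1 + (norm x)\<^sup>2)" by (simp add: japanese_bracket_def norm_sq_plane)
  show "japanese_bracket x \<ge> 1" unfolding e by simp
  show "norm x \<le> japanese_bracket x" unfolding e by (rule real_le_rsqrt) simp
  show "japanese_bracket x \<le> 1 + norm x" unfolding e by (rule real_le_lsqrt) (auto simp: power2_sum)
qed

lemma smooth_coordinate: "smooth (\<lambda>x. complex_of_real (fst x))" "smooth (\<lambda>x. complex_of_real (snd x))"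
proof -
  define F :: "nat \<Rightarrow> real \<Rightarrow> real" where "F n t = (if n = 0 then t else if n = 1 then 1 else 0)" for n t
  have "(F n has_real_derivative F (Suc n) t) (at t)" for n t
    unfolding F_def by (cases n) auto
  note s = smooth_affine_compose[of F, OF this]
  show "smooth (\<lambda>x. complex_of_real (fst x))" "smooth (\<lambda>x. complex_of_real (snd x))"
    using s[of 1 0 0] s[of 0 1 0] by (simp_all add: F_def)
qed

text \<open>The weight is a holomorphic function of \<open>|x|\<^sup>2\<close> in a half-plane; the denominator does not vanish there since the
principal square root has non-negative real part.\<close>

lemma smooth_weight:
  assumes n: "n > 0"
  shows "smooth (\<lambda>x. complex_of_real (weight c n x))"
proof -
  define F where "F z = exp (complex_of_real c * (csqrt (1 + z) / (1 + csqrt (1 + z) / complex_of_real n)))" for z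
  define f where "f x = complex_of_real (fst x) * complex_of_real (fst x) + complex_of_real (snd x) * complex_of_real (snd x)" for x :: plane
  let ?S = "{z. Re z > -1}"
  have nz: "1 + csqrt (1 + z) / complex_of_real n \<noteq> 0" if "z \<in> ?S" for z
  proof -
    have "Re (csqrt (1 + z)) \<ge> 0" using csqrt_principal[of "1 + z"] by auto
    then have "Re (1 + csqrt (1 + z) / complex_of_real n) \<ge> 1" using n by (simp add: Re_divide_of_real)
    then show ?thesis by (metis not_one_le_zero zero_complex.sel(1))
  qed
  have hol: "F holomorphic_on ?S"
    unfolding F_def using nz n by (intro holomorphic_intros) (auto simp: complex_nonpos_Reals_iff)
  have op: "open ?S" by (rule open_halfspace_Re_gt)
  have ran: "range f \<subseteq> ?S"
  proof
    fix z assume "z \<in> range f"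
    then obtain x where "z = f x" by blast
    moreover have "Re (f x) \<ge> 0" by (simp add: f_def)
    ultimately show "z \<in> ?S" by simp
  qed
  have "smooth f" unfolding f_def by (intro smooth_add smooth_mult smooth_coordinate)
  then have "smooth (\<lambda>x. F (f x))" by (rule smooth_holomorphic_compose[OF op hol ran])
  moreover have "F (f x) = complex_of_real (weight c n x)" for x
  proof -
    have "1 + f x = complex_of_real (1 + ((fst x)\<^sup>2 + (snd x)\<^sup>2))" by (simp add: f_def power2_eq_square)
    then have "csqrt (1 + f x) = complex_of_real (japanese_bracket x)"
      unfolding japanese_bracket_def by (simp only: of_real_sqrt add_nonneg_nonneg zero_le_one zero_le_power2)
    then show ?thesis unfolding F_def weight_def by (simp add: exp_of_real[symmetric])
  qed
  ultimately show ?thesis by simp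
qed

lemma dx_weight:
  fixes c n :: real
  assumes n: "n > 0"
  defines "k x \<equiv> c / (1 + japanese_bracket x / n)\<^sup>2 / japanese_bracket x"
  shows "dx1 (\<lambda>x. complex_of_real (weight c n x)) x = complex_of_real (k x * weight c n x * fst x)"
    "dx2 (\<lambda>x. complex_of_real (weight c n x)) x = complex_of_real (k x * weight c n x * snd x)"
proof -
  have j: "japanese_bracket x > 0" using japanese_bracket_bounds(1)[of x] by linarith
  have p: "1 + japanese_bracket x / n > 0" using j n by (simp add: add_pos_pos)
  have p': "n + japanese_bracket x > 0" using j n by simp
  have D1: "((\<lambda>x. 1 + ((fst x)\<^sup>2 + (snd x)\<^sup>2)) has_derivative (\<lambda>h. 2 * (fst x * fst h + snd x * snd h))) (at x)"
    by (auto intro!: derivative_eq_intros simp: power2_eq_square algebra_simps)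
  have D2: "(sqrt has_derivative (\<lambda>h. inverse (japanese_bracket x) / 2 * h)) (at (1 + ((fst x)\<^sup>2 + (snd x)\<^sup>2)))"
    unfolding has_field_derivative_def[symmetric] japanese_bracket_def by (rule DERIV_real_sqrt) (simp add: add_pos_nonneg)
  have D12: "(japanese_bracket has_derivative (\<lambda>h. inverse (japanese_bracket x) / 2 * (2 * (fst x * fst h + snd x * snd h)))) (at x)"
    using has_derivative_compose[OF D1 D2] unfolding japanese_bracket_def[abs_def] .
  have "((\<lambda>s. s / (1 + s / n)) has_real_derivative 1 / (1 + japanese_bracket x / n)\<^sup>2) (at (japanese_bracket x))"
    using p p' n by (auto intro!: derivative_eq_intros simp: power2_eq_square field_simps)
  then have "((\<lambda>s. exp (c * (s / (1 + s / n)))) has_real_derivative exp (c * (japanese_bracket x / (1 + japanese_bracket x / n))) * (c * (1 / (1 + japanese_bracket x / n)\<^sup>2))) (at (japanese_bracket x))"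
    by (intro DERIV_fun_exp DERIV_cmult)
  then have D3: "((\<lambda>s. exp (c * (s / (1 + s / n)))) has_derivative (\<lambda>h. weight c n x * (c * (1 / (1 + japanese_bracket x / n)\<^sup>2)) * h)) (at (japanese_bracket x))"
    unfolding has_field_derivative_def weight_def .
  have "(weight c n has_derivative (\<lambda>h. weight c n x * (c * (1 / (1 + japanese_bracket x / n)\<^sup>2)) * (inverse (japanese_bracket x) / 2 * (2 * (fst x * fst h + snd x * snd h))))) (at x)"
    using has_derivative_compose[OF D12 D3] unfolding weight_def[abs_def] .
  from dx_has_derivative[OF has_derivative_of_real[OF this]]
  show "dx1 (\<lambda>x. complex_of_real (weight c n x)) x = complex_of_real (k x * weight c n x * fst x)"
    "dx2 (\<lambda>x. complex_of_real (weight c n x)) x = complex_of_real (k x * weight c n x * snd x)"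
    by (simp_all add: k_def field_simps)
qed

lemma weight_pos: "weight c n x > 0"
  by (simp add: weight_def)

lemma norm_grad_weight:
  assumes n: "n > 0" and c: "c \<ge> 0"
  shows "norm (grad (\<lambda>x. complex_of_real (weight c n x)) x) \<le> c * weight c n x"
proof -
  define k where "k = c / (1 + japanese_bracket x / n)\<^sup>2 / japanese_bracket x"
  have j: "japanese_bracket x \<ge> 1" using japanese_bracket_bounds(1) .
  have k0: "k \<ge> 0" using c j by (simp add: k_def)
  have "grad (\<lambda>x. complex_of_real (weight c n x)) x = (complex_of_real (k * weight c n x * fst x), complex_of_real (k * weight c n x * snd x))"
    unfolding grad_def dx_weight[OF n] k_def ..
  then have "norm (grad (\<lambda>x. complex_of_real (weight c n x)) x) = sqrt ((k * weight c n x * fst x)\<^sup>2 + (k * weight c n x * snd x)\<^sup>2)"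
    by (simp only: norm_Pair norm_of_real power2_abs)
  also have "\<dots> = sqrt ((k * weight c n x)\<^sup>2 * (norm x)\<^sup>2)"
    unfolding norm_sq_plane by (simp only: power_mult_distrib distrib_left)
  also have "\<dots> = k * norm x * weight c n x"
    using k0 weight_pos[of c n x] by (simp add: real_sqrt_mult)
  also have "\<dots> \<le> c * weight c n x"
  proof (rule mult_right_mono)
    have "k * norm x \<le> k * japanese_bracket x" using k0 japanese_bracket_bounds(2) by (intro mult_left_mono)
    also have "\<dots> = c / (1 + japanese_bracket x / n)\<^sup>2" using j by (simp add: k_def)
    also have "\<dots> \<le> c / 1"
    proof (rule divide_left_mono)
      have "1 \<le> 1 + japanese_bracket x / n" using j n by simp
      then show "1 \<le> (1 + japanese_bracket x / n)\<^sup>2" by (rule one_le_power)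
      then show "0 < (1 + japanese_bracket x / n)\<^sup>2 * 1" by linarith
    qed (rule c)
    finally show "k * norm x \<le> c" by simp
  qed (use weight_pos[of c n x] in simp)
  finally show ?thesis .
qed

lemma norm_dx_le_grad: "norm (dx1 f x) \<le> norm (grad f x)" "norm (dx2 f x) \<le> norm (grad f x)"
  unfolding grad_def by (rule norm_fst_le norm_snd_le)+

lemma weight_le:
  assumes n: "n > 0" and c: "c \<ge> 0"
  shows "weight c n x \<le> exp (c * n)" "weight c n x \<le> exp (c * (1 + norm x))"
proof -
  have j: "japanese_bracket x \<ge> 1" using japanese_bracket_bounds(1) .
  have "japanese_bracket x / (1 + japanese_bracket x / n) \<le> n" using n j by (simp add: divide_le_eq add_pos_pos algebra_simps)
  from mult_left_mono[OF this c] show "weight c n x \<le> exp (c * n)" unfolding weight_def exp_le_cancel_iff .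
  have "japanese_bracket x / (1 + japanese_bracket x / n) \<le> japanese_bracket x / 1" using n j by (intro divide_left_mono) (auto simp: add_pos_pos)
  also have "\<dots> \<le> 1 + norm x" using japanese_bracket_bounds(3) by simp
  finally have "japanese_bracket x / (1 + japanese_bracket x / n) \<le> 1 + norm x" .
  from mult_left_mono[OF this c] show "weight c n x \<le> exp (c * (1 + norm x))" unfolding weight_def exp_le_cancel_iff .
qed

lemma smooth_multiplier_weight:
  assumes n: "n > 0" and c: "c \<ge> 0"
  shows "smooth_multiplier (\<lambda>x. complex_of_real (weight c n x))"
  unfolding smooth_multiplier_def
proof (intro conjI exI allI)
  let ?B = "(1 + c) * exp (c * n)"
  show "smooth (\<lambda>x. complex_of_real (weight c n x))" by (rule smooth_weight[OF n])
  fix x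
  have b: "c * weight c n x \<le> c * exp (c * n)" using weight_le(1)[OF n c] c by (intro mult_left_mono)
  have "c * exp (c * n) \<ge> 0" using c by simp
  then show "norm (complex_of_real (weight c n x)) \<le> ?B"
    using weight_le(1)[OF n c, of x] weight_pos[of c n x] unfolding norm_of_real distrib_right by linarith
  have g: "norm (grad (\<lambda>x. complex_of_real (weight c n x)) x) \<le> ?B"
    using norm_grad_weight[OF n c, of x] b unfolding distrib_right by (smt (verit) exp_gt_zero)
  show "norm (dx1 (\<lambda>x. complex_of_real (weight c n x)) x) \<le> ?B" "norm (dx2 (\<lambda>x. complex_of_real (weight c n x)) x) \<le> ?B"
    by (rule order_trans[OF norm_dx_le_grad(1) g], rule order_trans[OF norm_dx_le_grad(2) g])
qed

text \<open>Vanishes for \<open>x\<^sub>1 \<le> R\<close> and increases to \<open>1\<close>. It is nowhere constant beyond \<open>R\<close>, but its logarithmic derivative is at most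
\<open>1 / R\<close> once \<open>x\<^sub>1 \<ge> 2 R\<close>, which is as good for the estimate.\<close>

definition cutoff :: "real \<Rightarrow> plane \<Rightarrow> real" where "cutoff R x = flat (fst x / R - 1)"

lemma flat_deriv_1: "flat_deriv (Suc 0) t = (1 / t)\<^sup>2 * flat t"
  by (simp add: flat_deriv_def flat_def power2_eq_square pderiv_1)

lemma flat_deriv_1_bounds: "0 \<le> flat_deriv (Suc 0) t" "flat_deriv (Suc 0) t \<le> 2" "t \<ge> 1 \<Longrightarrow> flat_deriv (Suc 0) t \<le> flat t"
proof -
  show "0 \<le> flat_deriv (Suc 0) t" unfolding flat_deriv_1 by simp
  show "flat_deriv (Suc 0) t \<le> 2"
  proof (cases "t > 0")
    case True
    have "(1 / t)\<^sup>2 \<le> 2 * exp (1 / t)" using exp_lower_Taylor_quadratic[of "1 / t"] True by (smt (verit) divide_nonneg_pos field_sum_of_halves)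
    then have "(1 / t)\<^sup>2 * exp (- (1 / t)) \<le> 2 * exp (1 / t) * exp (- (1 / t))" by (rule mult_right_mono) simp
    also have "\<dots> = 2" by (simp add: exp_minus)
    finally show ?thesis using True by (simp add: flat_deriv_1 flat_def)
  qed (simp add: flat_deriv_1 flat_def)
  show "flat_deriv (Suc 0) t \<le> flat t" if "t \<ge> 1"
  proof -
    have "(1 / t)\<^sup>2 \<le> 1" using that by (intro power_le_one) auto
    then show ?thesis unfolding flat_deriv_1 using mult_right_mono[of "(1 / t)\<^sup>2" 1 "flat t"] by simp
  qed
qed

lemma dx_cutoff:
  "dx1 (\<lambda>x. complex_of_real (cutoff R x)) x = complex_of_real (flat_deriv (Suc 0) (fst x / R - 1) / R)"
  "dx2 (\<lambda>x. complex_of_real (cutoff R x)) x = 0"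
proof -
  have D1: "((\<lambda>x. fst x / R - 1) has_derivative (\<lambda>h. fst h / R)) (at x)"
    by (cases "R = 0") (auto intro!: derivative_eq_intros)
  have e: "flat_deriv 0 = flat" by (auto simp: flat_def flat_deriv_def)
  have D2: "(flat has_derivative (\<lambda>h. flat_deriv (Suc 0) (fst x / R - 1) * h)) (at (fst x / R - 1))"
    using flat_deriv_has_derivative[of 0] unfolding e has_field_derivative_def by simp
  have "(cutoff R has_derivative (\<lambda>h. flat_deriv (Suc 0) (fst x / R - 1) * (fst h / R))) (at x)"
    using has_derivative_compose[OF D1 D2] unfolding cutoff_def[abs_def] .
  from dx_has_derivative[OF has_derivative_of_real[OF this]]
  show "dx1 (\<lambda>x. complex_of_real (cutoff R x)) x = complex_of_real (flat_deriv (Suc 0) (fst x / R - 1) / R)"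
    "dx2 (\<lambda>x. complex_of_real (cutoff R x)) x = 0" by simp_all
qed

lemma smooth_cutoff: "smooth (\<lambda>x. complex_of_real (cutoff R x))"
  using smooth_flat[of "1 / R" 0 "-1"] by (simp add: cutoff_def)

lemma smooth_multiplier_cutoff:
  assumes R: "R \<ge> 1"
  shows "smooth_multiplier (\<lambda>x. complex_of_real (cutoff R x))"
  unfolding smooth_multiplier_def
proof (intro conjI exI allI)
  show "smooth (\<lambda>x. complex_of_real (cutoff R x))" by (rule smooth_cutoff)
  fix x
  show "norm (complex_of_real (cutoff R x)) \<le> 2" unfolding norm_of_real cutoff_def using flat_le_1[of "fst x / R - 1"] flat_nonneg[of "fst x / R - 1"] by simp
  have "flat_deriv (Suc 0) (fst x / R - 1) / R \<le> 2" using flat_deriv_1_bounds(1,2)[of "fst x / R - 1"] R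
    by (simp add: divide_le_eq)
  then show "norm (dx1 (\<lambda>x. complex_of_real (cutoff R x)) x) \<le> 2"
    unfolding dx_cutoff norm_of_real using flat_deriv_1_bounds(1)[of "fst x / R - 1"] R by simp
  show "norm (dx2 (\<lambda>x. complex_of_real (cutoff R x)) x) \<le> 2" unfolding dx_cutoff by simp
qed

lemma norm_grad_mult:
  assumes "smooth f" "smooth g"
  shows "norm (grad (\<lambda>x. f x * g x) x) \<le> norm (f x) * norm (grad g x) + norm (grad f x) * norm (g x)"
proof -
  note d = smooth_differentiable[OF assms(1)] smooth_differentiable[OF assms(2)]
  have m: "norm (a * p, a * q) = norm a * norm (p, q)" for a p q :: complex
    by (simp add: norm_Pair norm_mult power_mult_distrib distrib_left[symmetric] real_sqrt_mult)
  have "grad (\<lambda>x. f x * g x) x = (f x * dx1 g x, f x * dx2 g x) + (g x * dx1 f x, g x * dx2 f x)"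
    by (simp add: grad_def dx_mult[OF d] mult.commute)
  then have "norm (grad (\<lambda>x. f x * g x) x) \<le> norm (f x * dx1 g x, f x * dx2 g x) + norm (g x * dx1 f x, g x * dx2 f x)"
    by (simp only: norm_triangle_ineq)
  then show ?thesis unfolding m grad_def by (simp add: mult.commute)
qed

context acute_sector
begin

lemma norm_gradient_term: "norm (gradient_term \<psi> u x) = norm (grad \<psi> x) * norm (u x)"
  by (simp add: gradient_term_def grad_def norm_Pair norm_mult power_mult_distrib distrib_right[symmetric] real_sqrt_mult)

text \<open>In the sector, a bound for \<open>x\<^sub>1\<close> confines \<open>x\<close> to a bounded set.\<close>

lemma norm_le_in_U: "x \<in> U \<Longrightarrow> norm x \<le> fst x / cos \<alpha>"
proof -
  assume "x \<in> U"
  then have x: "fst x > 0" "\<bar>snd x\<bar> < fst x * tan \<alpha>" by (auto simp: U_eq)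
  have "(snd x)\<^sup>2 \<le> (fst x * tan \<alpha>)\<^sup>2" using x(2) by (metis abs_ge_zero less_imp_le power2_abs power_mono)
  then have "(norm x)\<^sup>2 \<le> (fst x)\<^sup>2 * (1 + (tan \<alpha>)\<^sup>2)" unfolding norm_sq_plane by (simp add: power_mult_distrib distrib_left)
  also have "1 + (tan \<alpha>)\<^sup>2 = 1 / (cos \<alpha>)\<^sup>2"
    using trig_pos sin_cos_squared_add[of \<alpha>] by (simp add: tan_def power_divide field_simps)
  finally have "(norm x)\<^sup>2 \<le> (fst x / cos \<alpha>)\<^sup>2" by (simp add: power_divide)
  then show ?thesis by (rule power2_le_imp_le) (use x trig_pos in simp)
qed

text \<open>Beyond \<open>x\<^sub>1 = 2 R\<close> the logarithmic gradient of \<open>\<psi>\<close> is at most \<open>c + 1 / R\<close>; the rest of the sector is bounded and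
contributes a constant that does not depend on the truncation \<open>n\<close>.\<close>

lemma cutoff_weight_gradient:
  assumes n: "n > 0" and c: "c \<ge> 0" and R: "R \<ge> 1" and x: "x \<in> U"
  defines "\<psi> \<equiv> \<lambda>x. complex_of_real (cutoff R x) * complex_of_real (weight c n x)"
  shows "(norm (grad \<psi> x))\<^sup>2 \<le> (c + 1 / R)\<^sup>2 * (norm (\<psi> x))\<^sup>2 + ((c + 2) * exp (c * (1 + 2 * R / cos \<alpha>)))\<^sup>2"
proof -
  let ?t = "fst x / R - 1"
  let ?w = "weight c n x"
  have w0: "?w > 0" by (rule weight_pos)
  have gc: "norm (grad (\<lambda>x. complex_of_real (cutoff R x)) x) = flat_deriv (Suc 0) ?t / R"
  proof -
    have "norm (grad (\<lambda>x. complex_of_real (cutoff R x)) x) = \<bar>flat_deriv (Suc 0) ?t / R\<bar>"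
      unfolding grad_def dx_cutoff by (simp only: norm_Pair norm_of_real norm_zero) simp
    then show ?thesis using flat_deriv_1_bounds(1)[of ?t] R by simp
  qed
  have nc: "norm (complex_of_real (cutoff R x)) = flat ?t" by (simp add: cutoff_def)
  have nw: "norm (complex_of_real ?w) = ?w" using w0 by simp
  have "norm (grad \<psi> x) \<le> flat ?t * norm (grad (\<lambda>x. complex_of_real (weight c n x)) x) + flat_deriv (Suc 0) ?t / R * ?w"
    unfolding \<psi>_def using norm_grad_mult[OF smooth_cutoff[of R] smooth_weight[OF n, of c], of x] unfolding gc nc nw .
  also have "\<dots> \<le> flat ?t * (c * ?w) + flat_deriv (Suc 0) ?t / R * ?w"
    using norm_grad_weight[OF n c] by (intro add_right_mono mult_left_mono) auto
  finally have g: "norm (grad \<psi> x) \<le> (flat ?t * c + flat_deriv (Suc 0) ?t / R) * ?w" by (simp add: algebra_simps)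
  show ?thesis
  proof (cases "?t \<ge> 1")
    case True
    have "flat_deriv (Suc 0) ?t / R \<le> flat ?t / R" using flat_deriv_1_bounds(3)[OF True] R by (intro divide_right_mono) auto
    then have "(flat ?t * c + flat_deriv (Suc 0) ?t / R) * ?w \<le> (flat ?t * c + flat ?t / R) * ?w" using w0 by (intro mult_right_mono) auto
    also have "\<dots> = (c + 1 / R) * norm (\<psi> x)" unfolding \<psi>_def norm_mult nc nw by (simp add: algebra_simps)
    finally have "norm (grad \<psi> x) \<le> (c + 1 / R) * norm (\<psi> x)" using g by linarith
    then have "(norm (grad \<psi> x))\<^sup>2 \<le> ((c + 1 / R) * norm (\<psi> x))\<^sup>2" by (rule power_mono) simp
    then show ?thesis unfolding power_mult_distrib[of "c + 1 / R"] by (smt (verit) zero_le_power2)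
  next
    case False
    then have "fst x \<le> 2 * R" using R by (simp add: field_simps)
    then have "fst x / cos \<alpha> \<le> 2 * R / cos \<alpha>" using trig_pos by (intro divide_right_mono) auto
    then have nx: "norm x \<le> 2 * R / cos \<alpha>" using norm_le_in_U[OF x] by linarith
    have "?w \<le> exp (c * (1 + norm x))" by (rule weight_le(2)[OF n c])
    also have "\<dots> \<le> exp (c * (1 + 2 * R / cos \<alpha>))" using nx c by (simp add: mult_left_mono)
    finally have we: "?w \<le> exp (c * (1 + 2 * R / cos \<alpha>))" .
    have "flat ?t * c \<le> 1 * c" using flat_le_1 c by (intro mult_right_mono) auto
    moreover have "flat_deriv (Suc 0) ?t / R \<le> 2" using flat_deriv_1_bounds(1,2)[of ?t] R by (simp add: divide_le_eq)
    ultimately have "flat ?t * c + flat_deriv (Suc 0) ?t / R \<le> c + 2" by simp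
    then have "(flat ?t * c + flat_deriv (Suc 0) ?t / R) * ?w \<le> (c + 2) * exp (c * (1 + 2 * R / cos \<alpha>))"
      using we w0 c by (intro mult_mono) auto
    then have "norm (grad \<psi> x) \<le> (c + 2) * exp (c * (1 + 2 * R / cos \<alpha>))" using g by linarith
    then have "(norm (grad \<psi> x))\<^sup>2 \<le> ((c + 2) * exp (c * (1 + 2 * R / cos \<alpha>)))\<^sup>2" by (rule power_mono) simp
    moreover have "0 \<le> (c + 1 / R)\<^sup>2 * (norm (\<psi> x))\<^sup>2" by simp
    ultimately show ?thesis by linarith
  qed
qed

text \<open>The far estimate for the cutoff weight, in which the term \<open>(c + 1 / R)\<^sup>2 \<integral>|\<psi> V|\<^sup>2\<close> is absorbed because
\<open>c\<^sup>2 < - 1 - E\<close>; the cutoff is removed afterwards.\<close>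

lemma weighted_bound:
  assumes V: "(V, \<lambda>x. complex_of_real E * V x) \<in> robin_laplacian \<alpha>" and c: "c \<ge> 0" and cE: "c\<^sup>2 < - 1 - E"
  obtains K where "\<And>n. n > 0 \<Longrightarrow> sq_norm L (\<lambda>x. complex_of_real (weight c n x) * V x) \<le> K"
proof -
  have VH: "V \<in> H1 U" using V unfolding robin_laplacian_def form_operator_def U_def by auto
  have VL: "V \<in> L2 L" using VH by (simp add: H1_def)
  have inv: "((\<lambda>R::real. inverse R) \<longlongrightarrow> 0) at_top" by (rule tendsto_inverse_0_at_top) (rule filterlim_ident)
  have "((\<lambda>R. inverse R * (1 / tan \<alpha>) + (c + inverse R)\<^sup>2) \<longlongrightarrow> 0 * (1 / tan \<alpha>) + (c + 0)\<^sup>2) at_top"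
    by (intro tendsto_intros inv)
  then have "eventually (\<lambda>R. inverse R * (1 / tan \<alpha>) + (c + inverse R)\<^sup>2 < - 1 - E) at_top"
    using cE by (intro order_tendstoD(2)) auto
  then have "eventually (\<lambda>R. inverse R * (1 / tan \<alpha>) + (c + inverse R)\<^sup>2 < - 1 - E \<and> R \<ge> 1) at_top"
    using eventually_ge_at_top[of 1] by (rule eventually_conj)
  \<comment> \<open>At \<open>R = \<infinity>\<close> the condition is \<open>c\<^sup>2 < - 1 - E\<close>.\<close>
  then obtain R where R: "inverse R * (1 / tan \<alpha>) + (c + inverse R)\<^sup>2 < - 1 - E" "R \<ge> 1"
    using eventually_happens'[OF trivial_limit_at_top_linorder] by blast
  define \<delta> where "\<delta> = - 1 - E - 1 / (R * tan \<alpha>) - (c + 1 / R)\<^sup>2"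
  have \<delta>: "\<delta> > 0" using R(1) by (simp add: \<delta>_def divide_inverse)
  define C where "C = (c + 2) * exp (c * (1 + 2 * R / cos \<alpha>))"
  define C2 where "C2 = exp (c * (1 + 2 * R / cos \<alpha>))"
  \<comment> \<open>Beyond \<open>x\<^sub>1 = 2 R\<close> the cutoff is at least \<open>exp (-1)\<close>, and before it the weight is at most \<open>C2\<close>.\<close>
  define K where "K = exp 2 * (C\<^sup>2 * sq_norm L V / \<delta>) + C2\<^sup>2 * sq_norm L V"
  show ?thesis
  proof (rule that)
    fix n :: real assume n: "n > 0"
    define \<psi> where "\<psi> = (\<lambda>x. complex_of_real (cutoff R x) * complex_of_real (weight c n x))"
    have t: "smooth_multiplier \<psi>" unfolding \<psi>_def by (rule smooth_multiplier_mult[OF smooth_multiplier_cutoff[OF R(2)] smooth_multiplier_weight[OF n c]])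
    have re: "Im (\<psi> x) = 0" for x by (simp add: \<psi>_def)
    have z: "\<psi> x = 0" if "fst x \<le> R" for x
    proof -
      have "fst x / R - 1 \<le> 0" using that R(2) by simp
      then show ?thesis by (simp add: \<psi>_def cutoff_def flat_0)
    qed
    obtain B where B: "B \<ge> 0" "\<And>x. norm (\<psi> x) \<le> B" "\<And>x. norm (dx1 \<psi> x) \<le> B" "\<And>x. norm (dx2 \<psi> x) \<le> B" using smooth_multiplierE[OF t] by blast
    have \<psi>V: "(\<lambda>x. \<psi> x * V x) \<in> L2 L" by (rule L2_mult_bounded(1)[OF VL smooth_L_borel[OF smooth_multiplier_smooth[OF t]] B(2)])
    have "sq_norm L (gradient_term \<psi> V) \<le> (\<integral>x. (c + 1 / R)\<^sup>2 * (norm (\<psi> x * V x))\<^sup>2 + C\<^sup>2 * (norm (V x))\<^sup>2 \<partial>L)"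
      unfolding sq_norm_def
    proof (rule integral_mono)
      show "integrable L (\<lambda>x. (norm (gradient_term \<psi> V x))\<^sup>2)" by (rule L2_integrable_sq[OF gradient_term_L2[OF VL t]])
      show "integrable L (\<lambda>x. (c + 1 / R)\<^sup>2 * (norm (\<psi> x * V x))\<^sup>2 + C\<^sup>2 * (norm (V x))\<^sup>2)"
        by (intro Bochner_Integration.integrable_add integrable_mult_right L2_integrable_sq \<psi>V VL)
      fix x assume "x \<in> space L"
      then have x: "x \<in> U" by simp
      have "(norm (gradient_term \<psi> V x))\<^sup>2 = (norm (grad \<psi> x))\<^sup>2 * (norm (V x))\<^sup>2" unfolding norm_gradient_term by (rule power_mult_distrib)
      also have "\<dots> \<le> ((c + 1 / R)\<^sup>2 * (norm (\<psi> x))\<^sup>2 + C\<^sup>2) * (norm (V x))\<^sup>2"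
        unfolding \<psi>_def C_def by (intro mult_right_mono cutoff_weight_gradient[OF n c R(2) x]) simp
      finally show "(norm (gradient_term \<psi> V x))\<^sup>2 \<le> (c + 1 / R)\<^sup>2 * (norm (\<psi> x * V x))\<^sup>2 + C\<^sup>2 * (norm (V x))\<^sup>2"
        by (simp add: norm_mult power_mult_distrib algebra_simps)
    qed
    also have "\<dots> = (c + 1 / R)\<^sup>2 * sq_norm L (\<lambda>x. \<psi> x * V x) + C\<^sup>2 * sq_norm L V"
      using L2_integrable_sq[OF \<psi>V] L2_integrable_sq[OF VL] by (simp add: sq_norm_def)
    finally have pot_le: "sq_norm L (gradient_term \<psi> V) \<le> (c + 1 / R)\<^sup>2 * sq_norm L (\<lambda>x. \<psi> x * V x) + C\<^sup>2 * sq_norm L V" .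
    have "(- 1 - E - 1 / (R * tan \<alpha>)) * sq_norm L (\<lambda>x. \<psi> x * V x) \<le> sq_norm L (gradient_term \<psi> V)"
    proof (rule agmon_far[OF V t re])
      show "R > 0" using R(2) by simp
    qed (rule z)
    moreover have "\<delta> * sq_norm L (\<lambda>x. \<psi> x * V x) =
        (- 1 - E - 1 / (R * tan \<alpha>)) * sq_norm L (\<lambda>x. \<psi> x * V x) - (c + 1 / R)\<^sup>2 * sq_norm L (\<lambda>x. \<psi> x * V x)"
      unfolding \<delta>_def by (rule left_diff_distrib)
    ultimately have "\<delta> * sq_norm L (\<lambda>x. \<psi> x * V x) \<le> C\<^sup>2 * sq_norm L V" using pot_le by linarith
    then have far: "sq_norm L (\<lambda>x. \<psi> x * V x) \<le> C\<^sup>2 * sq_norm L V / \<delta>" using \<delta> by (simp add: pos_le_divide_eq mult.commute)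
    note wL = L2_mult_bounded(1)[OF VL smooth_L_borel[OF smooth_weight[OF n]], of c "exp (c * n)"]
    have wV: "(\<lambda>x. complex_of_real (weight c n x) * V x) \<in> L2 L"
      by (rule wL) (use weight_le(1)[OF n c] weight_pos[of c n] in \<open>simp add: abs_of_pos\<close>)
    have "sq_norm L (\<lambda>x. complex_of_real (weight c n x) * V x) \<le> (\<integral>x. exp 2 * (norm (\<psi> x * V x))\<^sup>2 + C2\<^sup>2 * (norm (V x))\<^sup>2 \<partial>L)"
      unfolding sq_norm_def
    proof (rule integral_mono)
      show "integrable L (\<lambda>x. (norm (complex_of_real (weight c n x) * V x))\<^sup>2)" by (rule L2_integrable_sq[OF wV])
      show "integrable L (\<lambda>x. exp 2 * (norm (\<psi> x * V x))\<^sup>2 + C2\<^sup>2 * (norm (V x))\<^sup>2)"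
        by (intro Bochner_Integration.integrable_add integrable_mult_right L2_integrable_sq \<psi>V VL)
      fix x assume "x \<in> space L"
      then have x: "x \<in> U" by simp
      let ?w = "weight c n x"
      have w0: "?w > 0" by (rule weight_pos)
      have "?w\<^sup>2 \<le> exp 2 * (norm (\<psi> x))\<^sup>2 + C2\<^sup>2"
      proof (cases "fst x / R - 1 \<ge> 1")
        case True
        then have "exp (-1) \<le> cutoff R x" by (simp add: cutoff_def flat_def)
        then have "exp (-1) * ?w \<le> norm (\<psi> x)" unfolding \<psi>_def norm_mult using w0 by (intro mult_mono) auto
        then have "(exp (-1) * ?w)\<^sup>2 \<le> (norm (\<psi> x))\<^sup>2" using w0 by (intro power_mono) auto
        then have "exp 2 * (exp (-1) * ?w)\<^sup>2 \<le> exp 2 * (norm (\<psi> x))\<^sup>2" by (rule mult_left_mono) simp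
        moreover have "exp 2 * (exp (-1) * ?w)\<^sup>2 = ?w\<^sup>2"
        proof -
          have "(exp (-1))\<^sup>2 = exp (-2 :: real)" using exp_double[of "-1 :: real"] by simp
          then have "exp 2 * (exp (-1))\<^sup>2 = (1::real)" by (simp add: exp_minus)
          then show ?thesis by (simp add: power_mult_distrib)
        qed
        ultimately show ?thesis by (smt (verit) zero_le_power2)
      next
        case False
        then have "fst x \<le> 2 * R" using R by (simp add: field_simps)
        then have "fst x / cos \<alpha> \<le> 2 * R / cos \<alpha>" using trig_pos by (intro divide_right_mono) auto
        then have nx: "norm x \<le> 2 * R / cos \<alpha>" using norm_le_in_U[OF x] by linarith
        have "?w \<le> exp (c * (1 + norm x))" by (rule weight_le(2)[OF n c])
        also have "\<dots> \<le> C2" unfolding C2_def using nx c by (simp add: mult_left_mono)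
        finally have "?w\<^sup>2 \<le> C2\<^sup>2" using w0 by (intro power_mono) auto
        then show ?thesis by (smt (verit) exp_gt_zero mult_nonneg_nonneg zero_le_power2)
      qed
      then have "?w\<^sup>2 * (norm (V x))\<^sup>2 \<le> (exp 2 * (norm (\<psi> x))\<^sup>2 + C2\<^sup>2) * (norm (V x))\<^sup>2" by (rule mult_right_mono) simp
      then show "(norm (complex_of_real ?w * V x))\<^sup>2 \<le> exp 2 * (norm (\<psi> x * V x))\<^sup>2 + C2\<^sup>2 * (norm (V x))\<^sup>2"
        by (simp add: norm_mult power_mult_distrib algebra_simps)
    qed
    also have "\<dots> = exp 2 * sq_norm L (\<lambda>x. \<psi> x * V x) + C2\<^sup>2 * sq_norm L V"
      using L2_integrable_sq[OF \<psi>V] L2_integrable_sq[OF VL] by (simp add: sq_norm_def)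
    also have "\<dots> \<le> K" unfolding K_def using far by (intro add_right_mono mult_left_mono) auto
    finally show "sq_norm L (\<lambda>x. complex_of_real (weight c n x) * V x) \<le> K" .
  qed
qed

text \<open>The bound for the weighted function controls the gradient of the product \<open>\<psi> V\<close>, and from it the
weighted gradient.\<close>

lemma weighted_energy_bound:
  assumes V: "(V, \<lambda>x. complex_of_real E * V x) \<in> robin_laplacian \<alpha>" and c: "c \<ge> 0" and cE: "c\<^sup>2 < - 1 - E"
  obtains K where "\<And>n. n > 0 \<Longrightarrow> (\<integral>\<^sup>+x. ennreal ((weight c n x)\<^sup>2 * ((norm (weak_grad U V x))\<^sup>2 + (norm (V x))\<^sup>2)) \<partial>L) \<le> ennreal K"
proof -
  have VH: "V \<in> H1 U" using V unfolding robin_laplacian_def form_operator_def U_def by auto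
  have u: "V \<in> L2 L" "is_weak_gradient U V (weak_grad U V)" using VH H1_weak_gradient by (auto simp: H1_def)
  let ?g = "weak_grad U V"
  note gL = weak_gradient_L2[OF u(2)]
  obtain K where K: "\<And>n. n > 0 \<Longrightarrow> sq_norm L (\<lambda>x. complex_of_real (weight c n x) * V x) \<le> K"
    using weighted_bound[OF V c cE] by blast
  have K0: "K \<ge> 0" using K[of 1] sq_norm_nonneg by (meson order_trans zero_less_one)
  define T where "T = trace_const + \<bar>E\<bar>"
  have T: "T \<ge> 0" using trace_const_nonneg by (simp add: T_def)
  define K' where "K' = 6 * (c\<^sup>2 * K) + 4 * (T * K) + K"
  show ?thesis
  proof (rule that)
    fix n :: real assume n: "n > 0"
    define \<psi> where "\<psi> = (\<lambda>x. complex_of_real (weight c n x))"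
    have t: "smooth_multiplier \<psi>" unfolding \<psi>_def by (rule smooth_multiplier_weight[OF n c])
    have re: "Im (\<psi> x) = 0" for x by (simp add: \<psi>_def)
    have nw: "norm (\<psi> x) = weight c n x" for x using weight_pos[of c n x] by (simp add: \<psi>_def)
    note w = product_gradient_weak[OF u t]
    note WL = weak_gradient_L2[OF w(2)] and PL = gradient_term_L2[OF u(1) t]
    have \<psi>m: "\<psi> \<in> borel_measurable L" by (rule smooth_L_borel[OF smooth_multiplier_smooth[OF t]])
    have P: "sq_norm L (gradient_term \<psi> V) \<le> c\<^sup>2 * sq_norm L (\<lambda>x. \<psi> x * V x)"
    proof (rule L2_bound(2)[OF w(1) L2_measurable[OF PL]])
      fix x
      have "norm (gradient_term \<psi> V x) \<le> (c * weight c n x) * norm (V x)"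
        unfolding norm_gradient_term \<psi>_def by (intro mult_right_mono norm_grad_weight[OF n c]) simp
      then show "norm (gradient_term \<psi> V x) \<le> c * norm (\<psi> x * V x)" by (simp add: norm_mult nw mult.assoc)
    qed
    have \<psi>VK: "sq_norm L (\<lambda>x. \<psi> x * V x) \<le> K" using K[OF n] by (simp add: \<psi>_def)
    have PK: "sq_norm L (gradient_term \<psi> V) \<le> c\<^sup>2 * K" using P mult_left_mono[OF \<psi>VK, of "c\<^sup>2"] by simp
    have WK: "sq_norm L (product_gradient \<psi> V ?g) \<le> 2 * (c\<^sup>2 * K) + 2 * (T * K)"
    proof -
      have "2 * (trace_const + E) * sq_norm L (\<lambda>x. \<psi> x * V x) \<le> 2 * T * sq_norm L (\<lambda>x. \<psi> x * V x)"
        by (intro mult_right_mono) (auto simp: T_def)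
      also have "\<dots> \<le> 2 * T * K" using \<psi>VK T by (intro mult_left_mono) auto
      also have "\<dots> = 2 * (T * K)" by simp
      finally show ?thesis using agmon_gradient[OF V t re] PK by linarith
    qed
    let ?p = "\<lambda>x. (\<psi> x * fst (?g x), \<psi> x * snd (?g x))"
    have pe: "?p = (\<lambda>x. product_gradient \<psi> V ?g x - gradient_term \<psi> V x)" by (auto simp: product_gradient_def gradient_term_def)
    have pL: "?p \<in> L2 L" and psq: "sq_norm L ?p \<le> 2 * sq_norm L (product_gradient \<psi> V ?g) + 2 * sq_norm L (gradient_term \<psi> V)"
      unfolding pe using L2_diff[OF WL PL] by auto
    have pn: "(norm (?p x))\<^sup>2 = (weight c n x)\<^sup>2 * (norm (?g x))\<^sup>2" for x
      using norm_pair_sq[of "fst (?g x)" "snd (?g x)"] by (simp add: norm_pair_sq norm_mult nw power_mult_distrib distrib_left)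
    have vn: "(norm (\<psi> x * V x))\<^sup>2 = (weight c n x)\<^sup>2 * (norm (V x))\<^sup>2" for x
      by (simp add: norm_mult nw power_mult_distrib)
    have "(\<integral>\<^sup>+x. ennreal ((weight c n x)\<^sup>2 * ((norm (?g x))\<^sup>2 + (norm (V x))\<^sup>2)) \<partial>L) = (\<integral>\<^sup>+x. ennreal ((norm (?p x))\<^sup>2 + (norm (\<psi> x * V x))\<^sup>2) \<partial>L)"
      unfolding pn vn by (simp add: distrib_left)
    also have "\<dots> = ennreal (\<integral>x. (norm (?p x))\<^sup>2 + (norm (\<psi> x * V x))\<^sup>2 \<partial>L)"
      by (rule nn_integral_eq_integral) (use L2_integrable_sq[OF pL] L2_integrable_sq[OF w(1)] in auto)
    also have "(\<integral>x. (norm (?p x))\<^sup>2 + (norm (\<psi> x * V x))\<^sup>2 \<partial>L) = sq_norm L ?p + sq_norm L (\<lambda>x. \<psi> x * V x)"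
      unfolding sq_norm_def by (rule Bochner_Integration.integral_add[OF L2_integrable_sq[OF pL] L2_integrable_sq[OF w(1)]])
    also have "\<dots> \<le> K'" using psq WK PK \<psi>VK unfolding K'_def by linarith
    finally show "(\<integral>\<^sup>+x. ennreal ((weight c n x)\<^sup>2 * ((norm (?g x))\<^sup>2 + (norm (V x))\<^sup>2)) \<partial>L) \<le> ennreal K'"
      by (simp add: ennreal_leI)
  qed
qed

text \<open>The weights tend to \<open>exp (c sqrt (1 + |x|\<^sup>2)) \<ge> exp (c |x|)\<close>, and the bound is uniform, so Fatou's lemma applies.\<close>

lemma agmon_estimate:
  assumes V: "(V, \<lambda>x. complex_of_real E * V x) \<in> robin_laplacian \<alpha>" and c: "c \<ge> 0" and cE: "c\<^sup>2 < - 1 - E"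
  shows "(\<integral>\<^sup>+x. ennreal (((norm (weak_grad U V x))\<^sup>2 + (norm (V x))\<^sup>2) * exp (2 * c * norm x)) \<partial>L) < \<infinity>"
proof -
  have VH: "V \<in> H1 U" using V unfolding robin_laplacian_def form_operator_def U_def by auto
  have u: "V \<in> L2 L" "is_weak_gradient U V (weak_grad U V)" using VH H1_weak_gradient by (auto simp: H1_def)
  note [measurable] = L2_measurable[OF u(1)] L2_measurable[OF weak_gradient_L2[OF u(2)]]
  let ?e = "\<lambda>x. (norm (weak_grad U V x))\<^sup>2 + (norm (V x))\<^sup>2"
  obtain K where K: "\<And>n. n > 0 \<Longrightarrow> (\<integral>\<^sup>+x. ennreal ((weight c n x)\<^sup>2 * ?e x) \<partial>L) \<le> ennreal K"
    using weighted_energy_bound[OF V c cE] by blast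
  have wm: "weight c n \<in> borel_measurable L" if "n > 0" for n
    using measurable_compose[OF smooth_L_borel[OF smooth_weight[OF that, of c]] borel_measurable_Re] by simp
  have lim: "(\<lambda>n. ennreal ((weight c (real (Suc n)) x)\<^sup>2 * ?e x)) \<longlonglongrightarrow> ennreal (exp (2 * c * japanese_bracket x) * ?e x)" for x
  proof -
    have "(\<lambda>n. japanese_bracket x / real (Suc n)) \<longlonglongrightarrow> 0"
      using tendsto_mult_right_zero[OF LIMSEQ_Suc[OF lim_1_over_n], of "japanese_bracket x"] by simp
    then have "(\<lambda>n. (exp (c * (japanese_bracket x / (1 + japanese_bracket x / real (Suc n)))))\<^sup>2) \<longlonglongrightarrow> (exp (c * (japanese_bracket x / (1 + 0))))\<^sup>2"
      by (intro tendsto_intros) auto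
    moreover have "(exp (c * (japanese_bracket x / (1 + 0))))\<^sup>2 = exp (2 * c * japanese_bracket x)" by (simp add: exp_double[symmetric] mult.assoc)
    ultimately have "(\<lambda>n. (weight c (real (Suc n)) x)\<^sup>2) \<longlonglongrightarrow> exp (2 * c * japanese_bracket x)" by (simp add: weight_def)
    then show ?thesis by (intro tendsto_ennrealI tendsto_mult tendsto_const)
  qed
  have "(\<integral>\<^sup>+x. ennreal (?e x * exp (2 * c * norm x)) \<partial>L) \<le> (\<integral>\<^sup>+x. ennreal (exp (2 * c * japanese_bracket x) * ?e x) \<partial>L)"
  proof (intro nn_integral_mono ennreal_leI)
    fix x
    have "exp (2 * c * norm x) * ?e x \<le> exp (2 * c * japanese_bracket x) * ?e x"
      using japanese_bracket_bounds(2)[of x] c by (intro mult_right_mono) (auto intro: mult_left_mono)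
    then show "?e x * exp (2 * c * norm x) \<le> exp (2 * c * japanese_bracket x) * ?e x" by (simp add: mult.commute)
  qed
  also have "\<dots> = (\<integral>\<^sup>+x. liminf (\<lambda>n. ennreal ((weight c (real (Suc n)) x)\<^sup>2 * ?e x)) \<partial>L)"
    by (intro nn_integral_cong lim_imp_Liminf[symmetric] lim) simp
  also have "\<dots> \<le> liminf (\<lambda>n. \<integral>\<^sup>+x. ennreal ((weight c (real (Suc n)) x)\<^sup>2 * ?e x) \<partial>L)"
  proof (rule nn_integral_liminf)
    fix n
    have [measurable]: "weight c (real (Suc n)) \<in> borel_measurable L" by (rule wm) simp
    show "(\<lambda>x. ennreal ((weight c (real (Suc n)) x)\<^sup>2 * ?e x)) \<in> borel_measurable L" by measurable
  qed
  also have "\<dots> \<le> ennreal K"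
    by (rule Liminf_le) (auto intro!: always_eventually K)
  finally show ?thesis by (simp add: order_le_less_trans)
qed

end

theorem theorem5p1:
  fixes \<alpha> E \<epsilon> :: real and V :: "real \<times> real \<Rightarrow> complex"
  assumes "0 < \<alpha>" and "\<alpha> < pi / 2"
    and "discrete_eigenvalue (lebesgue_on (sector \<alpha>)) (robin_laplacian \<alpha>) (complex_of_real E)"
    and "is_eigenfunction (lebesgue_on (sector \<alpha>)) (robin_laplacian \<alpha>) (complex_of_real E) V"
    and "0 < \<epsilon>" and "\<epsilon> < 1"
  shows "(\<integral>\<^sup>+ x. ennreal (((norm (weak_grad (sector \<alpha>) V x))\<^sup>2 + (norm (V x))\<^sup>2)
            * exp (2 * (1 - \<epsilon>) * sqrt (- 1 - E) * norm x)) \<partial>lebesgue_on (sector \<alpha>)) < \<infinity>"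
proof -
  interpret acute_sector \<alpha> using assms(1,2) by unfold_locales
  have V: "(V, \<lambda>x. complex_of_real E * V x) \<in> robin_laplacian \<alpha>"
    using assms(4) by (simp add: is_eigenfunction_def eigenspace_def)
  define c where "c = (1 - \<epsilon>) * sqrt (- 1 - E)"
  show ?thesis
  proof (cases "E < - 1")
    case True
    have "c \<ge> 0" using True assms(6) by (simp add: c_def)
    moreover have "c\<^sup>2 < - 1 - E"
    proof -
      have "(1 - \<epsilon>)\<^sup>2 < 1" using assms(5,6) by (simp add: power_less_one_iff abs_square_less_1)
      then have "(1 - \<epsilon>)\<^sup>2 * (- 1 - E) < 1 * (- 1 - E)" using True by (intro mult_strict_right_mono) auto
      then show ?thesis using True by (simp add: c_def power_mult_distrib)
    qed
    ultimately have "(\<integral>\<^sup>+x. ennreal (((norm (weak_grad U V x))\<^sup>2 + (norm (V x))\<^sup>2) * exp (2 * c * norm x)) \<partial>L) < \<infinity>"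
      by (rule agmon_estimate[OF V])
    then show ?thesis unfolding U_def c_def by (simp only: mult.assoc)
  next
    case False
    have VH: "V \<in> H1 U" using V unfolding robin_laplacian_def form_operator_def U_def by auto
    have u: "V \<in> L2 L" "is_weak_gradient U V (weak_grad U V)" using VH H1_weak_gradient by (auto simp: H1_def)
    have i: "integrable L (\<lambda>x. (norm (weak_grad U V x))\<^sup>2 + (norm (V x))\<^sup>2)"
      using L2_integrable_sq[OF u(1)] L2_integrable_sq[OF weak_gradient_L2[OF u(2)]] by simp
    have "c \<le> 0" using False assms(6) by (simp add: c_def mult_nonneg_nonpos)
    have "(\<integral>\<^sup>+x. ennreal (((norm (weak_grad U V x))\<^sup>2 + (norm (V x))\<^sup>2) * exp (2 * c * norm x)) \<partial>L) \<le>
        (\<integral>\<^sup>+x. ennreal ((norm (weak_grad U V x))\<^sup>2 + (norm (V x))\<^sup>2) \<partial>L)"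
    proof (intro nn_integral_mono ennreal_leI mult_right_le_one_le)
      show "exp (2 * c * norm x) \<le> 1" for x using \<open>c \<le> 0\<close> by (simp add: mult_nonpos_nonneg)
    qed auto
    also have "\<dots> < \<infinity>"
      using nn_integral_eq_integral[OF i] by simp
    finally show ?thesis unfolding U_def c_def by (simp only: mult.assoc)
  qed
qed

end
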